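(* Let $\mathfrak{M}$ be an R-regular weight matrix of R-moderate growth such that there exists $M\in\mathfrak{M}$ with $\sum_{k\ge1}1/\mu_k<\infty$, where $\mu_k=M_k/M_{k-1}$. Then for every $d\ge1$ the ring ${}_d\mathcal{E}^{\{\mathfrak{M}\}}$ has property $(\mathscr{D})$.
   Context: A weight sequence is a sequence $M=(M_k)_{k\ge0}$ of positive reals with $M_k=\mu_1\cdots\mu_k$, $M_0=1$, where $(\mu_k)$ is positive and increasing with $\mu_0=1$, and $M_k^{1/k}\to\infty$; lowercase $m_k:=M_k/k!$ (similarly $n_k=N_k/k!$). For a positive sequence $m$ with $m_0=1$, $m_k^{1/k}\to\infty$, $m_{k+1}/m_k\to\infty$, set $h_m(t):=\inf_k m_kt^k$ ($t>0$), $\overline\Gamma_m(t):=\min\{k:h_m(t)=m_kt^k\}$, $\underline\Gamma_m(t):=\min\{k:m_{k+1}/m_k\ge1/t\}$. A weight matrix $\mathfrak{M}$ is a family of weight sequences totally ordered by the pointwise order. $\mathfrak{M}$ is R-regular if $m_k^{1/k}\to\infty$ for all $M\in\mathfrak{M}$, $\forall M\in\mathfrak{M}\ \exists N\in\mathfrak{M}\ \exists C\ge1\ \forall j: M_{j+1}\le C^{j+1}N_j$, and $\forall M\ \exists N\ \exists C\ge1\ \forall t>0: \overline\Gamma_n(Ct)\le\underline\Gamma_m(t)$. With $\mathrm{mg}(M,N):=\sup_{j,k\ge0,j+k\ge1}(M_{j+k}/(N_jN_k))^{1/(j+k)}$, $\mathfrak{M}$ has R-moderate growth if $\forall M\in\mathfrak{M}\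 \exists N\in\mathfrak{M}:\mathrm{mg}(M,N)<\infty$. For open $U\subseteq\mathbb{R}^d$ and $\sigma>0$, $\mathcal{B}^M_\sigma(U)$ is the set of $f\in C^\infty(U)$ with $\sup_{x\in U,\alpha}|\partial^\alpha f(x)|/(\sigma^{|\alpha|}M_{|\alpha|})<\infty$; $\mathcal{B}^{\{\mathfrak{M}\}}(U):=\bigcup_{M\in\mathfrak{M}}\bigcup_{\sigma>0}\mathcal{B}^M_\sigma(U)$, and $\mathcal{E}^{\{\mathfrak{M}\}}(U)$ is the set of $f:U\to\mathbb{C}$ with $f|_V\in\mathcal{B}^{\{\mathfrak{M}\}}(V)$ for every relatively compact open $V\subseteq U$. ${}_d\mathcal{E}^{\{\mathfrak{M}\}}$ is the ring of germs at $0\in\mathbb{R}^d$ of such functions. A subring $\mathcal{S}$ of the ring of germs at $0\in\mathbb{R}^d$ of complex valued $C^\infty$ functions has property $(\mathscr{D})$ if for every complex valued function germ $f$ at $0$: if $f^j,f^{j+1}\in\mathcal{S}$ for some integer $j\ge1$, then $f\in\mathcal{S}$. *)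

theory Defs
  imports "HOL-Analysis.Analysis"
begin

definition mu :: "(nat \<Rightarrow> real) \<Rightarrow> nat \<Rightarrow> real" where
  "mu M k = (if k = 0 then 1 else M k / M (k - 1))"

definition lower :: "(nat \<Rightarrow> real) \<Rightarrow> nat \<Rightarrow> real" where
  "lower M k = M k / fact k"

definition weight_seq :: "(nat \<Rightarrow> real) \<Rightarrow> bool" where
  "weight_seq M \<longleftrightarrow> M 0 = 1 \<and> (\<forall>k. 0 < M k) \<and> incseq (mu M)
     \<and> filterlim (\<lambda>k. root k (M k)) at_top sequentially"

definition weight_matrix :: "(nat \<Rightarrow> real) set \<Rightarrow> bool" where
  "weight_matrix W \<longleftrightarrow> W \<noteq> {} \<and> (\<forall>M\<in>W. weight_seq M)
     \<and> (\<forall>M\<in>W. \<forall>N\<in>W. (\<forall>k. M k \<le> N k) \<or> (\<forall>k. N k \<le> M k))"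

definition h_fun :: "(nat \<Rightarrow> real) \<Rightarrow> real \<Rightarrow> real" where
  "h_fun m t = (INF k. m k * t ^ k)"

definition Gamma_over :: "(nat \<Rightarrow> real) \<Rightarrow> real \<Rightarrow> nat" where
  "Gamma_over m t = (LEAST k. h_fun m t = m k * t ^ k)"

definition Gamma_under :: "(nat \<Rightarrow> real) \<Rightarrow> real \<Rightarrow> nat" where
  "Gamma_under m t = (LEAST k. m (Suc k) / m k \<ge> 1 / t)"

definition R_regular :: "(nat \<Rightarrow> real) set \<Rightarrow> bool" where
  "R_regular W \<longleftrightarrow>
     (\<forall>M\<in>W. filterlim (\<lambda>k. root k (lower M k)) at_top sequentially)
   \<and> (\<forall>M\<in>W. \<exists>N\<in>W. \<exists>C\<ge>1. \<forall>j. M (Suc j) \<le> C ^ (Suc j) * N j)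
   \<and> (\<forall>M\<in>W. \<exists>N\<in>W. \<exists>C\<ge>1. \<forall>t>0.
        Gamma_over (lower N) (C * t) \<le> Gamma_under (lower M) t)"

definition mg_finite :: "(nat \<Rightarrow> real) \<Rightarrow> (nat \<Rightarrow> real) \<Rightarrow> bool" where
  "mg_finite M N \<longleftrightarrow> (\<exists>C. \<forall>j k. j + k \<ge> 1 \<longrightarrow>
      (M (j + k) / (N j * N k)) powr (1 / real (j + k)) \<le> C)"

definition R_moderate_growth :: "(nat \<Rightarrow> real) set \<Rightarrow> bool" where
  "R_moderate_growth W \<longleftrightarrow> (\<forall>M\<in>W. \<exists>N\<in>W. mg_finite M N)"

definition pd :: "'n::finite \<Rightarrow> (real^'n \<Rightarrow> complex) \<Rightarrow> real^'n \<Rightarrow> complex" where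
  "pd i g x = vector_derivative (\<lambda>t. g (x + t *\<^sub>R axis i 1)) (at 0)"

fun iter_pd :: "'n::finite list \<Rightarrow> (real^'n \<Rightarrow> complex) \<Rightarrow> real^'n \<Rightarrow> complex" where
  "iter_pd [] f = f"
| "iter_pd (i # is) f = pd i (iter_pd is f)"

definition smooth_on :: "(real^'n::finite) set \<Rightarrow> (real^'n \<Rightarrow> complex) \<Rightarrow> bool" where
  "smooth_on U f \<longleftrightarrow> (\<forall>is. continuous_on U (iter_pd is f)
      \<and> (\<forall>x\<in>U. \<forall>i. (\<lambda>t. iter_pd is f (x + t *\<^sub>R axis i 1)) differentiable (at 0)))"

text \<open>Partial derivative for a multi-index alpha (well defined for smooth f by Schwarz).\<close>
definition deriv_multi :: "('n::finite \<Rightarrow> nat) \<Rightarrow> (real^'n \<Rightarrow> complex) \<Rightarrow> real^'n \<Rightarrow> complex" where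
  "deriv_multi \<alpha> f = iter_pd (SOME is. \<forall>i. count_list is i = \<alpha> i) f"

definition mi_len :: "('n::finite \<Rightarrow> nat) \<Rightarrow> nat" where
  "mi_len \<alpha> = (\<Sum>i\<in>UNIV. \<alpha> i)"

definition B_sigma :: "(nat \<Rightarrow> real) \<Rightarrow> real \<Rightarrow> (real^'n::finite) set \<Rightarrow> (real^'n \<Rightarrow> complex) \<Rightarrow> bool" where
  "B_sigma M \<sigma> U f \<longleftrightarrow> smooth_on U f \<and>
     (\<exists>C. \<forall>x\<in>U. \<forall>\<alpha>. norm (deriv_multi \<alpha> f x) \<le> C * \<sigma> ^ mi_len \<alpha> * M (mi_len \<alpha>))"

definition B_roum :: "(nat \<Rightarrow> real) set \<Rightarrow> (real^'n::finite) set \<Rightarrow> (real^'n \<Rightarrow> complex) \<Rightarrow> bool" where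
  "B_roum W U f \<longleftrightarrow> (\<exists>M\<in>W. \<exists>\<sigma>>0. B_sigma M \<sigma> U f)"

definition E_roum :: "(nat \<Rightarrow> real) set \<Rightarrow> (real^'n::finite) set \<Rightarrow> (real^'n \<Rightarrow> complex) \<Rightarrow> bool" where
  "E_roum W U f \<longleftrightarrow> (\<forall>V. open V \<and> compact (closure V) \<and> closure V \<subseteq> U \<longrightarrow> B_roum W V f)"

definition germ_E :: "(nat \<Rightarrow> real) set \<Rightarrow> (real^'n::finite \<Rightarrow> complex) \<Rightarrow> bool" where
  "germ_E W f \<longleftrightarrow> (\<exists>U. open U \<and> 0 \<in> U \<and> E_roum W U f)"

text \<open>Property (D) for a germ-invariant class S of function germs at 0.\<close>
definition property_D :: "(('a \<Rightarrow> complex) \<Rightarrow> bool) \<Rightarrow> bool" where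
  "property_D S \<longleftrightarrow> (\<forall>f j. j \<ge> 1 \<and> S (\<lambda>x. f x ^ j) \<and> S (\<lambda>x. f x ^ (j + 1)) \<longrightarrow> S f)"

end

theory Submission
  imports Defs "HOL-Complex_Analysis.Complex_Analysis" "HOL-Computational_Algebra.Fundamental_Theorem_Algebra"
begin

text \<open>
  Write \<open>g = f ^ j\<close> and \<open>h = f ^ (j + 1)\<close>. On a segment of length \<open>t\<close> parallel to a coordinate axis, Taylor's theorem
  approximates \<open>g\<close> and \<open>h\<close> by polynomials \<open>G\<close> and \<open>H\<close> of degree at most \<open>k\<close> with an error \<open>\<epsilon>\<close> so small that \<open>c ^ k\<close> is
  negligible against powers of \<open>\<epsilon>\<close>. Then \<open>H ^ j - G ^ (j + 1)\<close> is small on a complex disc, so \<open>\<bar>H / G\<bar> ^ j\<close> is about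
  \<open>\<bar>G\<bar>\<close> away from the zeros of \<open>G\<close>. The Cauchy integral \<open>F\<close> of \<open>H / G\<close> over the boundary of a square removes the
  poles: it differs from \<open>H / G\<close> only by integrals over curves where \<open>\<bar>G\<bar>\<close>, and with it \<open>H / G\<close>, is small. Hence \<open>F\<close>
  is holomorphic and approximates \<open>f\<close> on the segment to within a fixed power of \<open>\<epsilon>\<close>.

  Truncating the Taylor series of \<open>F\<close> and interpolating on tensor product grids gives approximations of \<open>f\<close> on cubes by
  polynomials in all variables. Their derivatives converge as \<open>t\<close> tends to \<open>0\<close>, by a Markov inequality applied to the
  differences for consecutive scales, which shows that \<open>f\<close> is smooth and bounds its derivatives of order \<open>a\<close> in terms of
  \<open>M k\<close> with \<open>k\<close> a fixed multiple of \<open>a + 4\<close>. Moderate growth absorbs the factor.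
\<close>

text \<open>Near the zeros of \<open>g\<close> the quotient \<open>h / g\<close> says nothing about
  \<open>f\<close>; only the smallness of \<open>f\<close>, through a \<open>j\<close>-th root,
  remains. Hence data accurate to a high fixed power of \<open>\<eta>\<close> yield \<open>f\<close>
  only to order \<open>\<eta>\<close>. A longer Taylor expansion pays for this: derivatives of order
  \<open>a\<close> use the expansion of order \<open>k = 2 ^ p * (a + 4)\<close>, with
  \<open>2 ^ p\<close> at least three times that power, and \<open>k\<close> stays fixed while the
  scale is halved. The factor is a power of 2 because moderate growth, applied to two equal halves,
  brings \<open>M (2 ^ p * b)\<close> down to order \<open>b\<close> in \<open>p\<close> steps.

  Interpolation in \<open>d\<close> variables with degree \<open>K\<close> costs a factor
  exponential in \<open>K * d\<close>. The degree of \<open>G\<close> and \<open>H\<close> is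
  dictated by \<open>k\<close>, but \<open>F\<close> is holomorphic and can be truncated at any
  degree: on a much smaller disc a small multiple of \<open>log (1 / \<eta>)\<close> suffices, and
  the cost drops to \<open>\<eta>\<close> to the power -1/3.

  In \<open>a + 4\<close>, two orders go to the second derivatives that control difference
  quotients, and two to convergence at a rate proportional to the square of the scale.\<close>

no_notation fps_nth (infixl "$" 75)

section \<open>Polynomials bounded on the unit interval\<close>

lemma poly_eq_sum_atMost:
  fixes p :: "'a::comm_semiring_1 poly"
  assumes "degree p \<le> n"
  shows "poly p x = (\<Sum>k\<le>n. coeff p k * x ^ k)"
proof -
  have "(\<Sum>k\<le>degree p. coeff p k * x ^ k) = (\<Sum>k\<le>n. coeff p k * x ^ k)"
    using assms by (intro sum.mono_neutral_left) (auto simp: coeff_eq_0)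
  then show ?thesis by (simp add: poly_altdef)
qed

text \<open>Bernstein-Walsh inequality. Under the Joukowski substitution
  \<open>z = (w + 1 / w) / 2\<close> the product of \<open>w ^ n\<close> and the value of
  \<open>p\<close> is a polynomial \<open>q\<close> in \<open>w\<close>. The unit circle lies over
  [-1, 1], so the maximum principle bounds \<open>q\<close> by \<open>S\<close> on the disc; the
  remaining factor bounds \<open>1 / w\<close> at a preimage \<open>w\<close> of \<open>z\<close> in
  the disc.\<close>

lemma norm_poly_le_of_unit_interval:
  fixes p :: "complex poly"
  assumes deg: "degree p \<le> n" and S: "\<And>s::real. \<bar>s\<bar> \<le> 1 \<Longrightarrow> norm (poly p (of_real s)) \<le> S"
  shows "norm (poly p z) \<le> (2 * norm z + 1) ^ n * S"
proof -
  define q where "q w = (\<Sum>k\<le>n. coeff p k * ((w\<^sup>2 + 1) / 2) ^ k * w ^ (n - k))" for w :: complex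
  have q: "q w = w ^ n * poly p ((w + 1 / w) / 2)" if "w \<noteq> 0" for w
  proof -
    have e: "(w\<^sup>2 + 1) / 2 = w * ((w + 1 / w) / 2)" using that by (simp add: field_simps power2_eq_square)
    have "coeff p k * ((w\<^sup>2 + 1) / 2) ^ k * w ^ (n - k) = w ^ n * (coeff p k * ((w + 1 / w) / 2) ^ k)"
      if "k \<le> n" for k
      unfolding e power_mult_distrib using that
      by (simp add: mult_ac flip: power_add)
    then show ?thesis unfolding q_def poly_eq_sum_atMost [OF deg] sum_distrib_left
      by (intro sum.cong) auto
  qed
  have b: "norm (q w) \<le> S" if "norm w = 1" for w
  proof -
    have w0: "w \<noteq> 0" using that by auto
    have "1 / w = cnj w" using that w0
      by (metis complex_norm_square divide_eq_eq mult.commute of_real_1 one_power2)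
    then have "(w + 1 / w) / 2 = of_real (Re w)" by (simp add: complex_add_cnj)
    moreover have "\<bar>Re w\<bar> \<le> 1" using abs_Re_le_cmod [of w] that by simp
    ultimately show ?thesis using S [of "Re w"] q [OF w0] that by (simp add: norm_mult norm_power)
  qed
  have le: "norm (q w) \<le> S" if "norm w \<le> 1" for w
  proof (rule maximum_modulus_frontier [of q "cball 0 1"])
    show "q holomorphic_on interior (cball 0 1)" unfolding q_def by (intro holomorphic_intros) auto
    show "continuous_on (closure (cball 0 1)) q" unfolding q_def by (intro continuous_intros) auto
  qed (use b that in auto)
  \<comment> \<open>The preimages \<open>z + s\<close> and \<open>z - s\<close> of \<open>z\<close>
    have product 1, so one of them lies in the closed unit disc, and its inverse is the other
    one.\<close>
  define s where "s = csqrt (z\<^sup>2 - 1)"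
  have ab: "(z + s) * (z - s) = 1" by (simp add: s_def algebra_simps flip: power2_eq_square)
  obtain w where w: "norm w \<le> 1" "w * (2 * z - w) = 1"
  proof (cases "norm (z + s) \<le> 1")
    case True then show ?thesis using that [of "z + s"] ab by simp
  next
    case False
    have "norm (z + s) * norm (z - s) = 1" using ab by (metis norm_mult norm_one)
    then have "norm (z - s) \<le> 1"
      using False by (smt (verit) mult_le_cancel_right2 norm_ge_zero)
    then show ?thesis using that [of "z - s"] ab by (simp add: mult.commute)
  qed
  have w0: "w \<noteq> 0" using w by auto
  have iw: "1 / w = 2 * z - w" using w w0 by (simp add: field_simps)
  then have "(w + 1 / w) / 2 = z" by simp
  then have "poly p z = q w * (1 / w) ^ n" using q [OF w0] w0 by (simp add: field_simps)
  then have "norm (poly p z) = norm (q w) * norm (2 * z - w) ^ n"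
    by (simp add: norm_mult norm_power iw)
  also have "\<dots> \<le> S * (2 * norm z + 1) ^ n"
  proof (intro mult_mono power_mono le)
    show "norm (2 * z - w) \<le> 2 * norm z + 1"
      using norm_triangle_ineq4 [of "2 * z" w] w by (simp add: norm_mult)
    show "0 \<le> S" by (rule order_trans [OF norm_ge_zero S [of 0]]) simp
  qed (use w in auto)
  finally show ?thesis by (simp add: mult.commute)
qed

text \<open>The balls of this norm are squares, which a square grid fills without remainder.\<close>

definition box_norm :: "complex \<Rightarrow> real" where
  "box_norm z = max \<bar>Re z\<bar> \<bar>Im z\<bar>"

lemma abs_le_box_norm: "\<bar>Re z\<bar> \<le> box_norm z" "\<bar>Im z\<bar> \<le> box_norm z"
  unfolding box_norm_def by (rule max.cobounded1, rule max.cobounded2)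

lemma box_norm_leI: "\<bar>Re z\<bar> \<le> b \<Longrightarrow> \<bar>Im z\<bar> \<le> b \<Longrightarrow> box_norm z \<le> b"
  unfolding box_norm_def by (rule max.boundedI)

lemma norm_le_box_norm: "norm z \<le> 2 * box_norm z"
  using order_trans [OF cmod_le add_mono [OF abs_le_box_norm [of z]]] by (simp only: mult_2)

lemma box_norm_le_norm: "box_norm z \<le> norm z"
  by (intro box_norm_leI abs_Re_le_cmod abs_Im_le_cmod)

lemma box_norm_nonneg: "0 \<le> box_norm z"
  by (rule order_trans [OF abs_ge_zero abs_le_box_norm(1)])

lemma box_norm_uminus: "box_norm (- z) = box_norm z"
  unfolding box_norm_def by simp

lemma box_norm_triangle: "box_norm (z + w) \<le> box_norm z + box_norm w"
  by (intro box_norm_leI) (auto intro!: order_trans [OF abs_triangle_ineq] add_mono abs_le_box_norm)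

lemma box_norm_diff: "\<bar>box_norm z - box_norm w\<bar> \<le> box_norm (z - w)"
  using box_norm_triangle [of "z - w" w] box_norm_triangle [of "w - z" z] box_norm_uminus [of "z - w"]
  by simp


section \<open>Products over the roots and a minimum modulus bound\<close>

lemma prod_mset_mono_nonneg:
  fixes f g :: "'a \<Rightarrow> real"
  assumes "\<And>x. x \<in># A \<Longrightarrow> 0 \<le> f x \<and> f x \<le> g x"
  shows "0 \<le> (\<Prod>x\<in>#A. f x) \<and> (\<Prod>x\<in>#A. f x) \<le> (\<Prod>x\<in>#A. g x)"
  using assms
proof (induction A)
  case (add a A)
  then have "0 \<le> f a" "f a \<le> g a" "0 \<le> (\<Prod>x\<in>#A. f x)" "(\<Prod>x\<in>#A. f x) \<le> (\<Prod>x\<in>#A. g x)" by auto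
  then show ?case by (auto intro!: mult_mono)
qed simp

lemma norm_poly_prod_mset:
  fixes a :: "'a \<Rightarrow> complex"
  shows "norm (poly (\<Prod>x\<in>#A. [:- a x, 1:]) z) = (\<Prod>x\<in>#A. norm (z - a x))"
  by (induction A) (auto simp: norm_mult simp flip: left_diff_distrib)

lemma degree_prod_mset_linear:
  fixes a :: "'a \<Rightarrow> complex"
  shows "degree (\<Prod>x\<in>#A. [:- a x, 1:]) \<le> size A"
proof (induction A)
  case (add x A)
  then show ?case using degree_mult_le [of "[:- a x, 1:]" "\<Prod>x\<in>#A. [:- a x, 1:]"] by simp
qed simp


text \<open>Replacing every root by its \<open>box_norm\<close> moves all roots to the real line and
  does not increase distances from points with \<open>box_norm z = r\<close>. So it suffices to find
  one good real number \<open>r\<close>, and by the Bernstein-Walsh bound a maximum point of the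
  modified polynomial on [1/2, 1] is good.\<close>

lemma poly_min_modulus_on_square:
  fixes p :: "complex poly"
  assumes deg: "degree p \<le> n"
  obtains r where "1 / 2 \<le> r" "r \<le> 1"
    "\<And>z w. box_norm z = r \<Longrightarrow> box_norm w \<le> 1 \<Longrightarrow> norm (poly p w) \<le> 44 ^ n * norm (poly p z)"
proof -
  define A where "A = proots p"
  define P where "P = (\<Prod>x\<in>#A. [:- of_real (box_norm x), 1:] :: complex poly)"
  \<comment> \<open>The substitution maps [-1, 1] onto [1/2, 1], the range allowed for
    \<open>r\<close>.\<close>
  define Q where "Q = pcompose P [:3 / 4, 1 / 4:]"
  have p: "norm (poly p z) = norm (lead_coeff p) * (\<Prod>x\<in>#A. norm (z - x))" for z
    using arg_cong [OF complex_poly_decompose_multiset [of p], of "\<lambda>q. norm (poly q z)"]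
    by (simp add: A_def norm_mult norm_poly_prod_mset)
  have sz: "size A \<le> n" using deg unfolding A_def
    by (metis degree_0 le_zero_eq order_trans proots_0 size_empty size_proots_complex zero_le)
  have "degree P \<le> size A" unfolding P_def by (rule degree_prod_mset_linear)
  then have dQ: "degree Q \<le> n" unfolding Q_def using sz by (simp add: degree_pcompose)
  have "\<exists>u\<in>{-1..1}. \<forall>v\<in>{-1..1}. norm (poly Q (of_real v)) \<le> norm (poly Q (of_real u))"
    by (intro continuous_attains_sup) (auto intro!: continuous_intros)
  then obtain u :: real where u: "\<bar>u\<bar> \<le> 1"
    "\<And>v::real. \<bar>v\<bar> \<le> 1 \<Longrightarrow> norm (poly Q (of_real v)) \<le> norm (poly Q (of_real u))"
    by (auto simp: abs_le_iff)
  define r where "r = 3 / 4 + u / 4"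
  have Qu: "norm (poly Q (of_real u)) = (\<Prod>x\<in>#A. \<bar>r - box_norm x\<bar>)"
  proof -
    have "norm (poly Q (of_real u)) = norm (poly P (of_real r))"
      by (simp add: Q_def r_def poly_pcompose)
    also have "\<dots> = (\<Prod>x\<in>#A. norm (complex_of_real r - of_real (box_norm x)))"
      unfolding P_def by (rule norm_poly_prod_mset)
    finally show ?thesis by (simp flip: of_real_diff)
  qed
  \<comment> \<open>The point \<open>v\<close> is sent to \<open>\<i>\<close>, which stays away from
    all the real roots. The growth factor at \<open>v\<close> is
    \<open>2 * 5 + 1 = 11\<close>.\<close>
  define v :: complex where "v = 4 * \<i> - 3"
  have nv: "norm v = 5" unfolding v_def by (simp add: cmod_def)
  have Qv: "norm (poly Q v) = (\<Prod>x\<in>#A. norm (\<i> - of_real (box_norm x)))"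
  proof -
    have "poly Q v = poly P \<i>" by (simp add: Q_def v_def poly_pcompose algebra_simps)
    then show ?thesis unfolding P_def by (simp only: norm_poly_prod_mset)
  qed
  have "norm (poly Q v) \<le> 11 ^ n * norm (poly Q (of_real u))"
    using norm_poly_le_of_unit_interval [OF dQ, of "norm (poly Q (of_real u))" v] u(2) nv by simp
  then have key: "(\<Prod>x\<in>#A. norm (\<i> - of_real (box_norm x))) \<le> 11 ^ n * (\<Prod>x\<in>#A. \<bar>r - box_norm x\<bar>)"
    using Qu Qv by simp
  \<comment> \<open>Here 44 = 4 * 11: the factor 4 compares distances from \<open>w\<close> with
    distances from \<open>\<i>\<close>, and 11 passes from \<open>\<i>\<close> to
    \<open>r\<close>.\<close>
  have main: "norm (poly p w) \<le> 44 ^ n * norm (poly p z)" if z: "box_norm z = r" and w: "box_norm w \<le> 1" for z w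
  proof -
    have 1: "norm (w - x) \<le> 4 * norm (\<i> - of_real (box_norm x))" for x
    proof -
      have "1 + box_norm x \<le> 2 * norm (\<i> - of_real (box_norm x))"
        using abs_Re_le_cmod [of "\<i> - of_real (box_norm x)"] abs_Im_le_cmod [of "\<i> - of_real (box_norm x)"]
          box_norm_nonneg [of x] by simp
      moreover have "box_norm (w - x) \<le> 1 + box_norm x"
        using w box_norm_triangle [of w "- x"] box_norm_uminus [of x] by simp
      ultimately show ?thesis using norm_le_box_norm [of "w - x"] by linarith
    qed
    have "(\<Prod>x\<in>#A. norm (w - x)) \<le> (\<Prod>x\<in>#A. 4 * norm (\<i> - of_real (box_norm x)))"
      by (rule conjunct2 [OF prod_mset_mono_nonneg]) (use 1 in auto)
    also have "\<dots> = 4 ^ size A * (\<Prod>x\<in>#A. norm (\<i> - of_real (box_norm x)))"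
      by (induction A) auto
    also have "\<dots> \<le> 4 ^ n * (11 ^ n * (\<Prod>x\<in>#A. \<bar>r - box_norm x\<bar>))"
      by (intro mult_mono key power_increasing sz)
         (auto intro: conjunct1 [OF prod_mset_mono_nonneg])
    also have "\<dots> = 44 ^ n * (\<Prod>x\<in>#A. \<bar>r - box_norm x\<bar>)" by (simp flip: power_mult_distrib)
    also have "\<dots> \<le> 44 ^ n * (\<Prod>x\<in>#A. norm (z - x))"
    proof (intro mult_left_mono conjunct2 [OF prod_mset_mono_nonneg])
      fix x
      have "\<bar>r - box_norm x\<bar> \<le> box_norm (z - x)" using z box_norm_diff [of z x] by simp
      then show "0 \<le> \<bar>r - box_norm x\<bar> \<and> \<bar>r - box_norm x\<bar> \<le> norm (z - x)"
        using box_norm_le_norm [of "z - x"] by simp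
    qed auto
    finally have "(\<Prod>x\<in>#A. norm (w - x)) \<le> 44 ^ n * (\<Prod>x\<in>#A. norm (z - x))" .
    then have "norm (lead_coeff p) * (\<Prod>x\<in>#A. norm (w - x))
        \<le> norm (lead_coeff p) * (44 ^ n * (\<Prod>x\<in>#A. norm (z - x)))"
      by (rule mult_left_mono) simp
    then show ?thesis unfolding p by (simp only: mult.left_commute)
  qed
  show ?thesis 
  proof (rule that)
    show "1 / 2 \<le> r" "r \<le> 1" using u(1) by (auto simp: r_def abs_le_iff)
  qed (rule main)
qed

text \<open>The function lives on a real segment, but the polynomial is complex, so that it can be
  continued off the segment.\<close>

definition poly_approx :: "nat \<Rightarrow> real \<Rightarrow> real \<Rightarrow> (real \<Rightarrow> complex) \<Rightarrow> bool" where
  "poly_approx n u e f \<longleftrightarrow>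
     (\<exists>q. degree q \<le> n \<and> (\<forall>s. \<bar>s\<bar> \<le> u \<longrightarrow> norm (f s - poly q (of_real s)) \<le> e))"

lemma poly_approx_mono: "poly_approx n u e f \<Longrightarrow> e \<le> e' \<Longrightarrow> poly_approx n u e' f"
  unfolding poly_approx_def by (meson order_trans)

lemma poly_approx_scale:
  assumes "poly_approx n (\<bar>c\<bar> * u) e f"
  shows "poly_approx n u e (\<lambda>s. f (c * s))"
proof -
  obtain q where q: "degree q \<le> n" "\<And>s. \<bar>s\<bar> \<le> \<bar>c\<bar> * u \<Longrightarrow> norm (f s - poly q (of_real s)) \<le> e"
    using assms unfolding poly_approx_def by blast
  have "degree (pcompose q [:0, of_real c:]) \<le> n"
    using q(1) order_trans [OF degree_pcompose_le [of q "[:0, complex_of_real c:]"]] by (auto split: if_splits)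
  moreover have "norm (f (c * s) - poly (pcompose q [:0, of_real c:]) (of_real s)) \<le> e" if "\<bar>s\<bar> \<le> u" for s
    using q(2) [of "c * s"] mult_left_mono [OF that, of "\<bar>c\<bar>"] by (simp add: poly_pcompose abs_mult mult.commute)
  ultimately show ?thesis unfolding poly_approx_def by blast
qed

text \<open>Conjugating the coefficients of \<open>g\<close> conjugates its values at real points,
  so the squared modulus along the line is a polynomial in the real parameter. Every crossing
  contains a root of \<open>q\<close>. Upward and downward crossings are counted separately, at most
  \<open>2 * n\<close> of each; the condition at \<open>x 0\<close> guarantees
  \<open>q \<noteq> 0\<close>.\<close>

lemma card_level_crossings:
  fixes G :: "complex poly" and x :: "nat \<Rightarrow> real"
  assumes deg: "degree G \<le> n" and x: "\<And>a. a < N \<Longrightarrow> x a < x (Suc a)" and \<delta>: "0 \<le> \<delta>"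
    and start: "\<delta> < norm (poly G (c + of_real (x 0) * d))"
  shows "card {a. a < N \<and> (\<delta> < norm (poly G (c + of_real (x a) * d)))
            \<noteq> (\<delta> < norm (poly G (c + of_real (x (Suc a)) * d)))} \<le> 4 * n"
proof -
  define \<phi> where "\<phi> s = norm (poly G (c + of_real s * d))" for s :: real
  define g where "g = pcompose G [:c, d:]"
  define q where "q = g * map_poly cnj g - [:of_real (\<delta>\<^sup>2):]"
  have pc: "poly (map_poly cnj g) (of_real s) = cnj (poly g (of_real s))" for s
    by (metis complex_cnj_complex_of_real poly_cnj)
  have q: "poly q (of_real s) = of_real ((\<phi> s)\<^sup>2 - \<delta>\<^sup>2)" for s
    by (simp add: q_def pc \<phi>_def g_def poly_pcompose complex_norm_square [symmetric])
  have "q \<noteq> 0"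
  proof
    assume "q = 0"
    then have "(\<phi> (x 0))\<^sup>2 - \<delta>\<^sup>2 = 0" using q [of "x 0"] by (metis of_real_eq_0_iff poly_0)
    then show False using start \<delta> by (simp add: \<phi>_def)
  qed
  have "degree g \<le> n"
    using order_trans [OF degree_pcompose_le [of G "[:c, d:]"], of n] deg
    unfolding g_def by (auto split: if_splits)
  moreover have "degree (map_poly cnj g) = degree g" by (simp add: degree_map_poly)
  ultimately have "degree (map_poly cnj g) \<le> n" "degree g \<le> n" by auto
  then have "degree q \<le> 2 * n" unfolding q_def
    by (intro degree_diff_le order_trans [OF degree_mult_le]) auto
  then have fin: "finite {z. poly q z = 0}" and cq: "card {z. poly q z = 0} \<le> 2 * n"
    using card_poly_roots_bound [OF \<open>q \<noteq> 0\<close>] poly_roots_finite [OF \<open>q \<noteq> 0\<close>] by auto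
  have cont: "continuous_on S \<phi>" for S unfolding \<phi>_def by (intro continuous_intros)
  have root: "poly q (of_real s) = 0" if "\<phi> s = \<delta>" for s using q [of s] that by simp
  \<comment> \<open>\<open>U\<close> collects the descents and \<open>D\<close> the ascents. For a
    descent the root can be kept off the left end of its interval, for an ascent off the right end;
    so different intervals of one kind have different roots even if a root is a common
    endpoint.\<close>
  define U where "U = {a. a < N \<and> \<delta> < \<phi> (x a) \<and> \<phi> (x (Suc a)) \<le> \<delta>}"
  define D where "D = {a. a < N \<and> \<phi> (x a) \<le> \<delta> \<and> \<delta> < \<phi> (x (Suc a))}"
  have mono: "x (Suc a) \<le> x b" if "a < b" "b \<le> N" for a b
    using that
  proof (induction b)
    case (Suc b)
    then show ?case using x [of b] by (cases "a = b") auto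
  qed simp
  have "\<forall>a\<in>U. \<exists>s. x a < s \<and> s \<le> x (Suc a) \<and> \<phi> s = \<delta>"
  proof
    fix a assume a: "a \<in> U"
    then have "\<exists>s\<ge>x a. s \<le> x (Suc a) \<and> \<phi> s = \<delta>"
      using x [of a] by (intro IVT2') (auto simp: U_def intro: cont)
    then show "\<exists>s. x a < s \<and> s \<le> x (Suc a) \<and> \<phi> s = \<delta>" using a by (force simp: U_def less_le)
  qed
  then obtain f where f: "\<And>a. a \<in> U \<Longrightarrow> x a < f a \<and> f a \<le> x (Suc a) \<and> \<phi> (f a) = \<delta>" by metis
  have "\<forall>a\<in>D. \<exists>s. x a \<le> s \<and> s < x (Suc a) \<and> \<phi> s = \<delta>"
  proof
    fix a assume a: "a \<in> D"
    then have "\<exists>s\<ge>x a. s \<le> x (Suc a) \<and> \<phi> s = \<delta>"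
      using x [of a] by (intro IVT') (auto simp: D_def intro: cont)
    then show "\<exists>s. x a \<le> s \<and> s < x (Suc a) \<and> \<phi> s = \<delta>" using a by (force simp: D_def less_le)
  qed
  then obtain h where h: "\<And>a. a \<in> D \<Longrightarrow> x a \<le> h a \<and> h a < x (Suc a) \<and> \<phi> (h a) = \<delta>" by metis
  have "card U \<le> card {z. poly q z = 0}"
  proof (rule card_inj_on_le [of "\<lambda>a. of_real (f a)"])
    show "inj_on (\<lambda>a. complex_of_real (f a)) U"
    proof (rule linorder_inj_onI)
      fix a b assume "a < b" "a \<in> U" "b \<in> U"
      then show "complex_of_real (f a) \<noteq> of_real (f b)"
        using f [of a] f [of b] mono [of a b] by (auto simp: U_def)
    qed auto
  qed (use f root fin in auto)
  moreover have "card D \<le> card {z. poly q z = 0}"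
  proof (rule card_inj_on_le [of "\<lambda>a. of_real (h a)"])
    show "inj_on (\<lambda>a. complex_of_real (h a)) D"
    proof (rule linorder_inj_onI)
      fix a b assume "a < b" "a \<in> D" "b \<in> D"
      then show "complex_of_real (h a) \<noteq> of_real (h b)"
        using h [of a] h [of b] mono [of a b] by (auto simp: D_def)
    qed auto
  qed (use h root fin in auto)
  moreover have "{a. a < N \<and> (\<delta> < \<phi> (x a)) \<noteq> (\<delta> < \<phi> (x (Suc a)))} \<subseteq> U \<union> D"
    by (auto simp: U_def D_def)
  then have "card {a. a < N \<and> (\<delta> < \<phi> (x a)) \<noteq> (\<delta> < \<phi> (x (Suc a)))} \<le> card U + card D"
    by (rule order_trans [OF card_mono card_Un_le, rotated]) (auto simp: U_def D_def)
  ultimately show ?thesis using cq unfolding \<phi>_def by linarith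
qed

section \<open>Separating a polynomial quotient from its poles\<close>

definition edge_h :: "(nat \<Rightarrow> real) \<Rightarrow> (complex \<Rightarrow> complex) \<Rightarrow> nat \<Rightarrow> nat \<Rightarrow> complex" where
  "edge_h x w a b = contour_integral (linepath (Complex (x a) (x b)) (Complex (x (Suc a)) (x b))) w"

definition edge_v :: "(nat \<Rightarrow> real) \<Rightarrow> (complex \<Rightarrow> complex) \<Rightarrow> nat \<Rightarrow> nat \<Rightarrow> complex" where
  "edge_v x w a b = contour_integral (linepath (Complex (x a) (x b)) (Complex (x a) (x (Suc b)))) w"

text \<open>The derivative falls on the kernel alone, so continuity of \<open>\<phi>\<close> on the
  segment is enough.\<close>

lemma holomorphic_on_contour_integral_linepath:
  assumes c: "continuous_on (closed_segment a b) \<phi>" and S: "open S" "S \<inter> closed_segment a b = {}"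
  shows "(\<lambda>z. contour_integral (linepath a b) (\<lambda>\<zeta>. \<phi> \<zeta> / (\<zeta> - z))) holomorphic_on S"
proof -
  have "(\<lambda>\<zeta>. \<phi> \<zeta> / (\<zeta> - z)) contour_integrable_on (linepath a b)" if "z \<in> S" for z
    using S that by (intro contour_integrable_continuous_linepath continuous_intros c) auto
  then have i: "((\<lambda>u. \<phi> u / (u - z) ^ 1) has_contour_integral
      contour_integral (linepath a b) (\<lambda>\<zeta>. \<phi> \<zeta> / (\<zeta> - z))) (linepath a b)" if "z \<in> S" for z
    using that by (simp add: has_contour_integral_integral)
  show ?thesis
    unfolding holomorphic_on_def field_differentiable_def
  proof
    fix z assume z: "z \<in> S"
    have "((\<lambda>z. contour_integral (linepath a b) (\<lambda>\<zeta>. \<phi> \<zeta> / (\<zeta> - z))) has_field_derivative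
        of_nat 1 * contour_integral (linepath a b) (\<lambda>u. \<phi> u / (u - z) ^ Suc 1)) (at z)"
    proof (rule Cauchy_next_derivative(2))
      show "norm (vector_derivative (linepath a b) (at t)) \<le> norm (b - a)" for t
        by (simp add: vector_derivative_linepath_at)
    qed (use c i z S in auto)
    then show "\<exists>f'. ((\<lambda>z. contour_integral (linepath a b) (\<lambda>\<zeta>. \<phi> \<zeta> / (\<zeta> - z))) has_field_derivative f') (at z within S)"
      using has_field_derivative_at_within by blast
  qed
qed

text \<open>Cauchy's formula and Cauchy's theorem in one statement, with all four edges oriented to
  the right or upwards. In this form the integrals over an edge shared by two grid cells are the
  same term with opposite signs.\<close>

lemma contour_integral_square:
  fixes x y x' y' :: real
  defines "h \<equiv> \<lambda>t. contour_integral (linepath (Complex x t) (Complex x' t))"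
    and "v \<equiv> \<lambda>s. contour_integral (linepath (Complex s y) (Complex s y'))"
  assumes le: "x < x'" "y < y'"
    and hol: "\<phi> holomorphic_on cbox (Complex x y) (Complex x' y')"
    and off: "Re z \<noteq> x" "Re z \<noteq> x'" "Im z \<noteq> y" "Im z \<noteq> y'"
  defines "w \<equiv> \<lambda>\<zeta>. \<phi> \<zeta> / (\<zeta> - z)"
  shows "h y w + v x' w - h y' w - v x w
       = (if x < Re z \<and> Re z < x' \<and> y < Im z \<and> Im z < y' then 2 * pi * \<i> * \<phi> z else 0)"
proof -
  let ?Q = "cbox (Complex x y) (Complex x' y')" and ?R = "rectpath (Complex x y) (Complex x' y')"
  have pi: "path_image ?R = {u. Re u \<in> {x, x'} \<and> Im u \<in> {y..y'}} \<union> {u. Im u \<in> {y, y'} \<and> Re u \<in> {x..x'}}"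
    using le by (subst path_image_rectpath) auto
  have sub: "path_image ?R \<subseteq> ?Q" using le by (intro path_image_rectpath_subset_cbox) auto
  have zn: "z \<notin> path_image ?R" using off unfolding pi by auto
  have seg: "closed_segment (Complex x y) (Complex x' y) \<subseteq> path_image ?R"
     "closed_segment (Complex x y') (Complex x' y') \<subseteq> path_image ?R"
     "closed_segment (Complex x y) (Complex x y') \<subseteq> path_image ?R"
     "closed_segment (Complex x' y) (Complex x' y') \<subseteq> path_image ?R"
    using le unfolding pi by (auto simp: closed_segment_same_Re closed_segment_same_Im closed_segment_eq_real_ivl)
  have cont: "continuous_on A w" if "A \<subseteq> path_image ?R" for A
    unfolding w_def using zn that sub
    by (intro continuous_intros continuous_on_subset [OF holomorphic_on_imp_continuous_on [OF hol]]) auto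
  have I: "w contour_integrable_on linepath (Complex x y) (Complex x' y)"
     "w contour_integrable_on linepath (Complex x y') (Complex x' y')"
     "w contour_integrable_on linepath (Complex x y) (Complex x y')"
     "w contour_integrable_on linepath (Complex x' y) (Complex x' y')"
     "w contour_integrable_on linepath (Complex x' y') (Complex x y')"
     "w contour_integrable_on linepath (Complex x y') (Complex x y)"
    using seg by (auto intro!: contour_integrable_continuous_linepath cont simp: closed_segment_commute [of "Complex x' y'"] closed_segment_commute [of "Complex x y'" "Complex x y"])
  have r: "contour_integral (linepath (Complex x' y') (Complex x y')) w = - h y' w"
    "contour_integral (linepath (Complex x y') (Complex x y)) w = - v x w"
    unfolding h_def v_def
    using seg by (auto intro!: contour_integral_reverse_linepath cont simp: closed_segment_commute [of "Complex x' y'"] closed_segment_commute [of "Complex x y'" "Complex x y"])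
  have lhs: "contour_integral ?R w = h y w + v x' w - h y' w - v x w"
    unfolding rectpath_def Let_def by (simp add: I r) (simp add: h_def v_def)
  have "contour_integral ?R w = (if x < Re z \<and> Re z < x' \<and> y < Im z \<and> Im z < y' then 2 * pi * \<i> * \<phi> z else 0)"
  proof (cases "x < Re z \<and> Re z < x' \<and> y < Im z \<and> Im z < y'")
    case True
    then have zb: "z \<in> box (Complex x y) (Complex x' y')" by (simp add: in_box_complex_iff)
    have "(w has_contour_integral (2*pi * \<i> * winding_number ?R z * \<phi> z)) ?R"
      unfolding w_def
      by (rule Cauchy_integral_formula_convex_simple [OF convex_box(1) hol])
         (use zb sub zn in \<open>auto simp: interior_cbox\<close>)
    then show ?thesis using True winding_number_rectpath [OF zb] by (auto dest: contour_integral_unique)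
  next
    case False
    then have "z \<notin> ?Q" using off by (auto simp: in_cbox_complex_iff)
    then have "w holomorphic_on ?Q" unfolding w_def by (intro holomorphic_intros hol) auto
    then have "(w has_contour_integral 0) ?R"
      by (rule Cauchy_theorem_convex_simple) (use sub in auto)
    then show ?thesis using False by (auto dest: contour_integral_unique)
  qed
  then show ?thesis using lhs by simp
qed

text \<open>Abel summation. With \<open>c\<close> the indicator of the kept cells, an inner edge
  survives only where the indicator changes.\<close>

lemma sum_telescope_weighted:
  fixes h :: "nat \<Rightarrow> 'a::comm_ring_1"
  shows "(\<Sum>b<Suc n. c b * (h b - h (Suc b)))
       = c 0 * h 0 - c n * h (Suc n) + (\<Sum>b<n. (c (Suc b) - c b) * h (Suc b))"
  by (induction n) (auto simp: algebra_simps)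

lemma norm_weighted_sum_le:
  fixes h :: "nat \<Rightarrow> complex"
  assumes card: "card {b. b < n \<and> p b \<noteq> p (Suc b)} \<le> k"
    and h: "\<And>b. b < n \<Longrightarrow> p b \<noteq> p (Suc b) \<Longrightarrow> norm (h b) \<le> M" and M: "0 \<le> M"
  shows "norm (\<Sum>b<n. (of_bool (p (Suc b)) - of_bool (p b)) * h b) \<le> k * M"
proof -
  let ?B = "{b. b < n \<and> p b \<noteq> p (Suc b)}"
  have "(\<Sum>b<n. (of_bool (p (Suc b)) - of_bool (p b)) * h b)
      = (\<Sum>b\<in>?B. (of_bool (p (Suc b)) - of_bool (p b)) * h b)"
    by (rule sum.mono_neutral_right) auto
  also have "norm \<dots> \<le> of_nat (card ?B) * M"
    by (rule sum_norm_bound) (use h in \<open>auto simp: norm_mult\<close>)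
  also have "\<dots> \<le> k * M" using card M by (intro mult_right_mono) auto
  finally show ?thesis .
qed

lemma box_norm_less_eq_box: "{z. box_norm z < r} = box (Complex (- r) (- r)) (Complex r r)"
  by (auto simp: in_box_complex_iff box_norm_def)

lemma box_norm_le_eq_cbox: "{z. box_norm z \<le> r} = cbox (Complex (- r) (- r)) (Complex r r)"
  by (auto simp: in_cbox_complex_iff box_norm_def)

text \<open>
  \<open>F\<close> is the Cauchy integral of \<open>H / G\<close> over the boundary of the square. Cutting the square into a fine grid, the
  difference to \<open>H / G\<close> becomes a sum over those inner edges that separate cells with \<open>\<bar>G\<bar> \<le> \<delta>\<close> at the centre from
  cells with \<open>\<bar>G\<bar> > \<delta>\<close>. On these edges \<open>H / G\<close> is at most \<open>m\<close>, and each grid line contains at most \<open>4 n\<close> of them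
  because \<open>\<bar>G\<bar>\<^sup>2 - \<delta>\<^sup>2\<close> is a polynomial of degree \<open>2 n\<close> on it; so their total length is bounded independently of
  the mesh.
\<close>
lemma norm_poly_separation:
  fixes G H :: "complex poly"
  assumes deg: "degree G \<le> n" and r: "0 < r" and \<delta>: "0 < \<delta>" and m: "0 \<le> m"
    and bd: "\<And>z. box_norm z = r \<Longrightarrow> 2 * \<delta> \<le> norm (poly G z)"
    and small: "\<And>z. box_norm z \<le> r \<Longrightarrow> \<delta> / 2 \<le> norm (poly G z) \<Longrightarrow> norm (poly G z) \<le> 2 * \<delta>
        \<Longrightarrow> norm (poly H z) \<le> m * norm (poly G z)"
  obtains F where "F holomorphic_on {z. box_norm z < r}"
    "\<And>z \<kappa>. box_norm z < r \<Longrightarrow> 0 < \<kappa> \<Longrightarrow> 2 * \<delta> < norm (poly G z)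
       \<Longrightarrow> (\<And>\<zeta>. box_norm \<zeta> \<le> r \<Longrightarrow> norm (poly G \<zeta>) \<le> 2 * \<delta> \<Longrightarrow> \<kappa> \<le> norm (\<zeta> - z))
       \<Longrightarrow> norm (F z - poly H z / poly G z) \<le> 32 * real n * r * m / \<kappa>"
proof -
  define K where "K = {z. box_norm z \<le> r}"
  define S where "S = {z. box_norm z < r}"
  have "compact K" unfolding K_def box_norm_le_eq_cbox by simp
  have "open S" unfolding S_def box_norm_less_eq_box by (rule open_box)
  have "uniformly_continuous_on K (poly G)"
    by (intro compact_uniformly_continuous \<open>compact K\<close> continuous_intros)
  then obtain d where d: "d > 0"
    "\<And>z w. z \<in> K \<Longrightarrow> w \<in> K \<Longrightarrow> norm (z - w) < d \<Longrightarrow> norm (poly G z - poly G w) < \<delta> / 4"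
    using \<delta> unfolding uniformly_continuous_on_def dist_norm by (metis divide_pos_pos zero_less_numeral)
  obtain M :: nat where M: "2 * r / d < real M" using reals_Archimedean2 by blast
  define N where "N = Suc M"
  define s where "s = 2 * r / N"
  define x where "x a = - r + real a * s" for a :: nat
  have s: "0 < s" "real N * s = 2 * r" unfolding s_def N_def using r by auto
  have "2 * r / d < real N" using M unfolding N_def by simp
  then have sd: "s < d" using d(1) r unfolding s_def N_def by (simp add: field_simps)
  have x_Suc: "x (Suc a) = x a + s" for a by (simp add: x_def algebra_simps)
  have x0: "x 0 = - r" and xN: "x N = r" using s by (auto simp: x_def)
  have x_mono: "x a \<le> x b" if "a \<le> b" for a b using that s unfolding x_def by simp
  have x_ge: "- r \<le> x a" for a using x_mono [of 0 a] x0 by simp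
  have x_le: "x a \<le> r" if "a \<le> N" for a using x_mono [OF that] xN by simp
  define cen where "cen a b = Complex (x a + s / 2) (x b + s / 2)" for a b
  \<comment> \<open>A cell is kept or discarded as a whole. Since \<open>\<bar>G\<bar>\<close>
    varies by less than \<open>\<delta> / 4\<close> from the centre, kept cells contain no zero of
    \<open>G\<close>, and on an edge between a kept and a discarded cell
    \<open>\<bar>G\<bar>\<close> lies between \<open>\<delta> / 2\<close> and
    \<open>2 * \<delta>\<close>.\<close>
  define inn where "inn a b \<longleftrightarrow> \<delta> < norm (poly G (cen a b))" for a b
  have sq: "\<zeta> \<in> K \<and> \<bar>norm (poly G \<zeta>) - norm (poly G (cen a b))\<bar> < \<delta> / 4"
    if "a < N" "b < N" "x a \<le> Re \<zeta>" "Re \<zeta> \<le> x (Suc a)" "x b \<le> Im \<zeta>" "Im \<zeta> \<le> x (Suc b)" for a b \<zeta>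
  proof -
    have xs: "x (Suc a) \<le> r" "x (Suc b) \<le> r" using x_le that by auto
    have z: "\<zeta> \<in> K" unfolding K_def mem_Collect_eq
      by (rule box_norm_leI) (use that xs x_ge [of a] x_ge [of b] in linarith)+
    have c: "cen a b \<in> K" unfolding K_def mem_Collect_eq
      by (rule box_norm_leI) (use s xs x_ge [of a] x_ge [of b] in \<open>simp_all add: cen_def x_Suc abs_le_iff\<close>)
    have "\<bar>Re (\<zeta> - cen a b)\<bar> \<le> s / 2" "\<bar>Im (\<zeta> - cen a b)\<bar> \<le> s / 2"
      using that unfolding x_Suc cen_def minus_complex.sel complex.sel abs_le_iff by linarith+
    then have "norm (\<zeta> - cen a b) < d" using cmod_le [of "\<zeta> - cen a b"] sd by linarith
    then have "norm (poly G \<zeta> - poly G (cen a b)) < \<delta> / 4" using d(2) z c by blast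
    then show ?thesis using z norm_triangle_ineq3 [of "poly G \<zeta>" "poly G (cen a b)"] by auto
  qed
  \<comment> \<open>All cells along the border are kept, so the outer edges enter with weight 1 and
    together form the full boundary integral in \<open>F\<close>.\<close>
  have inn_bd: "inn a b" if "a < N" "b < N" "a = 0 \<or> a = M \<or> b = 0 \<or> b = M" for a b
  proof -
    define \<zeta> where "\<zeta> = Complex (if a = M then r else x a) (if b = M then r else x b)"
    have sM: "x (Suc M) = r" using xN N_def by simp
    have 1: "x a \<le> Re \<zeta>" "Re \<zeta> \<le> x (Suc a)" "x b \<le> Im \<zeta>" "Im \<zeta> \<le> x (Suc b)"
      using that sM s x_le [of a] x_le [of b] unfolding \<zeta>_def by (auto simp: x_Suc)
    have "\<bar>Re \<zeta>\<bar> = r \<or> \<bar>Im \<zeta>\<bar> = r" using that(3) r x0 unfolding \<zeta>_def by auto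
    moreover have "box_norm \<zeta> \<le> r" using sq [OF that(1,2) 1] by (simp add: K_def)
    ultimately have "box_norm \<zeta> = r" using abs_le_box_norm [of \<zeta>] by linarith
    then show ?thesis using sq [OF that(1,2) 1] bd [of \<zeta>] \<delta> unfolding inn_def by linarith
  qed
  have nz: "poly G \<zeta> \<noteq> 0" if "box_norm \<zeta> = r" for \<zeta> using bd [OF that] \<delta> by auto
  define \<phi> where "\<phi> \<zeta> = poly H \<zeta> / poly G \<zeta>" for \<zeta>
  define w where "w z = (\<lambda>\<zeta>. \<phi> \<zeta> / (\<zeta> - z))" for z
  define F where "F z = ((\<Sum>a<N. edge_h x (w z) a 0 - edge_h x (w z) a N)
      + (\<Sum>b<N. edge_v x (w z) N b - edge_v x (w z) 0 b)) / (2 * pi * \<i>)" for z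
  have bdry: "closed_segment (Complex (x a) (x 0)) (Complex (x (Suc a)) (x 0)) \<subseteq> {z. box_norm z = r}"
    "closed_segment (Complex (x a) (x N)) (Complex (x (Suc a)) (x N)) \<subseteq> {z. box_norm z = r}"
    "closed_segment (Complex (x 0) (x a)) (Complex (x 0) (x (Suc a))) \<subseteq> {z. box_norm z = r}"
    "closed_segment (Complex (x N) (x a)) (Complex (x N) (x (Suc a))) \<subseteq> {z. box_norm z = r}"
    if "a < N" for a
  proof -
    have "- r \<le> x a" "x a \<le> x (Suc a)" "x (Suc a) \<le> r" using x_ge x_le [of "Suc a"] that s x_Suc by auto
    moreover have "box_norm u = r" if "\<bar>Re u\<bar> = r \<and> - r \<le> Im u \<and> Im u \<le> r \<or> \<bar>Im u\<bar> = r \<and> - r \<le> Re u \<and> Re u \<le> r" for u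
    proof (rule antisym)
      show "box_norm u \<le> r" using that by (intro box_norm_leI) (auto simp: abs_le_iff)
      show "r \<le> box_norm u" using that abs_le_box_norm [of u] by auto
    qed
    ultimately show "closed_segment (Complex (x a) (x 0)) (Complex (x (Suc a)) (x 0)) \<subseteq> {z. box_norm z = r}"
    "closed_segment (Complex (x a) (x N)) (Complex (x (Suc a)) (x N)) \<subseteq> {z. box_norm z = r}"
    "closed_segment (Complex (x 0) (x a)) (Complex (x 0) (x (Suc a))) \<subseteq> {z. box_norm z = r}"
    "closed_segment (Complex (x N) (x a)) (Complex (x N) (x (Suc a))) \<subseteq> {z. box_norm z = r}"
      using r unfolding x0 xN
      by (auto simp: closed_segment_same_Re closed_segment_same_Im closed_segment_eq_real_ivl)
  qed
  have hol_edge: "(\<lambda>z. contour_integral (linepath u v) (\<lambda>\<zeta>. \<phi> \<zeta> / (\<zeta> - z))) holomorphic_on S"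
    if "closed_segment u v \<subseteq> {z. box_norm z = r}" for u v
  proof (rule holomorphic_on_contour_integral_linepath [OF _ \<open>open S\<close>])
    show "continuous_on (closed_segment u v) \<phi>" unfolding \<phi>_def
      using that nz by (intro continuous_intros) auto
    show "S \<inter> closed_segment u v = {}" using that unfolding S_def by auto
  qed
  have holF: "F holomorphic_on S"
    unfolding F_def w_def edge_h_def edge_v_def using bdry
    by (intro holomorphic_intros hol_edge) auto
  have off: "norm (F z - \<phi> z) \<le> 16 * real n * r * m / \<kappa>"
    if z: "box_norm z < r" and \<kappa>: "0 < \<kappa>" and Gz: "2 * \<delta> < norm (poly G z)"
      and far: "\<And>\<zeta>. box_norm \<zeta> \<le> r \<Longrightarrow> norm (poly G \<zeta>) \<le> 2 * \<delta> \<Longrightarrow> \<kappa> \<le> norm (\<zeta> - z)"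
      and gr: "\<And>a. a \<le> N \<Longrightarrow> Re z \<noteq> x a \<and> Im z \<noteq> x a" for z \<kappa>
  proof -
    let ?h = "edge_h x (w z)" and ?v = "edge_v x (w z)"
    define C :: "nat \<Rightarrow> nat \<Rightarrow> complex" where "C a b = of_bool (inn a b)" for a b
    have ex: "\<exists>a<N. \<forall>a'. x a' < t \<and> t < x (Suc a') \<longleftrightarrow> a' = a" if t: "\<bar>t\<bar> < r" "\<And>a. a \<le> N \<Longrightarrow> t \<noteq> x a" for t
    proof -
      define a1 where "a1 = (LEAST a. t < x a)"
      have "t < x N" using t(1) xN by auto
      then have a1: "t < x a1" "a1 \<le> N" unfolding a1_def by (rule LeastI, rule Least_le)
      then obtain a where a: "a1 = Suc a" using x0 t(1) by (cases a1) auto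
      have "\<not> t < x a" using not_less_Least [of a "\<lambda>a. t < x a"] a unfolding a1_def by simp
      then have xa: "x a < t" using t(2) [of a] a a1(2) by fastforce
      have uniq: "a' = a" if "x a' < t" "t < x (Suc a')" for a'
      proof (rule ccontr)
        assume "a' \<noteq> a"
        then consider "Suc a' \<le> a" | "Suc a \<le> a'" by linarith
        then show False using x_mono [of "Suc a'" a] x_mono [of "Suc a" a'] that xa a1(1) a by cases auto
      qed
      have "t < x (Suc a)" "a < N" using a1 a by auto
      show ?thesis
      proof (intro exI conjI allI iffI)
        show "a < N" by fact
        show "a' = a" if "x a' < t \<and> t < x (Suc a')" for a' using that uniq by blast
        show "x a' < t" "t < x (Suc a')" if "a' = a" for a'
          unfolding that by fact+
      qed
    qed
    have "\<bar>Re z\<bar> < r" "\<bar>Im z\<bar> < r" using z abs_le_box_norm [of z] by auto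
    note zr = this
    have ne: "\<And>a. a \<le> N \<Longrightarrow> Re z \<noteq> x a" "\<And>a. a \<le> N \<Longrightarrow> Im z \<noteq> x a" using gr by auto
    have "\<exists>a<N. \<forall>a'. x a' < Re z \<and> Re z < x (Suc a') \<longleftrightarrow> a' = a"
      by (rule ex [OF zr(1) ne(1)])
    moreover have "\<exists>a<N. \<forall>a'. x a' < Im z \<and> Im z < x (Suc a') \<longleftrightarrow> a' = a"
      by (rule ex [OF zr(2) ne(2)])
    ultimately obtain a0 b0 where a0: "a0 < N" "\<And>a'. x a' < Re z \<and> Re z < x (Suc a') \<longleftrightarrow> a' = a0"
       and b0: "b0 < N" "\<And>a'. x a' < Im z \<and> Im z < x (Suc a') \<longleftrightarrow> a' = b0"
      by blast
    have inn0: "inn a0 b0"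
      using sq [of a0 b0 z] a0(1) b0(1) a0(2) [of a0] b0(2) [of b0] Gz \<delta> unfolding inn_def by linarith
    \<comment> \<open>Discarded cells have weight 0. The cell containing \<open>z\<close> is kept
      because \<open>\<bar>G\<bar>\<close> exceeds \<open>2 * \<delta>\<close> at \<open>z\<close>,
      and it alone contributes.\<close>
    have cell: "C a b * (?h a b + ?v (Suc a) b - ?h a (Suc b) - ?v a b)
        = (if a = a0 then if b = b0 then 2 * pi * \<i> * \<phi> z else 0 else 0)" if "a < N" "b < N" for a b
    proof (cases "inn a b")
      case True
      have hol: "\<phi> holomorphic_on cbox (Complex (x a) (x b)) (Complex (x (Suc a)) (x (Suc b)))"
        unfolding \<phi>_def
      proof (intro holomorphic_intros)
        fix \<zeta> assume "\<zeta> \<in> cbox (Complex (x a) (x b)) (Complex (x (Suc a)) (x (Suc b)))"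
        then show "poly G \<zeta> \<noteq> 0" using sq [of a b \<zeta>] that True \<delta> unfolding inn_def
          by (auto simp: in_cbox_complex_iff)
      qed
      have "?h a b + ?v (Suc a) b - ?h a (Suc b) - ?v a b
         = (if x a < Re z \<and> Re z < x (Suc a) \<and> x b < Im z \<and> Im z < x (Suc b) then 2 * pi * \<i> * \<phi> z else 0)"
        unfolding edge_h_def edge_v_def w_def
        by (rule contour_integral_square [OF _ _ hol]) (use s x_Suc gr [of a] gr [of "Suc a"] gr [of b] gr [of "Suc b"] that in auto)
      then show ?thesis using True a0(2) [of a] b0(2) [of b] by (auto simp: C_def)
    next
      case False
      then show ?thesis using inn0 by (auto simp: C_def)
    qed
    have "(\<Sum>b<N. C a b * (?h a b + ?v (Suc a) b - ?h a (Suc b) - ?v a b))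
        = (if a = a0 then 2 * pi * \<i> * \<phi> z else 0)" if "a < N" for a
      using that b0(1) by (cases "a = a0") (auto simp: cell)
    then have "(\<Sum>a<N. \<Sum>b<N. C a b * (?h a b + ?v (Suc a) b - ?h a (Suc b) - ?v a b)) = 2 * pi * \<i> * \<phi> z"
      using a0(1) by simp
    moreover have "(\<Sum>a<N. \<Sum>b<N. C a b * (?h a b + ?v (Suc a) b - ?h a (Suc b) - ?v a b))
        = (\<Sum>a<N. \<Sum>b<N. C a b * (?h a b - ?h a (Suc b))) - (\<Sum>b<N. \<Sum>a<N. C a b * (?v a b - ?v (Suc a) b))"
      unfolding sum.swap [of "\<lambda>b a. C a b * (?v a b - ?v (Suc a) b)"]
      by (simp add: sum_subtractf [symmetric] algebra_simps)
    moreover have "(\<Sum>b<N. C a b * (?h a b - ?h a (Suc b)))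
        = ?h a 0 - ?h a N + (\<Sum>b<M. (C a (Suc b) - C a b) * ?h a (Suc b))" if "a < N" for a
    proof -
      have "C a 0 = 1" "C a M = 1" using inn_bd [of a 0] inn_bd [of a M] that by (auto simp: C_def N_def)
      then show ?thesis unfolding N_def sum_telescope_weighted by simp
    qed
    moreover have "(\<Sum>a<N. C a b * (?v a b - ?v (Suc a) b))
        = ?v 0 b - ?v N b + (\<Sum>a<M. (C (Suc a) b - C a b) * ?v (Suc a) b)" if "b < N" for b
    proof -
      have "C 0 b = 1" "C M b = 1" using inn_bd [of 0 b] inn_bd [of M b] that by (auto simp: C_def N_def)
      then show ?thesis unfolding N_def
        using sum_telescope_weighted [of "\<lambda>a. C a b" "\<lambda>a. ?v a b" M] by (simp only: mult_1)
    qed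
    ultimately have "2 * pi * \<i> * \<phi> z = (\<Sum>a<N. ?h a 0 - ?h a N + (\<Sum>b<M. (C a (Suc b) - C a b) * ?h a (Suc b)))
       - (\<Sum>b<N. ?v 0 b - ?v N b + (\<Sum>a<M. (C (Suc a) b - C a b) * ?v (Suc a) b))" by simp
    also have "\<dots> = 2 * pi * \<i> * F z + (\<Sum>a<N. \<Sum>b<M. (C a (Suc b) - C a b) * ?h a (Suc b))
       - (\<Sum>b<N. \<Sum>a<M. (C (Suc a) b - C a b) * ?v (Suc a) b)"
    proof -
      have "2 * pi * \<i> * F z = (\<Sum>a<N. ?h a 0 - ?h a N) + (\<Sum>b<N. ?v N b - ?v 0 b)"
        unfolding F_def by simp
      then show ?thesis by (simp add: sum.distrib sum_subtractf)
    qed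
    finally have eq: "2 * pi * \<i> * (F z - \<phi> z) = (\<Sum>b<N. \<Sum>a<M. (C (Suc a) b - C a b) * ?v (Suc a) b)
        - (\<Sum>a<N. \<Sum>b<M. (C a (Suc b) - C a b) * ?h a (Suc b))" by (simp add: algebra_simps)
    have edge: "norm (contour_integral (linepath u v) (w z)) \<le> m / \<kappa> * s"
      if uv: "norm (v - u) = s" and on: "\<And>\<zeta>. \<zeta> \<in> closed_segment u v \<Longrightarrow> \<zeta> \<in> K \<and> \<delta> / 2 \<le> norm (poly G \<zeta>) \<and> norm (poly G \<zeta>) \<le> 2 * \<delta>" for u v
    proof -
      have pos: "\<kappa> \<le> norm (\<zeta> - z) \<and> poly G \<zeta> \<noteq> 0" if "\<zeta> \<in> closed_segment u v" for \<zeta>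
        using on [OF that] far [of \<zeta>] \<delta> unfolding K_def by auto
      have "norm (contour_integral (linepath u v) (w z)) \<le> m / \<kappa> * norm (v - u)"
      proof (rule contour_integral_bound_linepath)
        have "z \<notin> closed_segment u v" using pos [of z] \<kappa> by auto
        then have "continuous_on (closed_segment u v) (w z)"
          unfolding w_def \<phi>_def using pos by (intro continuous_intros) auto
        then show "w z contour_integrable_on linepath u v" by (rule contour_integrable_continuous_linepath)
        show "0 \<le> m / \<kappa>" using m \<kappa> by simp
        fix \<zeta> assume \<zeta>: "\<zeta> \<in> closed_segment u v"
        have "norm (\<phi> \<zeta>) \<le> m" unfolding \<phi>_def norm_divide
          using small [of \<zeta>] on [OF \<zeta>] pos [OF \<zeta>] unfolding K_def
          by (simp add: divide_le_eq)
        then show "norm (w z \<zeta>) \<le> m / \<kappa>" unfolding w_def norm_divide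
          using pos [OF \<zeta>] \<kappa> m by (intro frac_le) auto
      qed
      then show ?thesis using uv by simp
    qed
    have h_le: "norm (?h a (Suc b)) \<le> m / \<kappa> * s" if "a < N" "b < M" "inn a b \<noteq> inn a (Suc b)" for a b
      unfolding edge_h_def
    proof (rule edge)
      show "norm (Complex (x (Suc a)) (x (Suc b)) - Complex (x a) (x (Suc b))) = s"
        using s by (simp add: x_Suc cmod_def)
      fix \<zeta> assume "\<zeta> \<in> closed_segment (Complex (x a) (x (Suc b))) (Complex (x (Suc a)) (x (Suc b)))"
      then have z: "x a \<le> Re \<zeta>" "Re \<zeta> \<le> x (Suc a)" "Im \<zeta> = x (Suc b)"
        using s by (auto simp: closed_segment_same_Im closed_segment_eq_real_ivl x_Suc)
      have "\<bar>norm (poly G \<zeta>) - norm (poly G (cen a b))\<bar> < \<delta> / 4" "\<zeta> \<in> K"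
        using sq [of a b \<zeta>] that(1,2) z s unfolding N_def x_Suc by auto
      moreover have "\<bar>norm (poly G \<zeta>) - norm (poly G (cen a (Suc b)))\<bar> < \<delta> / 4"
        using sq [of a "Suc b" \<zeta>] that(1,2) z s unfolding N_def x_Suc by auto
      ultimately show "\<zeta> \<in> K \<and> \<delta> / 2 \<le> norm (poly G \<zeta>) \<and> norm (poly G \<zeta>) \<le> 2 * \<delta>"
        using that(3) \<delta> unfolding inn_def by linarith
    qed
    have v_le: "norm (?v (Suc a) b) \<le> m / \<kappa> * s" if "b < N" "a < M" "inn a b \<noteq> inn (Suc a) b" for a b
      unfolding edge_v_def
    proof (rule edge)
      show "norm (Complex (x (Suc a)) (x (Suc b)) - Complex (x (Suc a)) (x b)) = s"
        using s by (simp add: x_Suc cmod_def)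
      fix \<zeta> assume "\<zeta> \<in> closed_segment (Complex (x (Suc a)) (x b)) (Complex (x (Suc a)) (x (Suc b)))"
      then have z: "x b \<le> Im \<zeta>" "Im \<zeta> \<le> x (Suc b)" "Re \<zeta> = x (Suc a)"
        using s by (auto simp: closed_segment_same_Re closed_segment_eq_real_ivl x_Suc)
      have "\<bar>norm (poly G \<zeta>) - norm (poly G (cen a b))\<bar> < \<delta> / 4" "\<zeta> \<in> K"
        using sq [of a b \<zeta>] that(1,2) z s unfolding N_def x_Suc by auto
      moreover have "\<bar>norm (poly G \<zeta>) - norm (poly G (cen (Suc a) b))\<bar> < \<delta> / 4"
        using sq [of "Suc a" b \<zeta>] that(1,2) z s unfolding N_def x_Suc by auto
      ultimately show "\<zeta> \<in> K \<and> \<delta> / 2 \<le> norm (poly G \<zeta>) \<and> norm (poly G \<zeta>) \<le> 2 * \<delta>"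
        using that(3) \<delta> unfolding inn_def by linarith
    qed
    have nn: "0 \<le> m / \<kappa> * s" using m \<kappa> s by simp
    have cE: "norm (\<Sum>b<M. (C a (Suc b) - C a b) * ?h a (Suc b)) \<le> real (4 * n) * (m / \<kappa> * s)" if a: "a < N" for a
      unfolding C_def
    proof (rule norm_weighted_sum_le [OF _ h_le [OF a] nn])
      have cen: "cen a b = complex_of_real (x a + s / 2) + of_real (x b + s / 2) * \<i>" for b
        by (simp add: cen_def complex_eq_iff)
      have "card {b. b < M \<and> (\<delta> < norm (poly G (of_real (x a + s / 2) + of_real (x b + s / 2) * \<i>)))
            \<noteq> (\<delta> < norm (poly G (of_real (x a + s / 2) + of_real (x (Suc b) + s / 2) * \<i>)))} \<le> 4 * n"
        by (rule card_level_crossings [where x = "\<lambda>b. x b + s / 2", OF deg])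
           (use s \<delta> inn_bd [of a 0] a in \<open>auto simp: x_Suc inn_def cen N_def\<close>)
      then show "card {b. b < M \<and> inn a b \<noteq> inn a (Suc b)} \<le> 4 * n" unfolding inn_def cen .
    qed
    have cV: "norm (\<Sum>a<M. (C (Suc a) b - C a b) * ?v (Suc a) b) \<le> real (4 * n) * (m / \<kappa> * s)" if b: "b < N" for b
      unfolding C_def
    proof (rule norm_weighted_sum_le [where p = "\<lambda>a. inn a b", OF _ v_le [OF b] nn])
      have cen: "cen a b = \<i> * of_real (x b + s / 2) + of_real (x a + s / 2) * 1" for a
        by (simp add: cen_def complex_eq_iff)
      have "card {a. a < M \<and> (\<delta> < norm (poly G (\<i> * of_real (x b + s / 2) + of_real (x a + s / 2) * 1)))
            \<noteq> (\<delta> < norm (poly G (\<i> * of_real (x b + s / 2) + of_real (x (Suc a) + s / 2) * 1)))} \<le> 4 * n"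
        by (rule card_level_crossings [where x = "\<lambda>b. x b + s / 2", OF deg])
           (use s \<delta> inn_bd [of 0 b] b in \<open>auto simp: x_Suc inn_def cen N_def\<close>)
      then show "card {a. a < M \<and> inn a b \<noteq> inn (Suc a) b} \<le> 4 * n" unfolding inn_def cen .
    qed
    have "norm (2 * pi * \<i> * (F z - \<phi> z)) \<le> norm (\<Sum>b<N. \<Sum>a<M. (C (Suc a) b - C a b) * ?v (Suc a) b)
        + norm (\<Sum>a<N. \<Sum>b<M. (C a (Suc b) - C a b) * ?h a (Suc b))"
      unfolding eq by (rule norm_triangle_ineq4)
    \<comment> \<open>At most \<open>4 * n\<close> edges of length \<open>s\<close> on each of
      \<open>N\<close> lines, in two directions; \<open>N * s = 2 * r\<close> makes the bound
      independent of the mesh.\<close>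
    also have "\<dots> \<le> real (card {..<N}) * (real (4 * n) * (m / \<kappa> * s)) + real (card {..<N}) * (real (4 * n) * (m / \<kappa> * s))"
      by (intro add_mono sum_norm_bound cE cV) auto
    also have "\<dots> = 8 * real n * m / \<kappa> * (real N * s)" by simp
    also have "\<dots> = 16 * real n * r * m / \<kappa>" unfolding s by simp
    finally have "2 * pi * norm (F z - \<phi> z) \<le> 16 * real n * r * m / \<kappa>" by (simp add: norm_mult)
    moreover have "norm (F z - \<phi> z) \<le> 2 * pi * norm (F z - \<phi> z)"
      using pi_ge_two mult_right_mono [of 1 "2 * pi" "norm (F z - \<phi> z)"] by simp
    ultimately show ?thesis by linarith
  qed
  show thesis
  proof (rule that [of F])
    show "F holomorphic_on {z. box_norm z < r}" using holF unfolding S_def .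
    fix z \<kappa>
    assume z: "box_norm z < r" and \<kappa>: "0 < \<kappa>" and Gz: "2 * \<delta> < norm (poly G z)"
      and far: "\<And>\<zeta>. box_norm \<zeta> \<le> r \<Longrightarrow> norm (poly G \<zeta>) \<le> 2 * \<delta> \<Longrightarrow> \<kappa> \<le> norm (\<zeta> - z)"
    \<comment> \<open>A point on a grid line is approached along a diagonal, which leaves horizontal
      and vertical lines at once. Near \<open>z\<close> the distance \<open>\<kappa>\<close> is
      replaced by \<open>\<kappa> / 2\<close>, which turns 16 into 32.\<close>
    define zt where "zt t = z + of_real t * (1 + \<i>)" for t :: real
    have tz: "(zt \<longlongrightarrow> z) (at_right 0)" unfolding zt_def by (auto intro!: tendsto_eq_intros)
    have "isCont F z"
      using holomorphic_on_imp_continuous_on [OF holF] z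
      unfolding continuous_on_eq_continuous_at [OF \<open>open S\<close>] by (simp add: S_def)
    moreover have "isCont \<phi> z" unfolding \<phi>_def using Gz \<delta> by (intro continuous_intros) auto
    ultimately have lim: "((\<lambda>t. norm (F (zt t) - \<phi> (zt t))) \<longlongrightarrow> norm (F z - \<phi> z)) (at_right 0)"
      by (intro tendsto_intros isCont_tendsto_compose [OF _ tz])
    have e1: "\<forall>\<^sub>F t in at_right 0. zt t \<in> S"
      by (rule topological_tendstoD [OF tz \<open>open S\<close>]) (use z in \<open>simp add: S_def\<close>)
    have e2: "\<forall>\<^sub>F t in at_right 0. 2 * \<delta> < norm (poly G (zt t))"
      by (rule order_tendstoD(1) [OF _ Gz]) (intro tendsto_intros isCont_tendsto_compose [OF _ tz] continuous_intros)
    have e3: "\<forall>\<^sub>F t in at_right 0. dist (zt t) z < \<kappa> / 2" using \<kappa> by (intro tendstoD [OF tz]) simp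
    have "\<forall>\<^sub>F t in at_right 0. Re (zt t) \<noteq> c" "\<forall>\<^sub>F t in at_right 0. Im (zt t) \<noteq> c" for c
    proof -
      have "\<forall>\<^sub>F t in at_right 0. t \<noteq> c - Re z \<and> t \<noteq> c - Im z \<and> t > 0"
        by (intro eventually_conj eventually_neq_at_within eventually_at_right_less)
      then show "\<forall>\<^sub>F t in at_right 0. Re (zt t) \<noteq> c" "\<forall>\<^sub>F t in at_right 0. Im (zt t) \<noteq> c"
        by (auto simp: zt_def elim!: eventually_mono)
    qed
    then have e4: "\<forall>\<^sub>F t in at_right 0. \<forall>a\<in>{..N}. Re (zt t) \<noteq> x a \<and> Im (zt t) \<noteq> x a"
      by (intro eventually_ball_finite ballI eventually_conj) auto
    have "\<forall>\<^sub>F t in at_right 0. norm (F (zt t) - \<phi> (zt t)) \<le> 16 * real n * r * m / (\<kappa> / 2)"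
      using e1 e2 e3 e4
    proof eventually_elim
      case (elim t)
      show ?case
      proof (rule off)
        fix \<zeta> assume "box_norm \<zeta> \<le> r" "norm (poly G \<zeta>) \<le> 2 * \<delta>"
        then have "\<kappa> \<le> norm (\<zeta> - z)" by (rule far)
        also have "\<dots> \<le> norm (\<zeta> - zt t) + norm (zt t - z)"
          using norm_triangle_ineq [of "\<zeta> - zt t" "zt t - z"] by simp
        finally show "\<kappa> / 2 \<le> norm (\<zeta> - zt t)" using elim(3) by (simp add: dist_norm)
      qed (use elim \<kappa> in \<open>auto simp: S_def\<close>)
    qed
    then have "norm (F z - \<phi> z) \<le> 16 * real n * r * m / (\<kappa> / 2)"
      by (intro tendsto_upperbound [OF lim]) auto
    then show "norm (F z - poly H z / poly G z) \<le> 32 * real n * r * m / \<kappa>" unfolding \<phi>_def by simp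
  qed
qed

section \<open>Joris' theorem for approximating polynomials\<close>

text \<open>All scales are powers of \<open>\<sigma>\<close>. The poles are cut off at the level
  \<open>\<delta> = \<sigma> ^ (2 * j * j)\<close> of \<open>\<bar>G\<bar>\<close>, where
  \<open>H / G\<close> is at most \<open>4 * \<rho>\<close> with
  \<open>\<rho> = \<sigma> ^ (2 * j)\<close>. By the Lipschitz bound, points with
  \<open>\<bar>G\<bar> \<ge> \<theta>\<close> keep the distance
  \<open>\<kappa> = \<sigma> ^ j\<close> from there, so \<open>F\<close> differs from
  \<open>H / G\<close> by a multiple of \<open>n * \<rho> / \<kappa> = n * \<sigma> ^ j\<close>.
  Where \<open>\<bar>G\<bar> < 2 * \<theta>\<close>, both \<open>f\<close> and \<open>F\<close> are
  small: \<open>f\<close> by a \<open>j\<close>-th root, \<open>F\<close> by the maximum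
  principle.\<close>

lemma joris_step:
  fixes G H :: "complex poly" and j n :: nat and \<sigma> \<Lambda> A e r :: real and f :: "real \<Rightarrow> complex"
  assumes j: "1 \<le> j" and \<sigma>: "0 < \<sigma>" "\<sigma> \<le> 1" and \<Lambda>: "1 \<le> \<Lambda>" and A: "0 \<le> A" and deg: "degree G \<le> n"
    and r: "1 / 2 \<le> r" "r \<le> 1"
    and E: "\<And>z. box_norm z \<le> 1 \<Longrightarrow> norm (poly H z ^ j - poly G z ^ (j + 1)) \<le> (\<sigma> ^ (2 * j * j) / 2) ^ (j + 1)"
    and G_le: "\<And>z. box_norm z \<le> 1 \<Longrightarrow> norm (poly G z) \<le> \<Lambda>"
    and lip: "\<And>z w. box_norm z \<le> 1 \<Longrightarrow> box_norm w \<le> 1 \<Longrightarrow> norm (poly G z - poly G w) \<le> \<Lambda> * norm (z - w)"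
    and bd: "\<And>z. box_norm z = r \<Longrightarrow> 4 * ((2 + \<Lambda>) * \<sigma> ^ j) \<le> norm (poly G z)"
    and e: "0 \<le> e" "e \<le> \<sigma> * \<sigma> ^ j"
    and f: "\<And>s. \<bar>s\<bar> \<le> 1 \<Longrightarrow> norm (f s) \<le> A"
      "\<And>s. \<bar>s\<bar> \<le> 1 \<Longrightarrow> norm (f s ^ j - poly G (of_real s)) \<le> e"
      "\<And>s. \<bar>s\<bar> \<le> 1 \<Longrightarrow> norm (f s ^ (j + 1) - poly H (of_real s)) \<le> e"
  shows "\<exists>F. F holomorphic_on ball 0 (1 / 2)
    \<and> (\<forall>z\<in>ball 0 (1 / 2). norm (F z) \<le> 128 * real n + 4 * (2 + \<Lambda>) + 2 * \<Lambda>)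
    \<and> (\<forall>s. \<bar>s\<bar> < 1 / 2 \<longrightarrow> norm (f s - F (of_real s)) \<le> (128 * real n + 6 * (2 + \<Lambda>) + A + 2) * \<sigma>)"
proof -
  define \<kappa> where "\<kappa> = \<sigma> ^ j"
  define \<delta> where "\<delta> = \<sigma> ^ (2 * j * j)"
  define \<rho> where "\<rho> = \<kappa> * \<kappa>"
  define \<theta> where "\<theta> = (2 + \<Lambda>) * \<kappa>"
  have pos: "0 < \<kappa>" "0 < \<delta>" "0 < \<rho>" "0 < \<theta>" using \<sigma> \<Lambda> unfolding \<kappa>_def \<delta>_def \<rho>_def \<theta>_def by auto
  have \<kappa>1: "\<kappa> \<le> \<sigma>" unfolding \<kappa>_def using power_decreasing [of 1 j \<sigma>] j \<sigma> by simp
  have \<rho>: "\<rho> ^ j = \<delta>" unfolding \<rho>_def \<kappa>_def \<delta>_def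
    by (simp add: power_mult_distrib power_mult power_add mult_2 mult.assoc)
  have "\<delta> \<le> \<kappa>" unfolding \<delta>_def \<kappa>_def using \<sigma> j by (intro power_decreasing) auto
  then have \<theta>\<delta>: "\<Lambda> * \<kappa> + 2 * \<delta> \<le> \<theta>" unfolding \<theta>_def by (simp add: algebra_simps)
  moreover have "0 < \<Lambda> * \<kappa>" using \<Lambda> pos by simp
  ultimately have \<theta>\<delta>2: "2 * \<delta> < \<theta>" by linarith
  have root: "x \<le> c * y" if "x ^ j \<le> c * y ^ j" "1 \<le> c" "0 \<le> y" for x y c :: real
  proof (rule power_le_imp_le_base [of x "j - 1"])
    have "c \<le> c ^ j" using self_le_power [of c j] that(2) j by simp
    then have "c * y ^ j \<le> (c * y) ^ j" unfolding power_mult_distrib using that by (intro mult_right_mono) auto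
    then show "x ^ Suc (j - 1) \<le> (c * y) ^ Suc (j - 1)" using that(1) j by simp
  qed (use that in auto)
  have HG: "(norm (poly H z) / norm (poly G z)) ^ j \<le> 2 * norm (poly G z)"
    if "box_norm z \<le> 1" "\<delta> / 2 \<le> norm (poly G z)" for z
  proof -
    have g: "0 < norm (poly G z)" using that pos by linarith
    have "norm (poly H z) ^ j \<le> norm (poly G z) ^ (j + 1) + (\<delta> / 2) ^ (j + 1)"
      using E [OF that(1)] norm_triangle_sub [of "poly H z ^ j" "poly G z ^ (j + 1)"]
      unfolding \<delta>_def norm_power by linarith
    also have "(\<delta> / 2) ^ (j + 1) \<le> norm (poly G z) ^ (j + 1)"
      using that pos by (intro power_mono) auto
    finally have "norm (poly H z) ^ j \<le> (2 * norm (poly G z)) * norm (poly G z) ^ j" by simp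
    then show ?thesis using g by (simp add: power_divide divide_le_eq)
  qed
  have "\<exists>F. F holomorphic_on {z. box_norm z < r} \<and>
    (\<forall>z \<kappa>. box_norm z < r \<longrightarrow> 0 < \<kappa> \<longrightarrow> 2 * \<delta> < norm (poly G z)
       \<longrightarrow> (\<forall>\<zeta>. box_norm \<zeta> \<le> r \<longrightarrow> norm (poly G \<zeta>) \<le> 2 * \<delta> \<longrightarrow> \<kappa> \<le> norm (\<zeta> - z))
       \<longrightarrow> norm (F z - poly H z / poly G z) \<le> 32 * real n * r * (4 * \<rho>) / \<kappa>)"
  proof (rule norm_poly_separation [where G = G and H = H and n = n and r = r and \<delta> = \<delta> and m = "4 * \<rho>"])
    show "2 * \<delta> \<le> norm (poly G z)" if "box_norm z = r" for z
    proof -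
      have "4 * \<theta> \<le> norm (poly G z)" using bd [OF that] unfolding \<theta>_def \<kappa>_def .
      then show ?thesis using \<theta>\<delta>2 pos(4) by linarith
    qed
    show "norm (poly H z) \<le> 4 * \<rho> * norm (poly G z)"
      if "box_norm z \<le> r" "\<delta> / 2 \<le> norm (poly G z)" "norm (poly G z) \<le> 2 * \<delta>" for z
    proof -
      have "0 < norm (poly G z)" using that pos by linarith
      moreover have "(norm (poly H z) / norm (poly G z)) ^ j \<le> 4 * \<rho> ^ j"
      proof -
        have "(norm (poly H z) / norm (poly G z)) ^ j \<le> 2 * norm (poly G z)"
          by (rule HG) (use that r in auto)
        then show ?thesis using that(3) \<rho> by linarith
      qed
      then have "norm (poly H z) / norm (poly G z) \<le> 4 * \<rho>" by (rule root) (use pos in auto)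
      ultimately show ?thesis by (simp add: divide_le_eq)
    qed
    show "degree G \<le> n" "0 < r" "0 < \<delta>" "0 \<le> 4 * \<rho>" using deg r pos by auto
    fix F assume "F holomorphic_on {z. box_norm z < r}"
      "\<And>z \<kappa>. box_norm z < r \<Longrightarrow> 0 < \<kappa> \<Longrightarrow> 2 * \<delta> < norm (poly G z)
       \<Longrightarrow> (\<And>\<zeta>. box_norm \<zeta> \<le> r \<Longrightarrow> norm (poly G \<zeta>) \<le> 2 * \<delta> \<Longrightarrow> \<kappa> \<le> norm (\<zeta> - z))
       \<Longrightarrow> norm (F z - poly H z / poly G z) \<le> 32 * real n * r * (4 * \<rho>) / \<kappa>"
    then show ?thesis by blast
  qed
  then obtain F where holF: "F holomorphic_on {z. box_norm z < r}"
    and sep: "\<And>z \<kappa>. box_norm z < r \<Longrightarrow> 0 < \<kappa> \<Longrightarrow> 2 * \<delta> < norm (poly G z)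
       \<Longrightarrow> (\<And>\<zeta>. box_norm \<zeta> \<le> r \<Longrightarrow> norm (poly G \<zeta>) \<le> 2 * \<delta> \<Longrightarrow> \<kappa> \<le> norm (\<zeta> - z))
       \<Longrightarrow> norm (F z - poly H z / poly G z) \<le> 32 * real n * r * (4 * \<rho>) / \<kappa>" by blast
  have near: "norm (F z - poly H z / poly G z) \<le> 128 * real n * \<kappa>"
    if z: "box_norm z < r" and Gz: "\<theta> \<le> norm (poly G z)" for z
  proof -
    have "norm (F z - poly H z / poly G z) \<le> 32 * real n * r * (4 * \<rho>) / \<kappa>"
    proof (rule sep [OF z])
      fix \<zeta> assume \<zeta>: "box_norm \<zeta> \<le> r" "norm (poly G \<zeta>) \<le> 2 * \<delta>"
      have "\<Lambda> * \<kappa> \<le> norm (poly G z) - norm (poly G \<zeta>)" using Gz \<zeta> \<theta>\<delta> by linarith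
      also have "\<dots> \<le> \<Lambda> * norm (\<zeta> - z)"
        using lip [of z \<zeta>] z \<zeta> r norm_triangle_ineq2 [of "poly G z" "poly G \<zeta>"] by (simp add: norm_minus_commute)
      finally show "\<kappa> \<le> norm (\<zeta> - z)" using \<Lambda> by simp
    qed (use pos \<theta>\<delta>2 Gz in auto)
    also have "\<dots> = 128 * real n * \<kappa> * r" unfolding \<rho>_def using pos by simp
    also have "\<dots> \<le> 128 * real n * \<kappa> * 1" using r pos by (intro mult_left_mono) auto
    finally show ?thesis by simp
  qed
  have on_level: "norm (F z) \<le> 128 * real n * \<kappa> + 4 * (2 + \<Lambda>) * \<sigma>"
    if z: "box_norm z < r" and Gz: "norm (poly G z) = 2 * \<theta>" for z
  proof -
    have "(norm (poly H z) / norm (poly G z)) ^ j \<le> 4 * (2 + \<Lambda>) * \<sigma> ^ j"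
    proof -
      have "(norm (poly H z) / norm (poly G z)) ^ j \<le> 2 * norm (poly G z)"
        by (rule HG) (use z r Gz pos \<theta>\<delta>2 in auto)
      also have "\<dots> = 4 * (2 + \<Lambda>) * \<sigma> ^ j" unfolding Gz \<theta>_def \<kappa>_def by simp
      finally show ?thesis .
    qed
    then have "norm (poly H z / poly G z) \<le> 4 * (2 + \<Lambda>) * \<sigma>"
      unfolding norm_divide by (rule root) (use \<sigma> \<Lambda> in auto)
    moreover have "norm (F z - poly H z / poly G z) \<le> 128 * real n * \<kappa>" using near [OF z] Gz pos by simp
    ultimately show ?thesis using norm_triangle_sub [of "F z" "poly H z / poly G z"] by linarith
  qed
  \<comment> \<open>Inside \<open>V\<close> the quotient is useless, but \<open>F\<close> can be
    estimated from the frontier, where \<open>\<bar>G\<bar> = 2 * \<theta>\<close>. The lower bound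
    \<open>4 * \<theta>\<close> on the boundary of the square keeps the frontier of \<open>V\<close>
    away from it.\<close>
  define V where "V = {z. box_norm z < r} \<inter> {z. norm (poly G z) < 2 * \<theta>}"
  have opV: "open V" unfolding V_def box_norm_less_eq_box
    by (intro open_Int open_box open_Collect_less continuous_intros)
  have "closed ({z. box_norm z \<le> r} \<inter> {z. norm (poly G z) \<le> 2 * \<theta>})"
    unfolding box_norm_le_eq_cbox by (intro closed_Int closed_cbox closed_Collect_le continuous_intros)
  then have "closure V \<subseteq> {z. box_norm z \<le> r} \<inter> {z. norm (poly G z) \<le> 2 * \<theta>}"
    by (rule closure_minimal [rotated]) (auto simp: V_def)
  moreover have "box_norm z \<noteq> r" if "norm (poly G z) \<le> 2 * \<theta>" for z
  proof
    assume "box_norm z = r"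
    from bd [OF this] show False using that pos(4) unfolding \<theta>_def \<kappa>_def by linarith
  qed
  ultimately have clV: "box_norm z < r \<and> norm (poly G z) \<le> 2 * \<theta>" if "z \<in> closure V" for z
    using that by (metis (mono_tags, lifting) IntD1 IntD2 in_mono less_le mem_Collect_eq)
  have in_V: "norm (F z) \<le> 128 * real n * \<kappa> + 4 * (2 + \<Lambda>) * \<sigma>" if "z \<in> V" for z
  proof (rule maximum_modulus_frontier [of F V])
    show "F holomorphic_on interior V" 
      by (rule holomorphic_on_subset [OF holF]) (use interior_subset [of V] in \<open>auto simp: V_def\<close>)
    show "continuous_on (closure V) F"
      using holomorphic_on_imp_continuous_on [OF holF] by (rule continuous_on_subset) (use clV in blast)
    have "bounded {z. box_norm z \<le> r}" unfolding box_norm_le_eq_cbox by (rule bounded_cbox)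
    then show "bounded V" by (rule bounded_subset) (auto simp: V_def)
    fix u assume "u \<in> frontier V"
    then have u: "u \<in> closure V" "u \<notin> V" using opV by (auto simp: frontier_def interior_open)
    then have "box_norm u < r" "norm (poly G u) = 2 * \<theta>" using clV [OF u(1)] unfolding V_def by auto
    then show "norm (F u) \<le> 128 * real n * \<kappa> + 4 * (2 + \<Lambda>) * \<sigma>" by (rule on_level)
  qed (rule that)
  have in_ball: "box_norm z < r \<and> box_norm z \<le> 1" if "norm z < 1 / 2" for z
    using box_norm_le_norm [of z] that r by linarith
  have n\<kappa>: "128 * real n * \<kappa> \<le> 128 * real n * \<sigma>" using \<kappa>1 by (intro mult_left_mono) auto
  have L\<sigma>: "4 * (2 + \<Lambda>) * \<sigma> \<le> 4 * (2 + \<Lambda>)" "128 * real n * \<sigma> \<le> 128 * real n"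
    using \<sigma> \<Lambda> by (auto intro!: mult_left_le)
  show ?thesis
  proof (intro exI [of _ F] conjI ballI allI impI)
    show "F holomorphic_on ball 0 (1 / 2)"
      using holF by (rule holomorphic_on_subset) (use in_ball in auto)
    fix z :: complex assume "z \<in> ball 0 (1 / 2)"
    then have z: "box_norm z < r" "box_norm z \<le> 1" using in_ball by auto
    show "norm (F z) \<le> 128 * real n + 4 * (2 + \<Lambda>) + 2 * \<Lambda>"
    proof (cases "norm (poly G z) < 2 * \<theta>")
      case True
      then have "z \<in> V" using z by (auto simp: V_def)
      then show ?thesis using in_V [of z] n\<kappa> L\<sigma> \<Lambda> by linarith
    next
      case False
      have "(norm (poly H z) / norm (poly G z)) ^ j \<le> 2 * \<Lambda> * 1 ^ j"
      proof -
        have "(norm (poly H z) / norm (poly G z)) ^ j \<le> 2 * norm (poly G z)"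
          by (rule HG [OF z(2)]) (use False pos \<theta>\<delta>2 in linarith)
        then show ?thesis using G_le [OF z(2)] by simp
      qed
      then have "norm (poly H z / poly G z) \<le> 2 * \<Lambda> * 1"
        unfolding norm_divide by (rule root) (use \<Lambda> in auto)
      moreover have "norm (F z - poly H z / poly G z) \<le> 128 * real n * \<kappa>" using near [OF z(1)] False pos by simp
      ultimately have "norm (F z) \<le> 2 * \<Lambda> * 1 + 128 * real n * \<kappa>"
        by (intro order_trans [OF norm_triangle_sub [of "F z" "poly H z / poly G z"]] add_mono)
      also have "\<dots> \<le> 128 * real n + 4 * (2 + \<Lambda>) + 2 * \<Lambda>"
        using order_trans [OF n\<kappa> L\<sigma>(2)] \<Lambda> by simp
      finally show ?thesis .
    qed
  next
    fix s :: real assume s: "\<bar>s\<bar> < 1 / 2"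
    define z where "z = complex_of_real s"
    have z: "box_norm z < r" "box_norm z \<le> 1" using in_ball [of z] s by (auto simp: z_def)
    have s1: "\<bar>s\<bar> \<le> 1" using s by simp
    note fs = f(1) [OF s1] f(2,3) [OF s1, folded z_def]
    show "norm (f s - F (of_real s)) \<le> (128 * real n + 6 * (2 + \<Lambda>) + A + 2) * \<sigma>"
    proof (cases "norm (poly G z) < 2 * \<theta>")
      case True
      then have "norm (F z) \<le> 128 * real n * \<sigma> + 4 * (2 + \<Lambda>) * \<sigma>" using in_V [of z] z n\<kappa> by (auto simp: V_def)
      moreover have "norm (f s) \<le> (2 + 2 * (2 + \<Lambda>)) * \<sigma>"
      proof (rule root)
        have "norm (f s) ^ j \<le> norm (poly G z) + e"
          using fs(2) norm_triangle_sub [of "f s ^ j" "poly G z"] by (simp add: norm_power)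
        also have "\<dots> \<le> 2 * ((2 + \<Lambda>) * \<sigma> ^ j) + 2 * \<sigma> ^ j"
        proof (intro add_mono)
          have "\<sigma> * \<sigma> ^ j \<le> 1 * \<sigma> ^ j" using \<sigma> by (intro mult_right_mono) auto
          then show "e \<le> 2 * \<sigma> ^ j" using e pos unfolding \<kappa>_def by linarith
        qed (use True in \<open>simp add: \<theta>_def \<kappa>_def\<close>)
        finally show "norm (f s) ^ j \<le> (2 + 2 * (2 + \<Lambda>)) * \<sigma> ^ j" by (simp add: algebra_simps)
      qed (use \<sigma> \<Lambda> in auto)
      ultimately have "norm (f s - F z) \<le> (128 * real n + 6 * (2 + \<Lambda>) + 2) * \<sigma>"
        using norm_triangle_ineq4 [of "f s" "F z"] by (simp add: algebra_simps)
      also have "\<dots> \<le> (128 * real n + 6 * (2 + \<Lambda>) + A + 2) * \<sigma>"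
        using \<sigma> A by (intro mult_right_mono) auto
      finally show ?thesis unfolding z_def .
    next
      case False
      have G0: "\<theta> \<le> norm (poly G z)" using False pos by linarith
      have gp: "0 < norm (poly G z)" using G0 pos by linarith
      \<comment> \<open>The identity uses both approximations. Division by
        \<open>\<bar>G\<bar> \<ge> \<theta>\<close> costs a factor \<open>\<sigma> ^ j\<close>, and
        the error \<open>\<sigma> * \<sigma> ^ j\<close> leaves \<open>\<sigma>\<close>.\<close>
      have "f s * poly G z - poly H z = (f s ^ (j + 1) - poly H z) - f s * (f s ^ j - poly G z)"
        by (simp add: algebra_simps)
      then have "norm (f s * poly G z - poly H z) \<le> norm (f s ^ (j + 1) - poly H z) + norm (f s) * norm (f s ^ j - poly G z)"
        by (metis norm_mult norm_triangle_ineq4)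
      also have "\<dots> \<le> e + A * e" using fs e A by (intro add_mono mult_mono) auto
      finally have 1: "norm (f s * poly G z - poly H z) \<le> (A + 1) * e" by (simp add: algebra_simps)
      have "norm (f s - poly H z / poly G z) = norm (f s * poly G z - poly H z) / norm (poly G z)"
        using gp by (simp add: norm_divide [symmetric] diff_divide_distrib)
      also have "\<dots> \<le> (A + 1) * (\<sigma> * \<sigma> ^ j) / \<theta>"
      proof (rule frac_le)
        have "(A + 1) * e \<le> (A + 1) * (\<sigma> * \<sigma> ^ j)" using e A by (intro mult_left_mono) auto
        with 1 show "norm (f s * poly G z - poly H z) \<le> (A + 1) * (\<sigma> * \<sigma> ^ j)" by linarith
        show "0 \<le> (A + 1) * (\<sigma> * \<sigma> ^ j)" using A \<sigma> by simp
      qed (use G0 pos in auto)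
      also have "\<dots> = (A + 1) * \<sigma> / (2 + \<Lambda>)" using pos \<Lambda> unfolding \<theta>_def \<kappa>_def by simp
      also have "\<dots> \<le> (A + 1) * \<sigma> / 1" using A \<sigma> \<Lambda> by (intro divide_left_mono) auto
      finally have "norm (f s - poly H z / poly G z) \<le> (A + 1) * \<sigma>" by simp
      moreover have "norm (poly H z / poly G z - F z) \<le> 128 * real n * \<sigma>"
        using near [OF z(1) G0] n\<kappa> by (simp add: norm_minus_commute)
      ultimately have "norm (f s - F z) \<le> (A + 1) * \<sigma> + 128 * real n * \<sigma>"
        using norm_triangle_ineq [of "f s - poly H z / poly G z" "poly H z / poly G z - F z"] by simp
      also have "\<dots> \<le> (128 * real n + 6 * (2 + \<Lambda>) + A + 2) * \<sigma>" 
      proof -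
        have "0 \<le> (6 * (2 + \<Lambda>) + 1) * \<sigma>" using \<sigma> \<Lambda> by simp
        then show ?thesis by (simp add: algebra_simps)
      qed
      finally show ?thesis unfolding z_def .
    qed
  qed
qed

section \<open>Lipschitz bounds and the choice of exponents\<close>

lemma norm_power_diff_le:
  fixes a b :: complex
  assumes "norm a \<le> c" "norm b \<le> c" "1 \<le> c"
  shows "norm (a ^ m - b ^ m) \<le> real m * c ^ m * norm (a - b)"
proof (induction m)
  case (Suc m)
  have "a ^ Suc m - b ^ Suc m = a * (a ^ m - b ^ m) + (a - b) * b ^ m" by (simp add: algebra_simps)
  then have "norm (a ^ Suc m - b ^ Suc m) \<le> norm a * norm (a ^ m - b ^ m) + norm (a - b) * norm b ^ m"
    by (metis norm_mult norm_power norm_triangle_ineq)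
  also have "\<dots> \<le> c * (real m * c ^ m * norm (a - b)) + norm (a - b) * c ^ Suc m"
  proof (intro add_mono mult_mono Suc.IH assms)
    have "norm b ^ m \<le> c ^ m" using assms by (intro power_mono) auto
    also have "\<dots> \<le> c ^ Suc m" using assms by (intro power_increasing) auto
    finally show "norm b ^ m \<le> c ^ Suc m" .
  qed (use assms in auto)
  also have "\<dots> = real (Suc m) * c ^ Suc m * norm (a - b)" by (simp add: algebra_simps)
  finally show ?case .
qed simp

text \<open>Cauchy's estimate on circles of radius 1. The square lies in the disc of radius 2, the
  circles in the disc of radius 3, where the growth factor is \<open>2 * 3 + 1 = 7\<close>.\<close>

lemma poly_lipschitz_on_box:
  fixes G :: "complex poly"
  assumes deg: "degree G \<le> n" and S: "\<And>s::real. \<bar>s\<bar> \<le> 1 \<Longrightarrow> norm (poly G (of_real s)) \<le> S"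
    and z: "box_norm z \<le> 1" and w: "box_norm w \<le> 1"
  shows "norm (poly G z - poly G w) \<le> 7 ^ n * S * norm (z - w)"
proof (rule field_differentiable_bound)
  have S0: "0 \<le> S" by (rule order_trans [OF norm_ge_zero S [of 0]]) simp
  show "convex {z. box_norm z \<le> 1}" unfolding box_norm_le_eq_cbox by (rule convex_box)
  fix u assume "u \<in> {z. box_norm z \<le> 1}"
  then have u: "norm u \<le> 2" using norm_le_box_norm [of u] by simp
  show "(poly G has_field_derivative poly (pderiv G) u) (at u within {z. box_norm z \<le> 1})"
    by (rule has_field_derivative_at_within [OF poly_DERIV])
  have "norm ((deriv ^^ 1) (poly G) u) \<le> fact 1 * (7 ^ n * S) / 1 ^ 1"
  proof (rule Cauchy_inequality)
    fix x assume x: "norm (u - x) = 1"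
    have "norm x \<le> norm u + norm (u - x)" using norm_triangle_ineq4 [of u "u - x"] by simp
    then have "(2 * norm x + 1) ^ n \<le> 7 ^ n" using u x by (intro power_mono) auto
    then have "(2 * norm x + 1) ^ n * S \<le> 7 ^ n * S" using S0 by (rule mult_right_mono)
    then show "norm (poly G x) \<le> 7 ^ n * S"
      using norm_poly_le_of_unit_interval [OF deg S, of x] by linarith
  qed (auto intro!: holomorphic_intros continuous_intros)
  moreover have "deriv (poly G) u = poly (pderiv G) u" by (rule DERIV_imp_deriv [OF poly_DERIV])
  ultimately show "norm (poly (pderiv G) u) \<le> 7 ^ n * S" by simp
qed (use z w in auto)

text \<open>
  The exponent \<open>g\<close> depends on \<open>j\<close> only. The hypothesis \<open>D ^ n * \<eta> \<le> 1\<close> keeps the degree at most logarithmic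
  in \<open>1 / \<eta>\<close>, so that factors exponential in \<open>n\<close> can be absorbed into powers of \<open>\<eta>\<close>.
\<close>
lemma joris_polynomial_core:
  fixes j :: nat and A B :: real
  assumes j: "1 \<le> j" and A: "1 \<le> A" and B: "1 \<le> B"
  obtains g :: nat and C D :: real where "1 \<le> g" "1 \<le> C" "1 \<le> D"
    "\<And>\<eta> n f. 0 < \<eta> \<Longrightarrow> \<eta> \<le> 1 \<Longrightarrow> D ^ n * \<eta> \<le> 1
      \<Longrightarrow> (\<And>s::real. \<bar>s\<bar> \<le> 1 \<Longrightarrow> norm (f s) \<le> A)
      \<Longrightarrow> poly_approx n 1 (B * \<eta> ^ g) (\<lambda>s. f s ^ j) \<Longrightarrow> poly_approx n 1 (B * \<eta> ^ g) (\<lambda>s. f s ^ (j + 1))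
      \<Longrightarrow> \<exists>F. F holomorphic_on ball 0 (1 / 2) \<and> (\<forall>z\<in>ball 0 (1 / 2). norm (F z) \<le> C / \<eta>)
           \<and> (\<forall>s. \<bar>s\<bar> < 1 / 2 \<longrightarrow> norm (f s - F (of_real s)) \<le> C * \<eta>)"
proof -
  \<comment> \<open>With \<open>\<sigma> = \<eta> ^ 2\<close>, the bound required of
    \<open>H ^ j - G ^ (j + 1)\<close> is \<open>\<eta> ^ (4 * j * j * (j + 1))\<close> up to a
    constant. Of the two further powers, one absorbs \<open>7 ^ ((j + 1) * n)\<close> and the other
    the constants.\<close>
  define g where "g = 4 * j * j * (j + 1) + 2"
  define C2 where "C2 = A ^ (j + 1) + B"
  define C1 where "C1 = real (2 * j + 1) * C2 ^ (j + 1) * B"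
  define C3 where "C3 = C1 * 2 ^ (j + 1) + B"
  define C where "C = 200 + 100 * C2 + A * C3 + A"
  \<comment> \<open>\<open>7 ^ (j + 1)\<close> comes from extending
    \<open>H ^ j - G ^ (j + 1)\<close> from the segment to the square, and 308 = 44 * 7 from the
    minimum modulus bound together with the growth of \<open>G\<close>.\<close>
  define D where "D = (308 * 7 ^ (j + 1) :: real)"
  have "1 \<le> A ^ (j + 1)" using A by (rule one_le_power)
  then have C2: "1 \<le> C2" unfolding C2_def using B by linarith
  have C1: "0 \<le> C1" unfolding C1_def using C2 B by simp
  have "0 \<le> C1 * 2 ^ (j + 1)" using C1 by simp
  then have C3: "1 \<le> C3" unfolding C3_def using B by linarith
  have D7: "308 \<le> D" "7 ^ (j + 1) \<le> D" unfolding D_def using one_le_power [of "7::real" "j + 1"] by auto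
  have AC: "0 \<le> A * C3" using A C3 by simp
  have C: "1 \<le> C" "A * C3 \<le> C" unfolding C_def using AC A C2 by linarith+
  have g_ge: "2 * j + 3 \<le> g"
  proof -
    have "4 * 1 * 1 * (j + 1) \<le> 4 * j * j * (j + 1)" using j by (intro mult_le_mono) auto
    moreover have "2 * j + 3 \<le> 4 * 1 * 1 * (j + 1) + 2" using j by simp
    ultimately show ?thesis unfolding g_def by (meson add_le_mono1 order_trans)
  qed
  show thesis
  proof (rule that [of g C D])
    show "1 \<le> g" "1 \<le> C" "1 \<le> D" using g_ge C D7 by auto
    fix \<eta> n and f :: "real \<Rightarrow> complex"
    assume \<eta>: "0 < \<eta>" "\<eta> \<le> 1" "D ^ n * \<eta> \<le> 1"
      and fA: "\<And>s::real. \<bar>s\<bar> \<le> 1 \<Longrightarrow> norm (f s) \<le> A"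
      and "poly_approx n 1 (B * \<eta> ^ g) (\<lambda>s. f s ^ j)" "poly_approx n 1 (B * \<eta> ^ g) (\<lambda>s. f s ^ (j + 1))"
    then obtain G H where deg: "degree G \<le> n" "degree H \<le> n"
      and fG: "\<And>s::real. \<bar>s\<bar> \<le> 1 \<Longrightarrow> norm (f s ^ j - poly G (of_real s)) \<le> B * \<eta> ^ g"
      and fH: "\<And>s::real. \<bar>s\<bar> \<le> 1 \<Longrightarrow> norm (f s ^ (j + 1) - poly H (of_real s)) \<le> B * \<eta> ^ g"
      unfolding poly_approx_def by blast
    show "\<exists>F. F holomorphic_on ball 0 (1 / 2) \<and> (\<forall>z\<in>ball 0 (1 / 2). norm (F z) \<le> C / \<eta>)
           \<and> (\<forall>s. \<bar>s\<bar> < 1 / 2 \<longrightarrow> norm (f s - F (of_real s)) \<le> C * \<eta>)" (is "\<exists>F. ?P F")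
    proof (cases "C3 * \<eta> \<le> 1")
      \<comment> \<open>For \<open>\<eta>\<close> bounded away from 0 the trivial bound
        \<open>A\<close> on \<open>f\<close> is at most \<open>C * \<eta>\<close>, and zero serves
        as \<open>F\<close>.\<close>
      case False
      have "A \<le> A * C3 * \<eta>" using False A mult_left_mono [of 1 "C3 * \<eta>" A] by (simp add: mult.assoc)
      also have "\<dots> \<le> C * \<eta>" using C \<eta> by (intro mult_right_mono) auto
      finally have AC\<eta>: "A \<le> C * \<eta>" .
      have "?P (\<lambda>_. 0)"
        using C \<eta> order_trans [OF fA AC\<eta>] by (auto intro!: divide_nonneg_nonneg)
      then show ?thesis by blast
    next
      case True
      \<comment> \<open>One power of \<open>\<eta>\<close> is held in reserve: the constants
        multiplying \<open>\<sigma>\<close> grow with \<open>n\<close>, but at most like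
        \<open>1 / \<eta>\<close>.\<close>
      define \<sigma> where "\<sigma> = \<eta> ^ 2"
      have \<sigma>: "0 < \<sigma>" "\<sigma> \<le> 1" using \<eta> unfolding \<sigma>_def by (auto intro: power_le_one)
      have \<eta>g: "\<eta> ^ g \<le> 1" using \<eta> by (intro power_le_one) auto
      have G1: "norm (poly G (of_real s)) \<le> C2" if "\<bar>s\<bar> \<le> 1" for s :: real
      proof -
        have "norm (f s) ^ j \<le> A ^ j" using fA [OF that] by (intro power_mono) auto
        moreover have "A ^ j \<le> A ^ (j + 1)" using A by (intro power_increasing) auto
        ultimately have "norm (f s ^ j) \<le> A ^ (j + 1)" unfolding norm_power by linarith
        moreover have "B * \<eta> ^ g \<le> B" using B \<eta>g by (intro mult_left_le) auto
        ultimately show ?thesis unfolding C2_def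
          using fG [OF that] norm_triangle_sub [of "poly G (of_real s)" "f s ^ j"]
          unfolding norm_minus_commute [of "poly G (of_real s)"] by linarith
      qed
      have H1: "norm (poly H (of_real s)) \<le> C2" if "\<bar>s\<bar> \<le> 1" for s :: real
      proof -
        have "norm (f s ^ (j + 1)) \<le> A ^ (j + 1)" unfolding norm_power
          by (rule power_mono [OF fA [OF that] norm_ge_zero])
        moreover have "B * \<eta> ^ g \<le> B" using B \<eta>g by (intro mult_left_le) auto
        ultimately show ?thesis unfolding C2_def
          using fH [OF that] norm_triangle_sub [of "poly H (of_real s)" "f s ^ (j + 1)"]
          unfolding norm_minus_commute [of "poly H (of_real s)"] by linarith
      qed
      have G7: "norm (poly G z) \<le> C2 * 7 ^ n" if "box_norm z \<le> 1" for z
      proof -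
        have "(2 * norm z + 1) ^ n \<le> 7 ^ n" using that norm_le_box_norm [of z] by (intro power_mono) auto
        then have "(2 * norm z + 1) ^ n * C2 \<le> 7 ^ n * C2" using C2 by (intro mult_right_mono) auto
        then show ?thesis using norm_poly_le_of_unit_interval [OF deg(1) G1, of z] by (simp add: mult.commute)
      qed
      define e where "e = H ^ j - G ^ (j + 1)"
      have dege: "degree e \<le> (j + 1) * n"
      proof -
        have "degree (H ^ j) \<le> degree H * j" by (rule degree_power_le)
        also have "\<dots> \<le> n * (j + 1)" using deg by (intro mult_le_mono) auto
        finally have 1: "degree (H ^ j) \<le> (j + 1) * n" by (simp only: mult.commute)
        have "degree (G ^ (j + 1)) \<le> degree G * (j + 1)" by (rule degree_power_le)
        also have "\<dots> \<le> n * (j + 1)" using deg by (intro mult_le_mono) auto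
        finally have "degree (G ^ (j + 1)) \<le> (j + 1) * n" by (simp only: mult.commute)
        with 1 show ?thesis unfolding e_def by (rule degree_diff_le)
      qed
      have e1: "norm (poly e (of_real s)) \<le> C1 * \<eta> ^ g" if "\<bar>s\<bar> \<le> 1" for s :: real
      proof -
        let ?g = "poly G (of_real s)" and ?h = "poly H (of_real s)"
        have fs: "norm (f s ^ j) \<le> C2" "norm (f s ^ (j + 1)) \<le> C2"
        proof -
          have "norm (f s) ^ j \<le> A ^ j" using fA [OF that] by (intro power_mono) auto
          moreover have "A ^ j \<le> A ^ (j + 1)" using A by (intro power_increasing) auto
          ultimately show "norm (f s ^ j) \<le> C2" unfolding norm_power C2_def using B by linarith
          show "norm (f s ^ (j + 1)) \<le> C2" unfolding norm_power C2_def
            using power_mono [OF fA [OF that] norm_ge_zero, of "j + 1"] B by linarith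
        qed
        have "norm (?h ^ j - (f s ^ (j + 1)) ^ j) \<le> real j * C2 ^ j * norm (?h - f s ^ (j + 1))"
          by (rule norm_power_diff_le [OF H1 [OF that] fs(2) C2])
        also have "\<dots> \<le> real j * C2 ^ (j + 1) * (B * \<eta> ^ g)"
          using fH [OF that] C2 by (intro mult_mono power_increasing) (auto simp: norm_minus_commute)
        finally have 1: "norm (?h ^ j - (f s ^ (j + 1)) ^ j) \<le> real j * C2 ^ (j + 1) * (B * \<eta> ^ g)" .
        have "norm ((f s ^ j) ^ (j + 1) - ?g ^ (j + 1)) \<le> real (j + 1) * C2 ^ (j + 1) * norm (f s ^ j - ?g)"
          by (rule norm_power_diff_le [OF fs(1) G1 [OF that] C2])
        also have "\<dots> \<le> real (j + 1) * C2 ^ (j + 1) * (B * \<eta> ^ g)"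
          using fG [OF that] C2 by (intro mult_left_mono) auto
        finally have 2: "norm ((f s ^ j) ^ (j + 1) - ?g ^ (j + 1)) \<le> real (j + 1) * C2 ^ (j + 1) * (B * \<eta> ^ g)" .
        have "(f s ^ (j + 1)) ^ j = (f s ^ j) ^ (j + 1)" by (simp only: power_mult [symmetric] mult.commute)
        then have "poly e (of_real s) = (?h ^ j - (f s ^ (j + 1)) ^ j) + ((f s ^ j) ^ (j + 1) - ?g ^ (j + 1))"
          unfolding e_def by (simp del: power_Suc)
        then have "norm (poly e (of_real s)) \<le> real j * C2 ^ (j + 1) * (B * \<eta> ^ g) + real (j + 1) * C2 ^ (j + 1) * (B * \<eta> ^ g)"
          using norm_triangle_mono [OF 1 2] by simp
        also have "\<dots> = C1 * \<eta> ^ g" 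
        proof -
          have "real (2 * j + 1) = real j + real (j + 1)" by simp
          then show ?thesis unfolding C1_def by (simp only: distrib_right mult.assoc)
        qed
        finally show ?thesis .
      qed
      have D\<eta>: "7 ^ ((j + 1) * n) * \<eta> \<le> 1"
      proof -
        have "7 ^ ((j + 1) * n) \<le> D ^ n" unfolding power_mult using D7 by (intro power_mono) auto
        then have "7 ^ ((j + 1) * n) * \<eta> \<le> D ^ n * \<eta>" using \<eta> by (intro mult_right_mono) auto
        then show ?thesis using \<eta>(3) by linarith
      qed
      have E: "norm (poly H z ^ j - poly G z ^ (j + 1)) \<le> (\<sigma> ^ (2 * j * j) / 2) ^ (j + 1)" if "box_norm z \<le> 1" for z
      proof -
        have "norm (poly e z) \<le> (2 * norm z + 1) ^ ((j + 1) * n) * (C1 * \<eta> ^ g)"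
          by (rule norm_poly_le_of_unit_interval [OF dege e1])
        also have "\<dots> \<le> 7 ^ ((j + 1) * n) * (C1 * \<eta> ^ g)"
          using that norm_le_box_norm [of z] C1 \<eta> by (intro mult_right_mono power_mono) auto
        also have "\<dots> = (7 ^ ((j + 1) * n) * \<eta>) * (C1 * \<eta>) * \<eta> ^ (4 * j * j * (j + 1))"
          unfolding g_def by (simp add: power_add power2_eq_square)
        also have "\<dots> \<le> 1 * (1 / 2 ^ (j + 1)) * \<eta> ^ (4 * j * j * (j + 1))"
        proof (intro mult_right_mono mult_mono D\<eta>)
          have "C1 * 2 ^ (j + 1) * \<eta> \<le> C3 * \<eta>" unfolding C3_def using B \<eta> by (intro mult_right_mono) auto
          then show "C1 * \<eta> \<le> 1 / 2 ^ (j + 1)" using True by (simp add: field_simps)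
        qed (use \<eta> C1 in auto)
        also have "\<dots> = (\<sigma> ^ (2 * j * j) / 2) ^ (j + 1)"
        proof -
          have "\<sigma> ^ (2 * j * j) = \<eta> ^ (4 * j * j)" unfolding \<sigma>_def power_mult [symmetric] by (simp add: mult.assoc)
          then show ?thesis unfolding power_divide by (simp only: power_mult [symmetric] mult_1 times_divide_eq_left)
        qed
        finally show ?thesis unfolding e_def by (simp del: power_Suc)
      qed
      define \<Lambda> where "\<Lambda> = C2 * 7 ^ n"
      have p7: "1 \<le> (7::real) ^ n" by (rule one_le_power) simp
      have \<Lambda>: "1 \<le> \<Lambda>" unfolding \<Lambda>_def using C2 p7 mult_mono [of 1 C2 1 "7 ^ n"] by simp
      have D308: "308 ^ n * \<eta> \<le> 1"
      proof -
        have "308 ^ n \<le> D ^ n" using D7 by (intro power_mono) auto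
        then have "308 ^ n * \<eta> \<le> D ^ n * \<eta>" using \<eta> by (intro mult_right_mono) auto
        then show ?thesis using \<eta>(3) by linarith
      qed
      have n7: "7 ^ n * \<eta> \<le> 1"
      proof -
        have "7 ^ n * \<eta> \<le> 308 ^ n * \<eta>" using \<eta> by (intro mult_right_mono power_mono) auto
        then show ?thesis using D308 by linarith
      qed
      have n\<eta>: "real n * \<eta> \<le> 1"
      proof -
        have "real n \<le> 2 ^ n" by (rule less_imp_le [OF of_nat_less_two_power])
        also have "(2::real) ^ n \<le> 7 ^ n" by (intro power_mono) auto
        finally have "real n \<le> 7 ^ n" .
        then have "real n * \<eta> \<le> 7 ^ n * \<eta>" using \<eta> by (intro mult_right_mono) auto
        then show ?thesis using n7 by linarith
      qed
      have \<Lambda>\<eta>: "\<Lambda> * \<eta> \<le> C2" unfolding \<Lambda>_def using n7 C2 mult_left_mono [OF n7, of C2] by (simp add: mult.assoc)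
      have e\<sigma>: "B * \<eta> ^ g \<le> \<sigma> * \<sigma> ^ j"
      proof -
        have "\<eta> ^ g \<le> \<eta> ^ (2 * j + 3)" using \<eta> g_ge by (intro power_decreasing) auto
        also have "\<dots> = \<eta> * (\<sigma> * \<sigma> ^ j)"
        proof -
          have "2 * j + 3 = Suc (2 + 2 * j)" by simp
          then show ?thesis unfolding \<sigma>_def power_mult [symmetric] power_add [symmetric] by (simp only: power_Suc)
        qed
        finally have "B * \<eta> ^ g \<le> B * (\<eta> * (\<sigma> * \<sigma> ^ j))" using B by (intro mult_left_mono) auto
        also have "\<dots> = (B * \<eta>) * (\<sigma> * \<sigma> ^ j)" by simp
        also have "\<dots> \<le> 1 * (\<sigma> * \<sigma> ^ j)"
        proof (rule mult_right_mono)
          have "B * \<eta> \<le> C3 * \<eta>" unfolding C3_def using C1 \<eta> by (intro mult_right_mono) auto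
          then show "B * \<eta> \<le> 1" using True by linarith
        qed (use \<sigma> in auto)
        finally show ?thesis by simp
      qed
      have final: "K * \<sigma> \<le> C * \<eta>" if "K * \<eta> \<le> C" for K
        using mult_right_mono [OF that, of \<eta>] \<eta> unfolding \<sigma>_def by (simp add: power2_eq_square mult.assoc)
      \<comment> \<open>If \<open>G\<close> is large enough at one point of the square, the minimum
        modulus bound supplies a square boundary for the previous construction. Otherwise
        \<open>f\<close> is small on the whole segment and zero serves as \<open>F\<close>.\<close>
      show ?thesis
      proof (cases "\<exists>w. box_norm w \<le> 1 \<and> 44 ^ n * (4 * ((2 + \<Lambda>) * \<sigma> ^ j)) \<le> norm (poly G w)")
        case w: True
        then obtain w where w: "box_norm w \<le> 1" "44 ^ n * (4 * ((2 + \<Lambda>) * \<sigma> ^ j)) \<le> norm (poly G w)" by blast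
        obtain r where r: "1 / 2 \<le> r" "r \<le> 1"
          "\<And>z w. box_norm z = r \<Longrightarrow> box_norm w \<le> 1 \<Longrightarrow> norm (poly G w) \<le> 44 ^ n * norm (poly G z)"
          using poly_min_modulus_on_square [OF deg(1)] by blast
        have "\<exists>F. F holomorphic_on ball 0 (1 / 2)
          \<and> (\<forall>z\<in>ball 0 (1 / 2). norm (F z) \<le> 128 * real n + 4 * (2 + \<Lambda>) + 2 * \<Lambda>)
          \<and> (\<forall>s. \<bar>s\<bar> < 1 / 2 \<longrightarrow> norm (f s - F (of_real s)) \<le> (128 * real n + 6 * (2 + \<Lambda>) + A + 2) * \<sigma>)"
        proof (rule joris_step [OF j \<sigma> \<Lambda> _ deg(1) r(1,2) E _ _ _ _ e\<sigma> fA fG fH])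
          show "norm (poly G z) \<le> \<Lambda>" if "box_norm z \<le> 1" for z using G7 [OF that] unfolding \<Lambda>_def .
          show "norm (poly G z - poly G w) \<le> \<Lambda> * norm (z - w)" if "box_norm z \<le> 1" "box_norm w \<le> 1" for z w
            using poly_lipschitz_on_box [OF deg(1) G1 that] unfolding \<Lambda>_def by (simp add: mult.commute)
          show "4 * ((2 + \<Lambda>) * \<sigma> ^ j) \<le> norm (poly G z)" if "box_norm z = r" for z
          proof -
            have "44 ^ n * (4 * ((2 + \<Lambda>) * \<sigma> ^ j)) \<le> 44 ^ n * norm (poly G z)"
              using r(3) [OF that w(1)] w(2) by linarith
            then show ?thesis by (rule mult_left_le_imp_le) simp
          qed
        qed (use A B \<eta> in auto)
        then obtain F where F: "F holomorphic_on ball 0 (1 / 2)"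
          "\<And>z. z\<in>ball 0 (1 / 2) \<Longrightarrow> norm (F z) \<le> 128 * real n + 4 * (2 + \<Lambda>) + 2 * \<Lambda>"
          "\<And>s. \<bar>s\<bar> < 1 / 2 \<Longrightarrow> norm (f s - F (of_real s)) \<le> (128 * real n + 6 * (2 + \<Lambda>) + A + 2) * \<sigma>" by blast
        have "(128 * real n + 4 * (2 + \<Lambda>) + 2 * \<Lambda>) * \<eta> = 128 * (real n * \<eta>) + 8 * \<eta> + 6 * (\<Lambda> * \<eta>)" by (simp add: algebra_simps)
        also have "\<dots> \<le> C" unfolding C_def using n\<eta> \<eta> \<Lambda>\<eta> AC A C2 by linarith
        finally have C4: "128 * real n + 4 * (2 + \<Lambda>) + 2 * \<Lambda> \<le> C / \<eta>" using \<eta> by (simp add: pos_le_divide_eq)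
        have A\<eta>: "A * \<eta> \<le> A" using A \<eta> by (intro mult_left_le) auto
        have "(128 * real n + 6 * (2 + \<Lambda>) + A + 2) * \<eta> = 128 * (real n * \<eta>) + 14 * \<eta> + 6 * (\<Lambda> * \<eta>) + A * \<eta>" by (simp add: algebra_simps)
        also have "\<dots> \<le> C" unfolding C_def using n\<eta> \<eta> \<Lambda>\<eta> AC A\<eta> C2 by linarith
        finally have C5: "(128 * real n + 6 * (2 + \<Lambda>) + A + 2) * \<sigma> \<le> C * \<eta>" by (rule final)
        have "?P F" using F(1) order_trans [OF F(2) C4] order_trans [OF F(3) C5] by blast
        then show ?thesis by blast
      next
        case False
        define K where "K = 1 + 44 ^ n * (4 * (2 + \<Lambda>))"
        have K1: "1 \<le> K" unfolding K_def using \<Lambda> by simp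
        have "norm (f s) \<le> C * \<eta>" if s: "\<bar>s\<bar> < 1 / 2" for s
        proof -
          have s1: "\<bar>s\<bar> \<le> 1" using s by simp
          have "box_norm (of_real s) \<le> 1" using box_norm_le_norm [of "of_real s"] s1 by simp
          then have "norm (poly G (of_real s)) \<le> 44 ^ n * (4 * ((2 + \<Lambda>) * \<sigma> ^ j))" using False by force
          moreover have "norm (f s) ^ j \<le> norm (poly G (of_real s)) + B * \<eta> ^ g"
            using fG [OF s1] norm_triangle_sub [of "f s ^ j" "poly G (of_real s)"] by (simp add: norm_power)
          moreover have "B * \<eta> ^ g \<le> \<sigma> ^ j" 
          proof -
            have "\<sigma> * \<sigma> ^ j \<le> 1 * \<sigma> ^ j" using \<sigma> by (intro mult_right_mono) auto
            then show ?thesis using e\<sigma> by linarith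
          qed
          ultimately have "norm (f s) ^ j \<le> K * \<sigma> ^ j" unfolding K_def by (simp add: algebra_simps)
          also have "\<dots> \<le> (K * \<sigma>) ^ j" unfolding power_mult_distrib
            using self_le_power [of K j] K1 j \<sigma> by (intro mult_right_mono) auto
          finally have "norm (f s) ^ Suc (j - 1) \<le> (K * \<sigma>) ^ Suc (j - 1)" using j by simp
          then have "norm (f s) \<le> K * \<sigma>" by (rule power_le_imp_le_base) (use K1 \<sigma> in auto)
          also have "\<dots> \<le> C * \<eta>"
          proof (rule final)
            have e: "44 ^ n * 7 ^ n = (308::real) ^ n" by (simp add: power_mult_distrib [symmetric])
            have "K = 1 + 8 * 44 ^ n + 4 * C2 * (44 ^ n * 7 ^ n)" unfolding K_def \<Lambda>_def by (simp add: algebra_simps)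
            also have "\<dots> \<le> 308 ^ n + 8 * 308 ^ n + 4 * C2 * 308 ^ n"
              unfolding e using C2 by (intro add_mono mult_left_mono power_mono one_le_power) auto
            also have "\<dots> = (9 + 4 * C2) * 308 ^ n" by (simp add: algebra_simps)
            finally have "K * \<eta> \<le> (9 + 4 * C2) * 308 ^ n * \<eta>" using \<eta> by (intro mult_right_mono) auto
            also have "\<dots> \<le> 9 + 4 * C2" using D308 C2 mult_left_mono [OF D308, of "9 + 4 * C2"] by (simp add: mult.assoc)
            also have "\<dots> \<le> C" unfolding C_def using AC A C2 by linarith
            finally show "K * \<eta> \<le> C" .
          qed
          finally show ?thesis .
        qed
        then have "?P (\<lambda>_. 0)" using C \<eta> by (auto intro!: divide_nonneg_nonneg)
        then show ?thesis by blast
      qed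
    qed
  qed
qed

text \<open>Cauchy's estimate at radius 1/4 bounds the coefficients by \<open>S * 4 ^ n\<close>. On
  the smaller disc the terms are then at most \<open>S * (1 / (2 * R)) ^ n\<close>, where the factor
  2 makes the tail summable.\<close>

lemma taylor_truncation:
  fixes F :: "complex \<Rightarrow> complex"
  assumes hol: "F holomorphic_on ball 0 (1 / 2)" and S: "\<And>z. z \<in> ball 0 (1 / 2) \<Longrightarrow> norm (F z) \<le> S"
    and R: "1 \<le> R"
  obtains p :: "complex poly" where "degree p \<le> K"
    "\<And>z. norm z \<le> 1 / (8 * R) \<Longrightarrow> norm (F z - poly p z) \<le> S / R ^ (K + 1)"
proof -
  define a where "a n = (deriv ^^ n) F 0 / fact n" for n
  define p where "p = (\<Sum>n\<le>K. monom (a n) n)"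
  have S0: "0 \<le> S" by (rule order_trans [OF norm_ge_zero S [of 0]]) simp
  have a: "norm (a n) \<le> S * 4 ^ n" for n
  proof -
    have "norm ((deriv ^^ n) F 0) \<le> fact n * S / (1 / 4) ^ n"
    proof (rule Cauchy_inequality)
      show "F holomorphic_on ball 0 (1 / 4)" using hol by (rule holomorphic_on_subset) auto
      show "continuous_on (cball 0 (1 / 4)) F"
        by (rule continuous_on_subset [OF holomorphic_on_imp_continuous_on [OF hol]]) auto
    qed (auto intro!: S)
    then show ?thesis unfolding a_def by (simp add: norm_divide field_simps power_divide)
  qed
  show thesis
  proof (rule that [of p])
    show "degree p \<le> K" unfolding p_def
      by (intro degree_sum_le) (auto intro: order_trans [OF degree_monom_le])
    fix z :: complex assume z: "norm z \<le> 1 / (8 * R)"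
    have "1 / (8 * R) \<le> 1 / 8" using R by (intro divide_left_mono) auto
    then have "z \<in> ball 0 (1 / 2)" using z by simp
    then have "(\<lambda>n. a n * z ^ n) sums F z"
      using holomorphic_power_series [OF hol, of z] by (simp add: a_def)
    moreover have "(\<Sum>n<K + 1. a n * z ^ n) = poly p z"
      unfolding p_def by (simp add: poly_sum poly_monom lessThan_Suc_atMost)
    ultimately have s: "(\<lambda>n. a (n + (K + 1)) * z ^ (n + (K + 1))) sums (F z - poly p z)"
      using sums_split_initial_segment [of "\<lambda>n. a n * z ^ n" "F z" "K + 1"] by simp
    have t: "norm (a (n + (K + 1)) * z ^ (n + (K + 1))) \<le> S / R ^ (K + 1) * (1 / 2) ^ Suc n" for n
    proof -
      let ?m = "n + (K + 1)"
      have "norm (a ?m * z ^ ?m) \<le> (S * 4 ^ ?m) * (1 / (8 * R)) ^ ?m"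
        unfolding norm_mult norm_power using z S0 by (intro mult_mono a power_mono) auto
      also have "\<dots> = S * (1 / (2 * R)) ^ ?m"
      proof -
        have "4 * (1 / (8 * R)) = 1 / (2 * R)" using R by (simp add: field_simps)
        then show ?thesis by (simp only: mult.assoc power_mult_distrib [symmetric])
      qed
      also have "\<dots> = S * ((1 / R) ^ ?m * (1 / 2) ^ ?m)"
        by (simp add: power_divide power_mult_distrib)
      also have "\<dots> \<le> S * ((1 / R) ^ (K + 1) * (1 / 2) ^ Suc n)"
        using S0 R by (intro mult_left_mono mult_mono power_decreasing) auto
      finally show ?thesis by (simp add: power_divide)
    qed
    have g: "(\<lambda>n. S / R ^ (K + 1) * (1 / 2) ^ Suc n) sums (S / R ^ (K + 1) * 1)"
      by (intro sums_mult power_half_series)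
    have "norm (F z - poly p z) \<le> S / R ^ (K + 1) * 1"
      using norm_suminf_le [OF t sums_summable [OF g]] sums_unique [OF s] sums_unique [OF g] by simp
    then show "norm (F z - poly p z) \<le> S / R ^ (K + 1)" by simp
  qed
qed

text \<open>The degree \<open>K\<close> is no longer tied to \<open>n\<close>: a shorter segment,
  that is a larger \<open>R\<close>, permits a smaller degree. The condition on
  \<open>R ^ (K + 1)\<close> brings the truncation error of a function bounded by
  \<open>C / \<eta>\<close> down to \<open>C * \<eta>\<close>.\<close>

lemma joris_polynomial_approx:
  fixes j :: nat and A B :: real
  assumes j: "1 \<le> j" and A: "1 \<le> A" and B: "1 \<le> B"
  obtains g :: nat and C D :: real where "1 \<le> g" "1 \<le> C" "1 \<le> D"
    "\<And>\<eta> n f K R. 0 < \<eta> \<Longrightarrow> \<eta> \<le> 1 \<Longrightarrow> D ^ n * \<eta> \<le> 1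
      \<Longrightarrow> (\<And>s::real. \<bar>s\<bar> \<le> 1 \<Longrightarrow> norm (f s) \<le> A)
      \<Longrightarrow> poly_approx n 1 (B * \<eta> ^ g) (\<lambda>s. f s ^ j) \<Longrightarrow> poly_approx n 1 (B * \<eta> ^ g) (\<lambda>s. f s ^ (j + 1))
      \<Longrightarrow> 1 \<le> R \<Longrightarrow> 1 \<le> R ^ (K + 1) * \<eta> ^ 2
      \<Longrightarrow> poly_approx K (1 / (8 * R)) (C * \<eta>) f"
proof -
  obtain g C D where g: "1 \<le> g" "1 \<le> C" "1 \<le> D" and core:
    "\<And>\<eta> n f. 0 < \<eta> \<Longrightarrow> \<eta> \<le> 1 \<Longrightarrow> D ^ n * \<eta> \<le> 1
      \<Longrightarrow> (\<And>s::real. \<bar>s\<bar> \<le> 1 \<Longrightarrow> norm (f s) \<le> A)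
      \<Longrightarrow> poly_approx n 1 (B * \<eta> ^ g) (\<lambda>s. f s ^ j) \<Longrightarrow> poly_approx n 1 (B * \<eta> ^ g) (\<lambda>s. f s ^ (j + 1))
      \<Longrightarrow> \<exists>F. F holomorphic_on ball 0 (1 / 2) \<and> (\<forall>z\<in>ball 0 (1 / 2). norm (F z) \<le> C / \<eta>)
           \<and> (\<forall>s. \<bar>s\<bar> < 1 / 2 \<longrightarrow> norm (f s - F (of_real s)) \<le> C * \<eta>)"
    using joris_polynomial_core [OF assms] by blast
  show thesis
  proof (rule that [of g "2 * C" D])
    fix \<eta> n and f :: "real \<Rightarrow> complex" and K :: nat and R :: real
    assume *: "0 < \<eta>" "\<eta> \<le> 1" "D ^ n * \<eta> \<le> 1" "\<And>s::real. \<bar>s\<bar> \<le> 1 \<Longrightarrow> norm (f s) \<le> A"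
      "poly_approx n 1 (B * \<eta> ^ g) (\<lambda>s. f s ^ j)" "poly_approx n 1 (B * \<eta> ^ g) (\<lambda>s. f s ^ (j + 1))"
      and R: "1 \<le> R" "1 \<le> R ^ (K + 1) * \<eta> ^ 2"
    obtain F where F: "F holomorphic_on ball 0 (1 / 2)" "\<And>z. z \<in> ball 0 (1 / 2) \<Longrightarrow> norm (F z) \<le> C / \<eta>"
      "\<And>s. \<bar>s\<bar> < 1 / 2 \<Longrightarrow> norm (f s - F (of_real s)) \<le> C * \<eta>"
      using core [OF *] by blast
    obtain p where p: "degree p \<le> K" "\<And>z. norm z \<le> 1 / (8 * R) \<Longrightarrow> norm (F z - poly p z) \<le> C / \<eta> / R ^ (K + 1)"
      using taylor_truncation [OF F(1,2) R(1)] by blast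
    have R0: "0 < R ^ (K + 1)" using R by (intro zero_less_power) simp
    have "C / \<eta> / R ^ (K + 1) \<le> C * \<eta>"
    proof -
      have "C * 1 \<le> C * (R ^ (K + 1) * \<eta> ^ 2)" using R g by (intro mult_left_mono) auto
      also have "\<dots> = C * \<eta> * (\<eta> * R ^ (K + 1))" by (simp only: power2_eq_square mult_ac)
      finally have "C / (\<eta> * R ^ (K + 1)) \<le> C * \<eta>"
        using R0 *(1) by (subst pos_divide_le_eq) auto
      then show ?thesis by (simp only: divide_divide_eq_left)
    qed
    note CR = this
    have R8: "1 / (8 * R) \<le> 1 / 8" using R by (intro divide_left_mono) auto
    have "norm (f s - poly p (of_real s)) \<le> 2 * C * \<eta>" if s: "\<bar>s\<bar> \<le> 1 / (8 * R)" for s :: real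
    proof -
      have "norm (f s - F (of_real s)) \<le> C * \<eta>" using s R8 by (intro F(3)) simp
      moreover have "norm (F (of_real s) - poly p (of_real s)) \<le> C * \<eta>"
        using s by (intro order_trans [OF p(2) CR]) simp
      ultimately show ?thesis
        using norm_triangle_ineq [of "f s - F (of_real s)" "F (of_real s) - poly p (of_real s)"] by simp
    qed
    then show "poly_approx K (1 / (8 * R)) (2 * C * \<eta>) f"
      using p(1) unfolding poly_approx_def by blast
  qed (use g in auto)
qed

section \<open>Tensor product interpolation\<close>

text \<open>Equidistant nodes on [-1, 1]. For \<open>K = 0\<close> the division by zero gives 0, and
  the single node is -1.\<close>

definition lag_node :: "nat \<Rightarrow> nat \<Rightarrow> real" where
  "lag_node K m = 2 * real m / real K - 1"

definition lag :: "nat \<Rightarrow> nat \<Rightarrow> complex poly" where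
  "lag K m = smult (inverse (\<Prod>l\<in>{..K} - {m}. of_real (lag_node K m - lag_node K l)))
     (\<Prod>l\<in>{..K} - {m}. [:- of_real (lag_node K l), 1:])"

lemma abs_lag_node_le: "m \<le> K \<Longrightarrow> \<bar>lag_node K m\<bar> \<le> 1"
  unfolding lag_node_def by (cases "K = 0") (auto simp: abs_le_iff field_simps)

lemma lag_node_inj: "m \<le> K \<Longrightarrow> l \<le> K \<Longrightarrow> lag_node K m = lag_node K l \<Longrightarrow> m = l"
  unfolding lag_node_def by (cases "K = 0") (auto simp: field_simps)

lemma poly_lag_node:
  assumes "m \<le> K" "l \<le> K"
  shows "poly (lag K m) (of_real (lag_node K l)) = (if l = m then 1 else 0)"
proof (cases "l = m")
  case True
  have "(\<Prod>l\<in>{..K} - {m}. complex_of_real (lag_node K m - lag_node K l)) \<noteq> 0"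
    using lag_node_inj assms(1) by (auto simp: prod_zero_iff)
  then show ?thesis using True by (simp add: lag_def poly_prod)
next
  case False
  then have "(\<Prod>i\<in>{..K} - {m}. poly [:- complex_of_real (lag_node K i), 1:] (of_real (lag_node K l))) = 0"
    using assms by (intro prod_zero bexI [of _ l]) auto
  then show ?thesis using False by (simp add: lag_def poly_prod)
qed

lemma degree_lag: "m \<le> K \<Longrightarrow> degree (lag K m) \<le> K"
proof -
  assume m: "m \<le> K"
  have "degree (\<Prod>l\<in>{..K} - {m}. [:- complex_of_real (lag_node K l), 1:]) \<le> (\<Sum>l\<in>{..K} - {m}. 1)"
    by (rule order_trans [OF degree_prod_sum_le]) (auto intro!: sum_mono)
  also have "\<dots> = K" using m by simp
  finally show ?thesis unfolding lag_def using degree_smult_le order_trans by blast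
qed

lemma lagrange_interpolation:
  fixes q :: "complex poly"
  assumes "degree q \<le> K"
  shows "poly q z = (\<Sum>m\<le>K. poly q (of_real (lag_node K m)) * poly (lag K m) z)"
proof -
  let ?A = "(\<lambda>m. complex_of_real (lag_node K m)) ` {..K}"
  define r where "r = (\<Sum>m\<le>K. smult (poly q (of_real (lag_node K m))) (lag K m))"
  have "inj_on (\<lambda>m. complex_of_real (lag_node K m)) {..K}"
    by (rule inj_onI) (auto dest: lag_node_inj)
  then have card: "card ?A = Suc K" by (simp add: card_image)
  have "degree r \<le> K" unfolding r_def
    by (intro degree_sum_le) (auto intro: degree_lag)
  then have "q = r"
  proof (intro poly_eqI_degree [of ?A])
    fix z assume "z \<in> ?A"
    then obtain l where l: "l \<le> K" "z = of_real (lag_node K l)" by auto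
    then show "poly q z = poly r z"
      unfolding r_def by (simp add: poly_sum poly_lag_node if_distrib cong: if_cong)
  qed (use assms card in auto)
  then have "poly q z = poly r z" by simp
  also have "\<dots> = (\<Sum>m\<le>K. poly q (of_real (lag_node K m)) * poly (lag K m) z)"
    unfolding r_def by (simp add: poly_sum)
  finally show ?thesis .
qed

lemma power_self_le_fact: "real K ^ K \<le> 3 ^ K * fact K"
proof -
  have "(\<Sum>n\<in>{K}. real K ^ n /\<^sub>R fact n) \<le> (\<Sum>n. real K ^ n /\<^sub>R fact n)"
    by (rule sum_le_suminf [OF summable_exp_generic]) auto
  then have "real K ^ K / fact K \<le> exp (real K)" by (simp add: exp_def divide_inverse_commute)
  also have "\<dots> = exp 1 ^ K" using exp_of_nat_mult [of K "1::real"] by simp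
  also have "\<dots> \<le> 3 ^ K" using exp_le by (intro power_mono) auto
  finally show ?thesis by (simp add: divide_le_eq)
qed

text \<open>The numerator has \<open>K\<close> factors of size at most 2. For equidistant nodes the
  denominator is \<open>(2 / K) ^ K * (fact m * fact (K - m))\<close>, and binomial coefficients are
  at most \<open>2 ^ K\<close>, so it is at least \<open>fact K / K ^ K\<close>, hence at least
  \<open>1 / 3 ^ K\<close>.\<close>

lemma norm_lag_le:
  assumes m: "m \<le> K" and s: "\<bar>s\<bar> \<le> 1"
  shows "norm (poly (lag K m) (of_real s)) \<le> 6 ^ K"
proof -
  let ?P = "\<Prod>l\<in>{..K} - {m}. \<bar>lag_node K m - lag_node K l\<bar>"
  have num: "(\<Prod>l\<in>{..K} - {m}. \<bar>s - lag_node K l\<bar>) \<le> 2 ^ K"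
  proof -
    have "(\<Prod>l\<in>{..K} - {m}. \<bar>s - lag_node K l\<bar>) \<le> (\<Prod>l\<in>{..K} - {m}. 2)"
    proof (intro prod_mono conjI)
      fix l assume "l \<in> {..K} - {m}"
      then have "\<bar>lag_node K l\<bar> \<le> 1" by (intro abs_lag_node_le) auto
      then show "\<bar>s - lag_node K l\<bar> \<le> 2" using s by linarith
    qed auto
    then show ?thesis using m by simp
  qed
  have den: "1 \<le> 3 ^ K * ?P"
  proof (cases "K = 0")
    case False
    have "?P = (\<Prod>l\<in>{..K} - {m}. 2 / real K * \<bar>real m - real l\<bar>)"
      using False by (intro prod.cong) (auto simp: lag_node_def abs_if field_simps)
    also have "\<dots> = (2 / real K) ^ K * (\<Prod>l\<in>{..K} - {m}. \<bar>real m - real l\<bar>)"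
      unfolding prod.distrib using m by simp
    also have "(\<Prod>l\<in>{..K} - {m}. \<bar>real m - real l\<bar>)
        = (\<Prod>l\<in>{..<m}. \<bar>real m - real l\<bar>) * (\<Prod>l\<in>{m<..K}. \<bar>real m - real l\<bar>)"
      using m by (subst prod.union_disjoint [symmetric]) (auto intro!: prod.cong)
    also have "(\<Prod>l\<in>{..<m}. \<bar>real m - real l\<bar>) = (\<Prod>i\<in>{1..m}. real i)"
      by (rule prod.reindex_bij_witness [of _ "\<lambda>i. m - i" "\<lambda>l. m - l"]) (auto simp: of_nat_diff)
    also have "\<dots> = fact m" by (simp add: fact_prod)
    also have "(\<Prod>l\<in>{m<..K}. \<bar>real m - real l\<bar>) = (\<Prod>i\<in>{1..K - m}. real i)"
      by (rule prod.reindex_bij_witness [of _ "\<lambda>i. m + i" "\<lambda>l. l - m"]) (auto simp: of_nat_diff)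
    also have "\<dots> = fact (K - m)" by (simp add: fact_prod)
    finally have P: "?P = (2 / real K) ^ K * (fact m * fact (K - m))" .
    have "fact K = fact m * fact (K - m) * real (K choose m)"
      using binomial_fact_lemma [OF m] by (metis of_nat_fact of_nat_mult)
    also have "\<dots> \<le> fact m * fact (K - m) * 2 ^ K"
      using binomial_le_pow2 [of K m] by (intro mult_left_mono) (auto simp: of_nat_le_iff [symmetric] simp del: of_nat_le_iff)
    finally have b: "fact K \<le> fact m * fact (K - m) * (2::real) ^ K" .
    have "real K ^ K \<le> 3 ^ K * (fact m * fact (K - m) * 2 ^ K)"
      by (rule order_trans [OF power_self_le_fact mult_left_mono [OF b]]) simp
    then show ?thesis unfolding P using False by (simp add: power_divide field_simps)
  next
    case True
    then have "{..K} - {m} = {}" using m by auto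
    then show ?thesis using True by simp
  qed
  have P0: "0 < ?P" using lag_node_inj m by (intro prod_pos) auto
  have "norm (poly (lag K m) (of_real s)) = (\<Prod>l\<in>{..K} - {m}. \<bar>s - lag_node K l\<bar>) / ?P"
    unfolding lag_def
    by (simp add: poly_prod norm_mult norm_inverse prod_norm [symmetric] divide_inverse mult.commute
        flip: of_real_diff)
  also have "\<dots> \<le> 2 ^ K * 3 ^ K"
  proof -
    have "(\<Prod>l\<in>{..K} - {m}. \<bar>s - lag_node K l\<bar>) \<le> 2 ^ K * (3 ^ K * ?P)"
      by (rule order_trans [OF num]) (use mult_left_mono [OF den, of "2 ^ K"] in simp)
    then show ?thesis using P0 by (simp add: divide_le_eq mult.assoc)
  qed
  also have "\<dots> = 6 ^ K" by (simp add: power_mult_distrib [symmetric])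
  finally show ?thesis .
qed

section \<open>Derivatives of interpolation polynomials\<close>

lemma higher_deriv_poly: "(deriv ^^ a) (poly p) = poly ((pderiv ^^ a) (p :: complex poly))"
proof (induction a)
  case (Suc a)
  have "deriv (poly q) = poly (pderiv q)" for q :: "complex poly"
    by (rule ext) (rule DERIV_imp_deriv [OF poly_DERIV])
  then show ?case using Suc by simp
qed simp

text \<open>Cauchy's estimate on the circle of radius 1 about \<open>s\<close>, which lies in the
  disc of radius 2, where the growth factor is \<open>2 * 2 + 1 = 5\<close>; and 5 * 6 = 30.\<close>

lemma norm_pderiv_lag_le:
  assumes m: "m \<le> K" and s: "\<bar>s\<bar> \<le> 1"
  shows "norm (poly ((pderiv ^^ a) (lag K m)) (of_real s)) \<le> fact a * 30 ^ K"
proof -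
  have "norm ((deriv ^^ a) (poly (lag K m)) (of_real s)) \<le> fact a * 30 ^ K / 1 ^ a"
  proof (rule Cauchy_inequality)
    fix x assume x: "norm (complex_of_real s - x) = 1"
    have "norm x \<le> norm (complex_of_real s) + norm (complex_of_real s - x)"
      using norm_triangle_ineq4 [of "of_real s" "of_real s - x"] by simp
    then have "(2 * norm x + 1) ^ K \<le> 5 ^ K" using x s by (intro power_mono) auto
    then have "(2 * norm x + 1) ^ K * 6 ^ K \<le> 5 ^ K * 6 ^ K" by (rule mult_right_mono) simp
    also have "(5::real) ^ K * 6 ^ K = 30 ^ K" by (simp add: power_mult_distrib [symmetric])
    finally have "(2 * norm x + 1) ^ K * 6 ^ K \<le> 30 ^ K" .
    with norm_poly_le_of_unit_interval [OF degree_lag [OF m] norm_lag_le [OF m], of x]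
    show "norm (poly (lag K m) x) \<le> 30 ^ K" by linarith
  qed (auto intro!: holomorphic_intros continuous_intros)
  then show ?thesis by (simp add: higher_deriv_poly)
qed

lemma degree_higher_pderiv_le: "degree ((pderiv ^^ a) p) \<le> degree (p :: complex poly)"
  by (induction a) (auto simp: degree_pderiv intro: order_trans [OF diff_le_self])

text \<open>Polynomials in several variables, described through their restrictions to lines parallel
  to the axes, which is all that interpolation one coordinate at a time requires.\<close>

definition coord_poly :: "nat \<Rightarrow> (real^'n::finite \<Rightarrow> complex) \<Rightarrow> bool" where
  "coord_poly K p \<longleftrightarrow> (\<forall>z i. \<exists>q. degree q \<le> K \<and> (\<forall>s. p (z + s *\<^sub>R axis i 1) = poly q (of_real s)))"

definition grid_point :: "nat \<Rightarrow> real^'n::finite \<Rightarrow> real \<Rightarrow> ('n \<Rightarrow> nat) \<Rightarrow> real^'n" where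
  "grid_point K x t \<beta> = (\<chi> i. x $ i + t * lag_node K (\<beta> i))"

text \<open>The derivative of order \<open>a\<close> with respect to \<open>u\<close> of a basis
  polynomial rescaled from [-1, 1] to \<open>[-t, t]\<close>.\<close>

definition lag_factor :: "nat \<Rightarrow> real \<Rightarrow> nat \<Rightarrow> nat \<Rightarrow> real \<Rightarrow> complex" where
  "lag_factor K t a m u = of_real (1 / t) ^ a * poly ((pderiv ^^ a) (lag K m)) (of_real (u / t))"

text \<open>The derivative of order \<open>\<alpha>\<close> of the interpolation polynomial on the grid with centre \<open>x\<close> and mesh scale \<open>t\<close>.\<close>
definition interp :: "nat \<Rightarrow> real^'n::finite \<Rightarrow> real \<Rightarrow> ('n \<Rightarrow> nat) \<Rightarrow> (real^'n \<Rightarrow> complex) \<Rightarrow> real^'n \<Rightarrow> complex" where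
  "interp K x t \<alpha> f z = (\<Sum>\<beta>\<in>PiE UNIV (\<lambda>_. {..K}). f (grid_point K x t \<beta>) *
     (\<Prod>i\<in>UNIV. lag_factor K t (\<alpha> i) (\<beta> i) (z $ i - x $ i)))"

lemma has_vector_derivative_lag_factor:
  assumes "t \<noteq> 0"
  shows "((\<lambda>s. lag_factor K t a m (c + s)) has_vector_derivative lag_factor K t (Suc a) m (c + s)) (at s)"
proof -
  let ?q = "(pderiv ^^ a) (lag K m)"
  have "((\<lambda>s. (c + s) / t) has_real_derivative 1 / t) (at s)"
    using assms by (auto intro!: derivative_eq_intros)
  then have l: "((\<lambda>s. complex_of_real ((c + s) / t)) has_vector_derivative of_real (1 / t)) (at s)"
    by (intro has_vector_derivative_of_real) (simp add: has_real_derivative_iff_has_vector_derivative)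
  have "((poly ?q \<circ> (\<lambda>s. complex_of_real ((c + s) / t))) has_vector_derivative
      of_real (1 / t) * poly (pderiv ?q) (of_real ((c + s) / t))) (at s)"
    by (rule field_vector_diff_chain_at [OF l poly_DERIV])
  then have "((\<lambda>s. of_real (1 / t) ^ a * poly ?q (of_real ((c + s) / t))) has_vector_derivative
      of_real (1 / t) ^ a * (of_real (1 / t) * poly (pderiv ?q) (of_real ((c + s) / t)))) (at s)"
    unfolding o_def by (intro has_vector_derivative_mult_right)
  then show ?thesis unfolding lag_factor_def by (simp only: funpow.simps o_apply power_Suc mult_ac)
qed

lemma interp_line:
  fixes z :: "real^'n::finite"
  assumes t: "t \<noteq> 0"
  shows "((\<lambda>s. interp K x t \<alpha> f (z + s *\<^sub>R axis i 1)) has_vector_derivative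
     interp K x t (\<alpha>(i := Suc (\<alpha> i))) f (z + s *\<^sub>R axis i 1)) (at s)"
proof -
  define c where "c \<beta> = f (grid_point K x t \<beta>) * (\<Prod>j\<in>UNIV - {i}. lag_factor K t (\<alpha> j) (\<beta> j) (z $ j - x $ j))" for \<beta>
  have split: "(\<Prod>j\<in>UNIV. lag_factor K t (\<alpha>' j) (\<beta> j) ((z + s *\<^sub>R axis i 1) $ j - x $ j))
     = lag_factor K t (\<alpha>' i) (\<beta> i) (z $ i - x $ i + s) * (\<Prod>j\<in>UNIV - {i}. lag_factor K t (\<alpha> j) (\<beta> j) (z $ j - x $ j))"
    if "\<And>j. j \<noteq> i \<Longrightarrow> \<alpha>' j = \<alpha> j" for \<alpha>' \<beta> s
    by (subst prod.remove [of UNIV i]) (auto simp: that axis_def algebra_simps intro!: prod.cong)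
  have 1: "interp K x t \<alpha>' f (z + s *\<^sub>R axis i 1)
     = (\<Sum>\<beta>\<in>PiE UNIV (\<lambda>_. {..K}). c \<beta> * lag_factor K t (\<alpha>' i) (\<beta> i) (z $ i - x $ i + s))"
    if "\<And>j. j \<noteq> i \<Longrightarrow> \<alpha>' j = \<alpha> j" for \<alpha>' s
    unfolding interp_def c_def
  proof (rule sum.cong [OF refl])
    fix \<beta>
    show "f (grid_point K x t \<beta>) * (\<Prod>j\<in>UNIV. lag_factor K t (\<alpha>' j) (\<beta> j) ((z + s *\<^sub>R axis i 1) $ j - x $ j))
      = f (grid_point K x t \<beta>) * (\<Prod>j\<in>UNIV - {i}. lag_factor K t (\<alpha> j) (\<beta> j) (z $ j - x $ j))
        * lag_factor K t (\<alpha>' i) (\<beta> i) (z $ i - x $ i + s)"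
    proof -
      have "(\<Prod>j\<in>UNIV. lag_factor K t (\<alpha>' j) (\<beta> j) ((z + s *\<^sub>R axis i 1) $ j - x $ j))
         = lag_factor K t (\<alpha>' i) (\<beta> i) (z $ i - x $ i + s) * (\<Prod>j\<in>UNIV - {i}. lag_factor K t (\<alpha> j) (\<beta> j) (z $ j - x $ j))"
        by (rule split) (rule that)
      then show ?thesis by (simp only: mult_ac)
    qed
  qed
  have 2: "((\<lambda>s. \<Sum>\<beta>\<in>PiE UNIV (\<lambda>_. {..K}). c \<beta> * lag_factor K t (\<alpha> i) (\<beta> i) (z $ i - x $ i + s))
      has_vector_derivative (\<Sum>\<beta>\<in>PiE UNIV (\<lambda>_. {..K}). c \<beta> * lag_factor K t (Suc (\<alpha> i)) (\<beta> i) (z $ i - x $ i + s))) (at s)"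
    by (intro has_vector_derivative_sum has_vector_derivative_mult_right has_vector_derivative_lag_factor t)
  show ?thesis using 2 by (simp add: 1)
qed

lemma pd_interp: "t \<noteq> 0 \<Longrightarrow> pd i (interp K x t \<alpha> f) = interp K x t (\<alpha>(i := Suc (\<alpha> i))) f"
  unfolding pd_def by (rule ext) (use vector_derivative_at [OF interp_line [where s = 0]] in auto)

text \<open>Differentiation only raises an entry of the multi-index, so the order of differentiation
  is immaterial for these functions by computation.\<close>

lemma iter_pd_interp:
  assumes "t \<noteq> 0"
  shows "iter_pd is (interp K x t (\<lambda>_. 0) f) = interp K x t (count_list is) f"
proof (induction "is")
  case (Cons i "is")
  have "(count_list is)(i := Suc (count_list is i)) = count_list (i # is)" by (rule ext) auto
  then show ?case using Cons by (simp only: iter_pd.simps pd_interp [OF assms])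
qed (simp add: count_list.simps(1) [abs_def])

lemma sum_count_list_UNIV: "(\<Sum>i\<in>(UNIV :: 'n::finite set). count_list is i) = length is"
  by (rule sum_count_set) auto

lemma prod_fact_le_fact_sum: "finite A \<Longrightarrow> (\<Prod>i\<in>A. fact (a i) :: real) \<le> fact (\<Sum>i\<in>A. a i)"
proof (induction A rule: finite_induct)
  case (insert i A)
  have "(\<Prod>i\<in>insert i A. fact (a i) :: real) \<le> fact (a i) * fact (\<Sum>i\<in>A. a i)"
    using insert by (auto intro: mult_left_mono)
  also have "\<dots> \<le> fact (a i + (\<Sum>i\<in>A. a i))"
    using dvd_imp_le [OF fact_fact_dvd_fact [of "a i" "\<Sum>i\<in>A. a i"]]
    by (simp add: of_nat_le_iff [symmetric, where 'a = real] del: of_nat_le_iff)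
  finally show ?case using insert by simp
qed simp

text \<open>Every coordinate contributes at most \<open>30 ^ K\<close> to a term and
  \<open>K + 1 \<le> 2 ^ K\<close> to the number of terms, together \<open>60 ^ K\<close>.\<close>

lemma norm_interp_le:
  fixes z :: "real^'n::finite"
  assumes t: "0 < t" and z: "\<And>i. \<bar>z $ i - x $ i\<bar> \<le> t"
    and S: "\<And>y. (\<And>i. \<bar>y $ i - x $ i\<bar> \<le> t) \<Longrightarrow> norm (f y) \<le> S"
  shows "norm (interp K x t \<alpha> f z) \<le> fact (sum \<alpha> UNIV) / t ^ sum \<alpha> UNIV * 60 ^ (K * CARD('n)) * S"
proof -
  let ?B = "PiE (UNIV :: 'n set) (\<lambda>_. {..K})" and ?a = "sum \<alpha> UNIV"
  have S0: "0 \<le> S" by (rule order_trans [OF norm_ge_zero S [of x]]) (use t in auto)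
  have fac: "norm (lag_factor K t a m (z $ i - x $ i)) \<le> (1 / t) ^ a * (fact a * 30 ^ K)" if "m \<le> K" for a m i
  proof -
    have "\<bar>(z $ i - x $ i) / t\<bar> \<le> 1" using z [of i] t by simp
    from norm_pderiv_lag_le [OF that this, of a] show ?thesis
      unfolding lag_factor_def norm_mult norm_power norm_of_real using t by (intro mult_mono) auto
  qed
  have one: "norm (f (grid_point K x t \<beta>) * (\<Prod>i\<in>UNIV. lag_factor K t (\<alpha> i) (\<beta> i) (z $ i - x $ i)))
      \<le> S * (fact ?a / t ^ ?a * 30 ^ (K * CARD('n)))" if \<beta>: "\<beta> \<in> ?B" for \<beta>
  proof -
    have b: "\<beta> i \<le> K" for i using \<beta> by (auto simp: PiE_def)
    have "norm (f (grid_point K x t \<beta>)) \<le> S"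
    proof (rule S)
      fix i show "\<bar>grid_point K x t \<beta> $ i - x $ i\<bar> \<le> t"
        using mult_left_mono [OF abs_lag_node_le [OF b [of i]], of t] t by (simp add: grid_point_def abs_mult)
    qed
    moreover have "norm (\<Prod>i\<in>UNIV. lag_factor K t (\<alpha> i) (\<beta> i) (z $ i - x $ i))
        \<le> fact ?a / t ^ ?a * 30 ^ (K * CARD('n))"
    proof -
      have "norm (\<Prod>i\<in>UNIV. lag_factor K t (\<alpha> i) (\<beta> i) (z $ i - x $ i))
          \<le> (\<Prod>i\<in>UNIV. (1 / t) ^ \<alpha> i * (fact (\<alpha> i) * 30 ^ K))"
        unfolding prod_norm [symmetric] by (intro prod_mono conjI norm_ge_zero fac b)
      also have "\<dots> = (1 / t) ^ ?a * ((\<Prod>i\<in>UNIV. fact (\<alpha> i)) * 30 ^ (K * CARD('n)))"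
        by (simp add: prod.distrib power_sum power_mult)
      also have "\<dots> \<le> (1 / t) ^ ?a * (fact ?a * 30 ^ (K * CARD('n)))"
        using t by (intro mult_left_mono mult_right_mono prod_fact_le_fact_sum) auto
      finally show ?thesis by (simp add: power_one_over)
    qed
    ultimately show ?thesis unfolding norm_mult using S0 by (intro mult_mono) auto
  qed
  have "norm (interp K x t \<alpha> f z) \<le> real (card ?B) * (S * (fact ?a / t ^ ?a * 30 ^ (K * CARD('n))))"
    unfolding interp_def by (rule sum_norm_bound) (rule one)
  also have "card ?B = (K + 1) ^ CARD('n)" by (simp add: card_PiE)
  also have "real ((K + 1) ^ CARD('n)) * (S * (fact ?a / t ^ ?a * 30 ^ (K * CARD('n))))
      \<le> (2 ^ K) ^ CARD('n) * (S * (fact ?a / t ^ ?a * 30 ^ (K * CARD('n))))"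
  proof (rule mult_right_mono)
    have "K + 1 \<le> 2 ^ K" using Suc_leI [OF less_exp [of K]] by simp
    then have "real (K + 1) \<le> 2 ^ K" by (metis of_nat_le_iff of_nat_numeral of_nat_power)
    then show "real ((K + 1) ^ CARD('n)) \<le> (2 ^ K) ^ CARD('n)" by (simp add: power_mono)
  qed (use S0 t in auto)
  also have "\<dots> = fact ?a / t ^ ?a * (2 ^ (K * CARD('n)) * 30 ^ (K * CARD('n))) * S" by (simp add: power_mult)
  also have "(2::real) ^ (K * CARD('n)) * 30 ^ (K * CARD('n)) = 60 ^ (K * CARD('n))"
    by (simp add: power_mult_distrib [symmetric])
  finally show ?thesis .
qed


lemma coord_poly_interp:
  fixes x :: "real^'n::finite"
  shows "coord_poly K (interp K x t \<alpha> f)"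
  unfolding coord_poly_def
proof (intro allI)
  fix z :: "real^'n" and i
  define c where "c \<beta> = f (grid_point K x t \<beta>) * (\<Prod>j\<in>UNIV - {i}. lag_factor K t (\<alpha> j) (\<beta> j) (z $ j - x $ j))
     * of_real (1 / t) ^ \<alpha> i" for \<beta>
  define r where "r \<beta> = pcompose ((pderiv ^^ \<alpha> i) (lag K (\<beta> i))) [:of_real ((z $ i - x $ i) / t), of_real (1 / t):]" for \<beta>
  define q where "q = (\<Sum>\<beta>\<in>PiE UNIV (\<lambda>_. {..K}). smult (c \<beta>) (r \<beta>))"
  have "degree (r \<beta>) \<le> K" if "\<beta> \<in> PiE UNIV (\<lambda>_. {..K})" for \<beta>
  proof -
    have "degree ((pderiv ^^ \<alpha> i) (lag K (\<beta> i))) \<le> K"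
      by (rule order_trans [OF degree_higher_pderiv_le degree_lag]) (use that in \<open>auto simp: PiE_def\<close>)
    then have "degree ((pderiv ^^ \<alpha> i) (lag K (\<beta> i))) * degree [:complex_of_real ((z $ i - x $ i) / t), of_real (1 / t):] \<le> K * 1"
      by (intro mult_le_mono) auto
    then show ?thesis unfolding r_def by (intro order_trans [OF degree_pcompose_le]) (simp only: mult_1_right)
  qed
  then have "degree q \<le> K" unfolding q_def
    by (intro degree_sum_le order_trans [OF degree_smult_le]) (auto intro!: finite_PiE)
  moreover have "interp K x t \<alpha> f (z + s *\<^sub>R axis i 1) = poly q (of_real s)" for s
    unfolding interp_def q_def poly_sum
  proof (rule sum.cong [OF refl])
    fix \<beta>
    have "(\<Prod>j\<in>UNIV. lag_factor K t (\<alpha> j) (\<beta> j) ((z + s *\<^sub>R axis i 1) $ j - x $ j))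
     = lag_factor K t (\<alpha> i) (\<beta> i) (z $ i - x $ i + s) * (\<Prod>j\<in>UNIV - {i}. lag_factor K t (\<alpha> j) (\<beta> j) (z $ j - x $ j))"
      by (subst prod.remove [of UNIV i]) (auto simp: axis_def algebra_simps intro!: prod.cong)
    moreover have "lag_factor K t (\<alpha> i) (\<beta> i) (z $ i - x $ i + s) = of_real (1 / t) ^ \<alpha> i * poly (r \<beta>) (of_real s)"
      by (simp add: lag_factor_def r_def poly_pcompose add_divide_distrib)
    ultimately show "f (grid_point K x t \<beta>) * (\<Prod>j\<in>UNIV. lag_factor K t (\<alpha> j) (\<beta> j) ((z + s *\<^sub>R axis i 1) $ j - x $ j))
       = poly (smult (c \<beta>) (r \<beta>)) (of_real s)"
      unfolding c_def poly_smult by (simp only: mult_ac)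
  qed
  ultimately show "\<exists>q. degree q \<le> K \<and> (\<forall>s. interp K x t \<alpha> f (z + s *\<^sub>R axis i 1) = poly q (of_real s))" by blast
qed

lemma coord_poly_diff: "coord_poly K p \<Longrightarrow> coord_poly K q \<Longrightarrow> coord_poly K (\<lambda>z. p z - q z)"
  unfolding coord_poly_def by (metis (no_types) degree_diff_le poly_diff)

lemma coord_poly_mono: "coord_poly K p \<Longrightarrow> K \<le> L \<Longrightarrow> coord_poly L p"
  unfolding coord_poly_def by (meson order_trans)

text \<open>Interpolation in the coordinates of \<open>S\<close> only. It leads from
  \<open>f\<close> to \<open>interp\<close> by induction over \<open>S\<close>.\<close>

definition partial_interp :: "nat \<Rightarrow> real^'n::finite \<Rightarrow> real \<Rightarrow> 'n set \<Rightarrow> (real^'n \<Rightarrow> complex) \<Rightarrow> real^'n \<Rightarrow> complex" where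
  "partial_interp K x t S f z = (\<Sum>\<beta>\<in>PiE S (\<lambda>_. {..K}).
     f (\<chi> j. if j \<in> S then x $ j + t * lag_node K (\<beta> j) else z $ j) *
     (\<Prod>i\<in>S. poly (lag K (\<beta> i)) (of_real ((z $ i - x $ i) / t))))"

lemma partial_interp_UNIV: "partial_interp K x t UNIV f z = interp K x t (\<lambda>_. 0) f z"
  by (simp add: partial_interp_def interp_def grid_point_def lag_factor_def)

lemma partial_interp_empty: "partial_interp K x t {} f z = f z"
  by (simp add: partial_interp_def)

definition vec_upd :: "real^'n::finite \<Rightarrow> 'n \<Rightarrow> real \<Rightarrow> real^'n" where
  "vec_upd z i v = (\<chi> j. if j = i then v else z $ j)"

lemma partial_interp_insert:
  fixes x :: "real^'n::finite"
  assumes i: "i \<notin> S"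
  shows "partial_interp K x t (insert i S) f z = (\<Sum>m\<le>K. poly (lag K m) (of_real ((z $ i - x $ i) / t)) *
           partial_interp K x t S f (vec_upd z i (x $ i + t * lag_node K m)))"
proof -
  let ?\<phi> = "\<lambda>(m, \<beta>). \<beta>(i := m)"
  let ?T = "\<lambda>\<beta>. f (\<chi> j. if j \<in> insert i S then x $ j + t * lag_node K (\<beta> j) else z $ j) *
     (\<Prod>i\<in>insert i S. poly (lag K (\<beta> i)) (of_real ((z $ i - x $ i) / t)))"
  have inj: "inj_on ?\<phi> ({..K} \<times> PiE S (\<lambda>_. {..K}))"
    by (rule inj_combinator) (rule i)
  have "partial_interp K x t (insert i S) f z = (\<Sum>p\<in>{..K} \<times> PiE S (\<lambda>_. {..K}). ?T (?\<phi> p))"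
    unfolding partial_interp_def PiE_insert_eq by (subst sum.reindex [OF inj]) (simp only: o_def)
  also have "\<dots> = (\<Sum>m\<le>K. \<Sum>\<beta>\<in>PiE S (\<lambda>_. {..K}). ?T (\<beta>(i := m)))"
    unfolding sum.cartesian_product by (rule sum.cong) auto
  also have "\<dots> = (\<Sum>m\<le>K. poly (lag K m) (of_real ((z $ i - x $ i) / t)) *
           partial_interp K x t S f (vec_upd z i (x $ i + t * lag_node K m)))"
    unfolding partial_interp_def sum_distrib_left
  proof (intro sum.cong refl)
    fix m \<beta>
    have v: "(\<chi> j. if j \<in> insert i S then x $ j + t * lag_node K ((\<beta>(i := m)) j) else z $ j)
        = (\<chi> j. if j \<in> S then x $ j + t * lag_node K (\<beta> j) else vec_upd z i (x $ i + t * lag_node K m) $ j)"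
      using i by (auto simp: vec_eq_iff vec_upd_def)
    have p: "(\<Prod>j\<in>insert i S. poly (lag K ((\<beta>(i := m)) j)) (of_real ((z $ j - x $ j) / t)))
       = poly (lag K m) (of_real ((z $ i - x $ i) / t)) *
         (\<Prod>j\<in>S. poly (lag K (\<beta> j)) (of_real ((vec_upd z i (x $ i + t * lag_node K m) $ j - x $ j) / t)))"
      using i by (auto simp: vec_upd_def intro!: prod.cong)
    show "?T (\<beta>(i := m)) = poly (lag K m) (of_real ((z $ i - x $ i) / t)) *
       (f (\<chi> j. if j \<in> S then x $ j + t * lag_node K (\<beta> j) else vec_upd z i (x $ i + t * lag_node K m) $ j) *
       (\<Prod>j\<in>S. poly (lag K (\<beta> j)) (of_real ((vec_upd z i (x $ i + t * lag_node K m) $ j - x $ j) / t))))"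
      unfolding v p by (simp only: mult_ac)
  qed
  finally show ?thesis .
qed

lemma interpolation_line:
  fixes q :: "complex poly"
  assumes "degree q \<le> K" "t \<noteq> 0"
  shows "poly q (of_real s) = (\<Sum>m\<le>K. poly (lag K m) (of_real (s / t)) * poly q (of_real (t * lag_node K m)))"
proof -
  let ?q = "pcompose q [:0, of_real t:]"
  have "degree ?q \<le> K" using assms(1) order_trans [OF degree_pcompose_le [of q "[:0, complex_of_real t:]"]] by (auto split: if_splits)
  from lagrange_interpolation [OF this, of "of_real (s / t)"] show ?thesis
    using assms(2) by (simp add: poly_pcompose mult.commute)
qed

lemma interp_coord_poly:
  fixes x :: "real^'n::finite"
  assumes p: "coord_poly K p" and t: "t \<noteq> 0"
  shows "interp K x t (\<lambda>_. 0) p = p"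
proof
  fix z
  have "partial_interp K x t S p z = p z" if "finite S" for S z
    using that
  proof (induction S arbitrary: z rule: finite_induct)
    case (insert i S)
    obtain q where q: "degree q \<le> K" "\<And>s. p (vec_upd z i (x $ i) + s *\<^sub>R axis i 1) = poly q (of_real s)"
      using p unfolding coord_poly_def by blast
    have u: "p (vec_upd z i (x $ i + s)) = poly q (of_real s)" for s
    proof -
      have "vec_upd z i (x $ i + s) = vec_upd z i (x $ i) + s *\<^sub>R axis i 1"
        by (simp add: vec_upd_def vec_eq_iff axis_def)
      then show ?thesis by (simp only: q)
    qed
    have "z = vec_upd z i (x $ i + (z $ i - x $ i))" by (simp add: vec_upd_def vec_eq_iff)
    then have "p z = poly q (of_real (z $ i - x $ i))" by (metis u)
    then show ?case
      unfolding partial_interp_insert [OF insert(2)] insert.IH u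
      using interpolation_line [OF q(1) t, of "z $ i - x $ i"] by simp
  qed (simp add: partial_interp_empty)
  from this [of UNIV] show "interp K x t (\<lambda>_. 0) p z = p z" by (simp add: partial_interp_UNIV)
qed

text \<open>On a line in the new direction \<open>f\<close> is within \<open>e\<close> of a
  polynomial that interpolation reproduces. So a further coordinate adds \<open>e\<close> and
  amplifies the previous error, increased by \<open>e\<close>, by at most
  \<open>(K + 1) * 30 ^ K\<close>, a bound for the Lebesgue constant. \<open>Y\<close> is this
  number plus 1.\<close>

lemma norm_diff_interp_le:
  fixes x :: "real^'n::finite"
  assumes t: "0 < t" and e: "0 \<le> e"
    and line: "\<And>z i. (\<And>j. \<bar>z $ j - x $ j\<bar> \<le> t) \<Longrightarrow> z $ i = x $ i \<Longrightarrow> 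
        poly_approx K t e (\<lambda>s. f (z + s *\<^sub>R axis i 1))"
    and z: "\<And>j. \<bar>z $ j - x $ j\<bar> \<le> t"
  shows "norm (f z - interp K x t (\<lambda>_. 0) f z) \<le> real CARD('n) * (1 + (real K + 1) * 30 ^ K) ^ CARD('n) * e"
proof -
  define Y where "Y = 1 + (real K + 1) * 30 ^ K"
  have Y: "1 \<le> Y" unfolding Y_def by simp
  have "norm (f z - partial_interp K x t S f z) \<le> real (card S) * Y ^ card S * e"
    if "finite S" "\<And>j. \<bar>z $ j - x $ j\<bar> \<le> t" for S z
    using that
  proof (induction S arbitrary: z rule: finite_induct)
    case (insert i S)
    let ?s = "z $ i - x $ i" and ?u = "\<lambda>s. vec_upd z i (x $ i + s)"
    have in_box: "\<bar>?u s $ j - x $ j\<bar> \<le> t" if "\<bar>s\<bar> \<le> t" for s j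
      using that insert.prems [of j] by (simp add: vec_upd_def)
    obtain q where q: "degree q \<le> K" "\<And>s. \<bar>s\<bar> \<le> t \<Longrightarrow> norm (f (?u 0 + s *\<^sub>R axis i 1) - poly q (of_real s)) \<le> e"
      using line [of "?u 0" i] in_box [of 0] t unfolding poly_approx_def by (auto simp: vec_upd_def)
    have u: "norm (f (?u s) - poly q (of_real s)) \<le> e" if "\<bar>s\<bar> \<le> t" for s
    proof -
      have "?u s = ?u 0 + s *\<^sub>R axis i 1"
        by (simp add: vec_upd_def vec_eq_iff axis_def)
      then show ?thesis using q(2) [OF that] by simp
    qed
    have node: "\<bar>t * lag_node K m\<bar> \<le> t" if "m \<le> K" for m
      using mult_left_mono [OF abs_lag_node_le [OF that], of t] t by (simp add: abs_mult)
    have lag: "norm (poly (lag K m) (of_real (?s / t))) \<le> 30 ^ K" if "m \<le> K" for m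
    proof -
      have "\<bar>?s / t\<bar> \<le> 1" using insert.prems [of i] t by simp
      from norm_pderiv_lag_le [OF that this, of 0] show ?thesis by simp
    qed
    let ?L = "\<lambda>m. poly (lag K m) (of_real (?s / t))"
    have z: "z = ?u ?s" by (simp add: vec_upd_def vec_eq_iff)
    have "f z - partial_interp K x t (insert i S) f z
      = (f z - poly q (of_real ?s)) - (\<Sum>m\<le>K. ?L m * (partial_interp K x t S f (?u (t * lag_node K m)) - poly q (of_real (t * lag_node K m))))"
      unfolding partial_interp_insert [OF insert(2)]
      using interpolation_line [OF q(1), of t ?s] t by (simp add: right_diff_distrib sum_subtractf)
    also have "norm \<dots> \<le> e + (real K + 1) * (30 ^ K * (real (card S) * Y ^ card S * e + e))"
    proof (rule norm_triangle_le_diff, rule add_mono)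
      show "norm (f z - poly q (of_real ?s)) \<le> e"
        by (subst z, rule u) (rule insert.prems)
      have "norm (\<Sum>m\<le>K. ?L m * (partial_interp K x t S f (?u (t * lag_node K m)) - poly q (of_real (t * lag_node K m))))
         \<le> real (card {..K}) * (30 ^ K * (real (card S) * Y ^ card S * e + e))"
      proof (rule sum_norm_bound)
        fix m assume "m \<in> {..K}"
        then have m: "m \<le> K" by simp
        have "norm (partial_interp K x t S f (?u (t * lag_node K m)) - f (?u (t * lag_node K m))) \<le> real (card S) * Y ^ card S * e"
          using insert.IH [of "?u (t * lag_node K m)"] in_box [OF node [OF m]] by (simp add: norm_minus_commute)
        then have "norm (partial_interp K x t S f (?u (t * lag_node K m)) - poly q (of_real (t * lag_node K m)))
            \<le> real (card S) * Y ^ card S * e + e"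
          using norm_triangle_mono [OF _ u [OF node [OF m]]] by fastforce
        then show "norm (?L m * (partial_interp K x t S f (?u (t * lag_node K m)) - poly q (of_real (t * lag_node K m))))
            \<le> 30 ^ K * (real (card S) * Y ^ card S * e + e)"
          unfolding norm_mult by (intro mult_mono lag m) auto
      qed
      then show "norm (\<Sum>m\<le>K. ?L m * (partial_interp K x t S f (?u (t * lag_node K m)) - poly q (of_real (t * lag_node K m))))
         \<le> (real K + 1) * (30 ^ K * (real (card S) * Y ^ card S * e + e))" by (simp add: add.commute)
    qed
    also have "\<dots> = Y * e + (Y - 1) * (real (card S) * Y ^ card S * e)" unfolding Y_def by (simp add: algebra_simps)
    also have "\<dots> \<le> Y * Y ^ card S * e + Y * (real (card S) * Y ^ card S * e)"
    proof (intro add_mono mult_right_mono)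
      show "Y \<le> Y * Y ^ card S" using Y one_le_power [OF Y, of "card S"] by simp
    qed (use e Y in auto)
    also have "\<dots> = real (card (insert i S)) * Y ^ card (insert i S) * e"
      using insert(1,2) by (simp add: algebra_simps)
    finally show ?case .
  qed (simp add: partial_interp_empty)
  from this [of UNIV, OF _ z] show ?thesis by (simp add: partial_interp_UNIV Y_def)
qed

text \<open>The bound comes from expressing \<open>p\<close> through its values on a grid.\<close>
lemma norm_iter_pd_coord_poly_le:
  fixes x :: "real^'n::finite"
  assumes p: "coord_poly K p" and t: "0 < t" and z: "\<And>i. \<bar>z $ i - x $ i\<bar> \<le> t"
    and S: "\<And>y. (\<And>i. \<bar>y $ i - x $ i\<bar> \<le> t) \<Longrightarrow> norm (p y) \<le> S"
  shows "norm (iter_pd is p z) \<le> fact (length is) / t ^ length is * 60 ^ (K * CARD('n)) * S"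
proof -
  have "iter_pd is p = interp K x t (count_list is) p"
    using iter_pd_interp [of t "is" K x p] interp_coord_poly [OF p, of t x] t by simp
  then show ?thesis
    using norm_interp_le [OF t z S, where K = K and \<alpha> = "count_list is"] by (simp only: sum_count_list_UNIV)
qed

text \<open>Iterated \<open>pd\<close> is not additive for arbitrary functions, since a derivative
  need not exist. For these polynomials additivity is read off from the interpolation formula, which
  is linear in the values on the grid.\<close>

lemma iter_pd_diff_coord_poly:
  fixes p q :: "real^'n::finite \<Rightarrow> complex"
  assumes "coord_poly K p" "coord_poly K q"
  shows "iter_pd is (\<lambda>z. p z - q z) z = iter_pd is p z - iter_pd is q z"
proof -
  have e: "iter_pd is p = interp K 0 1 (count_list is) p" if "coord_poly K p" for p :: "real^'n \<Rightarrow> complex"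
    using iter_pd_interp [of 1 "is" K 0 p] interp_coord_poly [OF that, of 1 0] by simp
  show ?thesis unfolding e [OF coord_poly_diff [OF assms]] e [OF assms(1)] e [OF assms(2)]
    by (simp add: interp_def left_diff_distrib sum_subtractf)
qed

lemma iter_pd_coord_poly_line:
  fixes z :: "real^'n::finite"
  assumes "coord_poly K p"
  shows "((\<lambda>s. iter_pd is p (z + s *\<^sub>R axis i 1)) has_vector_derivative
    iter_pd (i # is) p (z + s *\<^sub>R axis i 1)) (at s)"
proof -
  have e: "iter_pd is p = interp K 0 1 (count_list is) p" for "is"
    using iter_pd_interp [of 1 "is" K 0 p] interp_coord_poly [OF assms, of 1 0] by simp
  have "(count_list is)(i := Suc (count_list is i)) = count_list (i # is)" by (rule ext) auto
  then show ?thesis unfolding e using interp_line [of 1 K 0 "count_list is" p z i s] by simp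
qed

lemma continuous_on_iter_pd_coord_poly:
  fixes p :: "real^'n::finite \<Rightarrow> complex"
  assumes "coord_poly K p"
  shows "continuous_on A (iter_pd is p)"
proof -
  have "iter_pd is p = interp K 0 1 (count_list is) p"
    using iter_pd_interp [of 1 "is" K 0 p] interp_coord_poly [OF assms, of 1 0] by simp
  then show ?thesis by (simp add: interp_def [abs_def] lag_factor_def) (intro continuous_intros)
qed

section \<open>Smoothness from local approximation by polynomials\<close>

lemma geometric_cauchy_limit:
  fixes a :: "nat \<Rightarrow> complex"
  assumes a: "\<And>l. norm (a l - a (Suc l)) \<le> E / 4 ^ l"
  obtains L where "\<And>l. norm (a l - L) \<le> 2 * E / 4 ^ l"
proof -
  have g: "(\<lambda>n. E / 4 ^ l * (1 / 4) ^ n) sums (E / 4 ^ l * (1 / (1 - 1 / 4)))" for l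
    by (intro sums_mult geometric_sums) auto
  have E0: "0 \<le> E" using order_trans [OF norm_ge_zero a [of 0]] by simp
  have b: "norm (a (n + l) - a (Suc n + l)) \<le> E / 4 ^ l * (1 / 4) ^ n" for n l
    using a [of "n + l"] by (simp add: power_add power_divide mult.commute)
  have "summable (\<lambda>n. a (n + 0) - a (Suc n + 0))"
    by (rule summable_comparison_test' [OF sums_summable [OF g [of 0]]]) (rule b)
  then have "summable (\<lambda>n. a (Suc n) - a n)"
    using summable_minus by fastforce
  then have "convergent a" by (simp add: telescope_summable' summable_iff_convergent sum_lessThan_telescope convergent_diff_const_right_iff)
  then obtain L where L: "a \<longlonglongrightarrow> L" unfolding convergent_def by blast
  have "norm (a l - L) \<le> 2 * E / 4 ^ l" for l
  proof -
    have "(\<lambda>n. a (n + l)) \<longlonglongrightarrow> L" using L by (rule LIMSEQ_ignore_initial_segment)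
    then have "(\<lambda>n. a (n + l) - a (Suc n + l)) sums (a (0 + l) - L)" by (rule telescope_sums')
    then have "norm (a l - L) \<le> (\<Sum>n. E / 4 ^ l * (1 / 4) ^ n)"
      using norm_suminf_le [OF b sums_summable [OF g]] sums_unique by fastforce
    also have "\<dots> = E / 4 ^ l * (4 / 3)" using sums_unique [OF g [of l]] by simp
    also have "\<dots> \<le> E / 4 ^ l * 2" using E0 by (intro mult_left_mono) auto
    finally show ?thesis by (simp add: mult.commute)
  qed
  then show thesis by (rule that)
qed

lemma norm_diff_sum_le: "norm (a - b + c + d) \<le> norm a + norm b + norm c + norm d"
  for a b c d :: "'a::real_normed_vector"
  by (intro order_trans [OF norm_triangle_ineq] add_right_mono norm_triangle_ineq4)

lemma second_order_bound:
  fixes \<phi> :: "real \<Rightarrow> complex"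
  assumes d1: "\<And>u. \<bar>u\<bar> \<le> \<bar>s\<bar> \<Longrightarrow> (\<phi> has_vector_derivative \<phi>' u) (at u)"
    and d2: "\<And>u. \<bar>u\<bar> \<le> \<bar>s\<bar> \<Longrightarrow> (\<phi>' has_vector_derivative \<phi>'' u) (at u)"
    and M: "\<And>u. \<bar>u\<bar> \<le> \<bar>s\<bar> \<Longrightarrow> norm (\<phi>'' u) \<le> M"
  shows "norm (\<phi> s - \<phi> 0 - s *\<^sub>R \<phi>' 0) \<le> M * s\<^sup>2"
proof -
  let ?I = "{-\<bar>s\<bar>..\<bar>s\<bar>}"
  have b1: "norm (\<phi>' u - \<phi>' 0) \<le> M * \<bar>s\<bar>" if u: "u \<in> ?I" for u
  proof -
    have M0: "0 \<le> M" by (rule order_trans [OF norm_ge_zero M [of 0]]) simp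
    have "norm (\<phi>' u - \<phi>' 0) \<le> M * norm (u - 0)"
    proof (rule differentiable_bound [where S = ?I and f' = "\<lambda>v h. h *\<^sub>R \<phi>'' v"])
      fix v assume "v \<in> ?I"
      then have v: "\<bar>v\<bar> \<le> \<bar>s\<bar>" by auto
      show "(\<phi>' has_derivative (\<lambda>h. h *\<^sub>R \<phi>'' v)) (at v within ?I)"
        using has_vector_derivative_at_within [OF d2 [OF v]] unfolding has_vector_derivative_def .
      show "onorm (\<lambda>h. h *\<^sub>R \<phi>'' v) \<le> M"
      proof (rule onorm_le)
        fix h :: real
        show "norm (h *\<^sub>R \<phi>'' v) \<le> M * norm h"
          using mult_right_mono [OF M [OF v], of "\<bar>h\<bar>"] by (simp add: mult.commute)
      qed
    qed (use u in auto)
    also have "\<dots> \<le> M * \<bar>s\<bar>" using u M0 by (intro mult_left_mono) auto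
    finally show ?thesis .
  qed
  have "norm (\<phi> s - \<phi> 0 - (s - 0) *\<^sub>R \<phi>' 0) \<le> norm (s - 0) * (M * \<bar>s\<bar>)"
  proof (rule vector_differentiable_bound_linearization [where S = ?I])
    show "(\<phi> has_vector_derivative \<phi>' v) (at v within ?I)" if "v \<in> ?I" for v
      by (rule has_vector_derivative_at_within [OF d1]) (use that in auto)
    show "closed_segment 0 s \<subseteq> ?I" by (auto simp: closed_segment_eq_real_ivl)
  qed (use b1 in auto)
  then show ?thesis by (simp add: power2_eq_square abs_mult_self_eq mult.left_commute [of "\<bar>s\<bar>"])
qed

lemma has_vector_derivative_of_quadratic_bound:
  fixes \<phi> :: "real \<Rightarrow> complex"
  assumes "0 < d" and b: "\<And>s. \<bar>s\<bar> < d \<Longrightarrow> norm (\<phi> s - \<phi> 0 - s *\<^sub>R v) \<le> C * s\<^sup>2"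
  shows "(\<phi> has_vector_derivative v) (at 0)"
  unfolding has_vector_derivative_def has_derivative_at
proof (intro conjI bounded_linear_scaleR_left)
  have "((\<lambda>h. norm (\<phi> (0 + h) - \<phi> 0 - h *\<^sub>R v) / norm h) \<longlongrightarrow> 0) (at 0)"
  proof (rule Lim_null_comparison)
    show "\<forall>\<^sub>F h in at 0. norm (norm (\<phi> (0 + h) - \<phi> 0 - h *\<^sub>R v) / norm h) \<le> C * \<bar>h\<bar>"
      unfolding eventually_at
    proof (intro exI [of _ d] conjI ballI impI assms(1))
      fix h :: real assume "h \<noteq> 0 \<and> dist h 0 < d"
      then have h: "h \<noteq> 0" "\<bar>h\<bar> < d" by auto
      have "norm (\<phi> h - \<phi> 0 - h *\<^sub>R v) / \<bar>h\<bar> \<le> C * h\<^sup>2 / \<bar>h\<bar>"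
        using b [OF h(2)] by (intro divide_right_mono) auto
      also have "\<dots> = C * \<bar>h\<bar>" using h by (auto simp: power2_eq_square abs_if)
      finally show "norm (norm (\<phi> (0 + h) - \<phi> 0 - h *\<^sub>R v) / norm h) \<le> C * \<bar>h\<bar>" by simp
    qed
    show "((\<lambda>h. C * \<bar>h\<bar>) \<longlongrightarrow> 0) (at 0)" by (auto intro!: tendsto_eq_intros)
  qed
  then show "((\<lambda>h. norm (\<phi> (0 + h) - \<phi> 0 - h *\<^sub>R v) / norm h) \<midarrow>0\<rightarrow> 0)" .
qed

text \<open>Each centre \<open>x\<close> has its own polynomials, which need not fit together for
  different centres. The left side of \<open>rate\<close> is the Markov bound on the cube of half
  side \<open>t (Suc l)\<close> for a polynomial of size \<open>2 * e l\<close>, the possible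
  difference of two approximants. The rate \<open>1 / 4 ^ l\<close> is proportional to the square of
  \<open>t l\<close>, so that it stays negligible after division by an increment of size
  \<open>t l\<close>.\<close>

locale coord_poly_approx =
  fixes f :: "real^'n::finite \<Rightarrow> complex" and P :: "nat \<Rightarrow> real^'n \<Rightarrow> real^'n \<Rightarrow> complex"
    and K :: "nat \<Rightarrow> nat" and t e :: "nat \<Rightarrow> real" and r E S :: real and m :: nat
  assumes r: "0 < r" and t0: "0 < t 0" and t_Suc: "\<And>l. t (Suc l) = t l / 2"
    and K_mono: "\<And>l. K l \<le> K (Suc l)" and e_mono: "\<And>l. e (Suc l) \<le> e l"
    and P: "\<And>l x. (\<And>i. \<bar>x $ i\<bar> < r) \<Longrightarrow> coord_poly (K l) (P l x)"
    and approx: "\<And>l x y. (\<And>i. \<bar>x $ i\<bar> < r) \<Longrightarrow> (\<And>i. \<bar>y $ i - x $ i\<bar> \<le> t l) \<Longrightarrow> norm (f y - P l x y) \<le> e l"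
    and bound: "\<And>x y. (\<And>i. \<bar>x $ i\<bar> < r) \<Longrightarrow> (\<And>i. \<bar>y $ i - x $ i\<bar> \<le> t 0) \<Longrightarrow> norm (P 0 x y) \<le> S"
    and rate: "\<And>l a. a \<le> m \<Longrightarrow> fact a / t (Suc l) ^ a * 60 ^ (K (Suc l) * CARD('n)) * (2 * e l) \<le> E / 4 ^ l"
begin

definition U :: "(real^'n) set" where "U = {x. \<forall>i. \<bar>x $ i\<bar> < r}"

definition D :: "nat \<Rightarrow> 'n list \<Rightarrow> real^'n \<Rightarrow> complex" where "D l is x = iter_pd is (P l x) x"

lemma t_eq: "t l = t 0 / 2 ^ l"
  by (induction l) (simp_all add: t_Suc del: mult_2)

lemma t_pos: "0 < t l"
  unfolding t_eq [of l] using t0 by simp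

lemma coord_poly_P: "x \<in> U \<Longrightarrow> coord_poly (K l) (P l x)"
  using P unfolding U_def by simp

lemma e_nonneg: "0 \<le> e l"
  using order_trans [OF norm_ge_zero approx [of 0 0 l]] r t_pos [of l] by simp

lemma next_level:
  assumes x: "x \<in> U" and z: "\<And>i. \<bar>z $ i - x $ i\<bar> \<le> t (Suc l)" and a: "length is \<le> m"
  shows "norm (iter_pd is (P l x) z - iter_pd is (P (Suc l) x) z) \<le> E / 4 ^ l"
proof -
  let ?p = "\<lambda>z. P l x z - P (Suc l) x z"
  have c: "coord_poly (K (Suc l)) (P l x)" "coord_poly (K (Suc l)) (P (Suc l) x)"
    using coord_poly_P [OF x] coord_poly_mono [OF _ K_mono] by blast+
  have "norm (iter_pd is ?p z) \<le> fact (length is) / t (Suc l) ^ length is * 60 ^ (K (Suc l) * CARD('n)) * (2 * e l)"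
  proof (rule norm_iter_pd_coord_poly_le [OF coord_poly_diff [OF c] t_pos z])
    fix y assume y: "\<And>i. \<bar>y $ i - x $ i\<bar> \<le> t (Suc l)"
    then have y2: "\<bar>y $ i - x $ i\<bar> \<le> t l" for i
      using y [of i] t_pos [of l] unfolding t_Suc by linarith
    have "norm (f y - P l x y) \<le> e l" "norm (f y - P (Suc l) x y) \<le> e (Suc l)"
      using x by (auto simp: U_def intro: approx y y2)
    then show "norm (P l x y - P (Suc l) x y) \<le> 2 * e l"
      using e_mono [of l] norm_triangle_ineq4 [of "f y - P (Suc l) x y" "f y - P l x y"] by simp
  qed
  also have "\<dots> \<le> E / 4 ^ l" by (rule rate [OF a])
  finally show ?thesis unfolding iter_pd_diff_coord_poly [OF c] .
qed

text \<open>The cube of half side \<open>t (Suc l)\<close> about \<open>y\<close> is contained in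
  the cube of half side \<open>t l\<close> about \<open>x\<close>, so both polynomials are close to
  \<open>f\<close> on it.\<close>

lemma change_center:
  assumes x: "x \<in> U" and y: "y \<in> U" and xy: "\<And>i. \<bar>y $ i - x $ i\<bar> \<le> t (Suc l)"
    and a: "length is \<le> m"
  shows "norm (iter_pd is (P l x) y - D l is y) \<le> E / 4 ^ l"
proof -
  let ?p = "\<lambda>z. P l x z - P l y z"
  have c: "coord_poly (K (Suc l)) (P l x)" "coord_poly (K (Suc l)) (P l y)"
    using coord_poly_P [OF x] coord_poly_P [OF y] coord_poly_mono [OF _ K_mono] by blast+
  have "norm (iter_pd is ?p y) \<le> fact (length is) / t (Suc l) ^ length is * 60 ^ (K (Suc l) * CARD('n)) * (2 * e l)"
  proof (rule norm_iter_pd_coord_poly_le [OF coord_poly_diff [OF c] t_pos])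
    show "\<bar>y $ i - y $ i\<bar> \<le> t (Suc l)" for i using t_pos [of "Suc l"] by simp
    fix z assume z: "\<And>i. \<bar>z $ i - y $ i\<bar> \<le> t (Suc l)"
    have z1: "\<bar>z $ i - x $ i\<bar> \<le> t l" for i
      using z [of i] xy [of i] unfolding t_Suc by linarith
    have z2: "\<bar>z $ i - y $ i\<bar> \<le> t l" for i
      using z [of i] t_pos [of l] unfolding t_Suc by linarith
    have "norm (f z - P l x z) \<le> e l" "norm (f z - P l y z) \<le> e l"
      using x y by (auto simp: U_def intro: approx z1 z2)
    then show "norm (P l x z - P l y z) \<le> 2 * e l"
      using norm_triangle_ineq4 [of "f z - P l y z" "f z - P l x z"] by simp
  qed
  also have "\<dots> \<le> E / 4 ^ l" by (rule rate [OF a])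
  finally show ?thesis unfolding iter_pd_diff_coord_poly [OF c] D_def .
qed

lemma limit_exists:
  assumes "x \<in> U" "length is \<le> m"
  shows "\<exists>L. \<forall>l. norm (D l is x - L) \<le> 2 * E / 4 ^ l"
proof (rule geometric_cauchy_limit [of "\<lambda>l. D l is x" E])
  show "norm (D l is x - D (Suc l) is x) \<le> E / 4 ^ l" for l
    unfolding D_def by (rule next_level) (use assms t_pos [of "Suc l"] in auto)
qed blast

lemma D0_bound:
  assumes x: "x \<in> U"
  shows "norm (D 0 is x) \<le> fact (length is) / t 0 ^ length is * 60 ^ (K 0 * CARD('n)) * S"
  unfolding D_def
  by (rule norm_iter_pd_coord_poly_le [OF coord_poly_P [OF x] t0])
     (use x t0 bound in \<open>auto simp: U_def\<close>)

lemma E_nonneg: "0 \<le> E"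
  using order_trans [OF _ rate [of 0 0]] e_nonneg [of 0] by simp

lemma D_bound:
  assumes "x \<in> U" "length is \<le> m"
  shows "norm (D l is x) \<le> fact (length is) / t 0 ^ length is * 60 ^ (K 0 * CARD('n)) * S + 4 * E"
proof -
  obtain L where L: "\<And>l. norm (D l is x - L) \<le> 2 * E / 4 ^ l" using limit_exists [OF assms] by blast
  have "2 * E / 4 ^ l \<le> 2 * E / 1" using E_nonneg by (intro divide_left_mono) auto
  then have "norm (D l is x - L) \<le> 2 * E" using L [of l] by simp
  moreover have "norm (D 0 is x - L) \<le> 2 * E" using L [of 0] by simp
  moreover have "norm (D l is x) \<le> norm (D 0 is x) + norm (D 0 is x - L) + norm (D l is x - L)"
    using norm_diff_sum_le [of "D 0 is x" "D 0 is x - L" "D l is x - L" 0] by simp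
  ultimately show ?thesis using D0_bound [OF assms(1), of "is"] by linarith
qed

text \<open>For an increment \<open>s\<close> the level \<open>l\<close> is chosen with
  \<open>t l\<close> comparable to \<open>\<bar>s\<bar>\<close>. The polynomial of that level has a
  Taylor remainder \<open>M * s\<^sup>2\<close> with \<open>M\<close> independent of
  \<open>l\<close>, and passing from its derivatives to their limits costs multiples of
  \<open>E / 4 ^ l\<close>, which is again of order \<open>s\<^sup>2\<close>.\<close>

lemma derivative_step:
  assumes x: "x \<in> U" and a: "length is + 2 \<le> m"
    and conv: "\<And>y l. y \<in> U \<Longrightarrow> norm (D l is y - iter_pd is f y) \<le> 2 * E / 4 ^ l"
    and L: "\<And>l. norm (D l (i # is) x - L) \<le> 2 * E / 4 ^ l"
  shows "((\<lambda>s. iter_pd is f (x + s *\<^sub>R axis i 1)) has_vector_derivative L) (at 0)"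
proof -
  define M where "M = fact (length is + 2) / t 0 ^ (length is + 2) * 60 ^ (K 0 * CARD('n)) * S + 4 * E + E"
  define d where "d = min (min (t 0 / 2) 1) (r - \<bar>x $ i\<bar>)"
  have d: "0 < d" using x t0 unfolding d_def U_def by auto
  let ?x = "\<lambda>s. x + s *\<^sub>R axis i 1"
  have xU: "?x s \<in> U" if "\<bar>s\<bar> < d" for s
    using x that unfolding U_def d_def by (auto simp: axis_def)
  \<comment> \<open>Here 112 = 7 * 16: seven errors \<open>E / 4 ^ l\<close>, with
    \<open>1 / 4 ^ l\<close> at most \<open>16 * s\<^sup>2 / (t 0)\<^sup>2\<close>.\<close>
  define C where "C = M + 112 * E / (t 0)\<^sup>2"
  show ?thesis
  proof (rule has_vector_derivative_of_quadratic_bound [OF d])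
    fix s :: real assume s: "\<bar>s\<bar> < d"
    show "norm (iter_pd is f (?x s) - iter_pd is f (?x 0) - s *\<^sub>R L) \<le> C * s\<^sup>2"
    proof (cases "s = 0")
      case False
      have ex: "\<exists>l. t (Suc l) < \<bar>s\<bar>"
      proof -
        have "(\<lambda>l. t 0 * (1 / 2) ^ l) \<longlonglongrightarrow> t 0 * 0" by (intro tendsto_intros) auto
        then have "\<forall>\<^sub>F l in sequentially. t 0 * (1 / 2) ^ l < \<bar>s\<bar>"
          using False by (intro order_tendstoD(2)) auto
        then obtain l where "t 0 * (1 / 2) ^ l < \<bar>s\<bar>" unfolding eventually_sequentially by blast
        then have "t l < \<bar>s\<bar>" unfolding t_eq [of l] by (simp add: power_divide)
        then show ?thesis using t_pos [of l] t_Suc [of l] by (intro exI [of _ l]) linarith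
      qed
      \<comment> \<open>Since \<open>\<bar>s\<bar> \<le> t 1\<close>, the least such level is not 0,
        and its predecessor \<open>l\<close> satisfies \<open>t l / 4 < \<bar>s\<bar>\<close> and
        \<open>\<bar>s\<bar> \<le> t l / 2\<close>.\<close>
      define k where "k = (LEAST l. t (Suc l) < \<bar>s\<bar>)"
      have k: "t (Suc k) < \<bar>s\<bar>" unfolding k_def using ex by (rule LeastI_ex)
      have "\<bar>s\<bar> \<le> t 1" using s t_Suc [of 0] unfolding d_def by simp
      then have "k \<noteq> 0" using k by (cases "k = 0") auto
      then obtain l where l: "k = Suc l" using not0_implies_Suc by blast
      have sl: "\<bar>s\<bar> \<le> t (Suc l)" using not_less_Least [of l "\<lambda>l. t (Suc l) < \<bar>s\<bar>"] l unfolding k_def by simp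
      have "t l < 4 * \<bar>s\<bar>" using k unfolding l t_Suc by simp
      then have "t l ^ 2 \<le> (4 * \<bar>s\<bar>) ^ 2" using t_pos [of l] by (intro power_mono) auto
      moreover have "((2::real) ^ l)\<^sup>2 = 4 ^ l" by (simp add: power2_eq_square power_mult_distrib [symmetric])
      ultimately have "(t 0)\<^sup>2 / 4 ^ l \<le> 16 * s\<^sup>2"
        unfolding t_eq [of l] power_divide power_mult_distrib by simp
      then have sq: "1 / 4 ^ l \<le> 16 * s\<^sup>2 / (t 0)\<^sup>2" using t0 by (simp add: field_simps)
      let ?\<phi> = "\<lambda>js u. iter_pd js (P l x) (?x u)"
      have "norm (?\<phi> is s - ?\<phi> is 0 - s *\<^sub>R ?\<phi> (i # is) 0) \<le> M * s\<^sup>2"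
      proof (rule second_order_bound)
        fix u :: real assume u: "\<bar>u\<bar> \<le> \<bar>s\<bar>"
        show "(?\<phi> is has_vector_derivative ?\<phi> (i # is) u) (at u)"
          by (rule iter_pd_coord_poly_line [OF coord_poly_P [OF x]])
        show "(?\<phi> (i # is) has_vector_derivative ?\<phi> (i # i # is) u) (at u)"
          by (rule iter_pd_coord_poly_line [OF coord_poly_P [OF x]])
        have uU: "?x u \<in> U" using u s by (intro xU) simp
        have "norm (?\<phi> (i # i # is) u - D l (i # i # is) (?x u)) \<le> E / 4 ^ l"
          by (rule change_center [OF x uU]) (use u sl a t_pos [of "Suc l"] in \<open>auto simp: axis_def\<close>)
        moreover have "E / 4 ^ l \<le> E / 1" using E_nonneg by (intro divide_left_mono) auto
        moreover have "norm (D l (i # i # is) (?x u)) \<le> M - E"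
          using D_bound [OF uU, of "i # i # is" l] a unfolding M_def by simp
        ultimately show "norm (?\<phi> (i # i # is) u) \<le> M"
          using norm_triangle_sub [of "?\<phi> (i # i # is) u" "D l (i # i # is) (?x u)"] by linarith
      qed
      moreover have "norm (?\<phi> is s - iter_pd is f (?x s)) \<le> E / 4 ^ l + 2 * E / 4 ^ l"
      proof -
        have "norm (?\<phi> is s - D l is (?x s)) \<le> E / 4 ^ l"
          by (rule change_center [OF x xU [OF s]]) (use sl a t_pos [of "Suc l"] in \<open>auto simp: axis_def\<close>)
        from norm_triangle_mono [OF this conv [OF xU [OF s], of l]] show ?thesis by simp
      qed
      moreover have "norm (?\<phi> is 0 - iter_pd is f (?x 0)) \<le> 2 * E / 4 ^ l"
        using conv [OF x, of l] by (simp add: D_def)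
      moreover have "norm (s *\<^sub>R (?\<phi> (i # is) 0 - L)) \<le> 2 * E / 4 ^ l"
      proof -
        have "\<bar>s\<bar> * norm (?\<phi> (i # is) 0 - L) \<le> 1 * (2 * E / 4 ^ l)"
          using L [of l] s by (intro mult_mono) (auto simp: D_def d_def)
        then show ?thesis by simp
      qed
      moreover have "E / 4 ^ l + 2 * E / 4 ^ l + 2 * E / 4 ^ l + 2 * E / 4 ^ l = 7 * E * (1 / 4 ^ l)"
        by (simp add: add_divide_distrib [symmetric])
      ultimately have "norm ((?\<phi> is s - ?\<phi> is 0 - s *\<^sub>R ?\<phi> (i # is) 0) - (?\<phi> is s - iter_pd is f (?x s))
          + (?\<phi> is 0 - iter_pd is f (?x 0)) + s *\<^sub>R (?\<phi> (i # is) 0 - L)) \<le> M * s\<^sup>2 + 7 * E * (1 / 4 ^ l)"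
        using norm_diff_sum_le [of "?\<phi> is s - ?\<phi> is 0 - s *\<^sub>R ?\<phi> (i # is) 0" "?\<phi> is s - iter_pd is f (?x s)"
          "?\<phi> is 0 - iter_pd is f (?x 0)" "s *\<^sub>R (?\<phi> (i # is) 0 - L)"] by linarith
      moreover have "(?\<phi> is s - ?\<phi> is 0 - s *\<^sub>R ?\<phi> (i # is) 0) - (?\<phi> is s - iter_pd is f (?x s))
          + (?\<phi> is 0 - iter_pd is f (?x 0)) + s *\<^sub>R (?\<phi> (i # is) 0 - L)
        = iter_pd is f (?x s) - iter_pd is f (?x 0) - s *\<^sub>R L"
        by (simp add: scaleR_diff_right)
      ultimately have "norm (iter_pd is f (?x s) - iter_pd is f (?x 0) - s *\<^sub>R L) \<le> M * s\<^sup>2 + 7 * E * (1 / 4 ^ l)"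
        by (simp only:)
      also have "\<dots> \<le> M * s\<^sup>2 + 7 * E * (16 * s\<^sup>2 / (t 0)\<^sup>2)"
        using E_nonneg by (intro add_left_mono mult_left_mono sq) auto
      also have "\<dots> = C * s\<^sup>2" unfolding C_def by (simp add: algebra_simps)
      finally show ?thesis .
    qed simp
  qed
qed

text \<open>Once the limit for \<open>is\<close> is identified on all of \<open>U\<close>, the
  difference quotients of \<open>iter_pd is f\<close> can be computed, and they identify the limit
  for \<open>i # is\<close>.\<close>

lemma iter_pd_limit:
  assumes "length is + 1 \<le> m" "x \<in> U"
  shows "norm (D l is x - iter_pd is f x) \<le> 2 * E / 4 ^ l"
  using assms
proof (induction "is" arbitrary: x l)
  case Nil
  have "norm (D l [] x - f x) \<le> e l"
    using approx [of x x l] Nil(2) t_pos [of l] by (simp add: D_def U_def norm_minus_commute)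
  also have "\<dots> \<le> 60 ^ (K (Suc l) * CARD('n)) * (2 * e l)"
  proof -
    have "1 * e l \<le> 60 ^ (K (Suc l) * CARD('n)) * (2 * e l)"
      using e_nonneg [of l] by (intro mult_mono one_le_power) auto
    then show ?thesis by simp
  qed
  also have "\<dots> \<le> E / 4 ^ l" using rate [of 0 l] by simp
  also have "\<dots> \<le> 2 * E / 4 ^ l" using E_nonneg by (intro divide_right_mono) auto
  finally show ?case by simp
next
  case (Cons i "is")
  have "length (i # is) \<le> m" using Cons.prems by simp
  then obtain L where L: "\<And>l. norm (D l (i # is) x - L) \<le> 2 * E / 4 ^ l"
    using limit_exists [OF Cons.prems(2)] by blast
  have "((\<lambda>s. iter_pd is f (x + s *\<^sub>R axis i 1)) has_vector_derivative L) (at 0)"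
    by (rule derivative_step [OF Cons.prems(2) _ Cons.IH L]) (use Cons.prems in auto)
  then have "iter_pd (i # is) f x = L" by (simp add: pd_def vector_derivative_at)
  then show ?case using L by simp
qed

lemma iter_pd_regular:
  assumes a: "length is + 2 \<le> m"
  shows "continuous_on U (iter_pd is f)"
    and "x \<in> U \<Longrightarrow> (\<lambda>s. iter_pd is f (x + s *\<^sub>R axis i 1)) differentiable (at 0)"
    and "x \<in> U \<Longrightarrow> norm (iter_pd is f x) \<le> fact (length is) / t 0 ^ length is * 60 ^ (K 0 * CARD('n)) * S + 2 * E"
proof -
  note lim = iter_pd_limit [of "is"]
  have a1: "length is + 1 \<le> m" using a by simp
  show "(\<lambda>s. iter_pd is f (x + s *\<^sub>R axis i 1)) differentiable (at 0)" if x: "x \<in> U"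
  proof -
    have "length (i # is) \<le> m" using a by simp
    then obtain L where L: "\<And>l. norm (D l (i # is) x - L) \<le> 2 * E / 4 ^ l"
      using limit_exists [OF x] by blast
    have "((\<lambda>s. iter_pd is f (x + s *\<^sub>R axis i 1)) has_vector_derivative L) (at 0)"
      by (rule derivative_step [OF x a lim [OF a1] L])
    then show ?thesis by (rule differentiableI_vector)
  qed
  show "norm (iter_pd is f x) \<le> fact (length is) / t 0 ^ length is * 60 ^ (K 0 * CARD('n)) * S + 2 * E" if x: "x \<in> U"
    using lim [OF a1 x, of 0] D0_bound [OF x, of "is"] norm_triangle_sub [of "iter_pd is f x" "D 0 is x"]
    by (simp add: norm_minus_commute)
  show "continuous_on U (iter_pd is f)"
    unfolding continuous_on_iff
  proof (intro ballI allI impI)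
    fix x and \<epsilon> :: real assume x: "x \<in> U" and \<epsilon>: "0 < \<epsilon>"
    \<comment> \<open>Five errors \<open>E / 4 ^ l\<close>: one for the change of centre, two for
      the limit at each of \<open>x\<close> and \<open>y\<close>.\<close>
    have "(\<lambda>l. 5 * E * (1 / 4) ^ l) \<longlonglongrightarrow> 5 * E * 0" by (intro tendsto_intros) auto
    then have "\<forall>\<^sub>F l in sequentially. 5 * E * (1 / 4) ^ l < \<epsilon> / 2"
      using \<epsilon> by (intro order_tendstoD(2)) auto
    then obtain l where l: "5 * E * (1 / 4) ^ l < \<epsilon> / 2" unfolding eventually_sequentially by blast
    have "continuous_on UNIV (iter_pd is (P l x))"
      by (rule continuous_on_iter_pd_coord_poly [OF coord_poly_P [OF x]])
    then obtain d where d: "0 < d" "\<And>y. dist y x < d \<Longrightarrow> dist (iter_pd is (P l x) y) (iter_pd is (P l x) x) < \<epsilon> / 2"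
      unfolding continuous_on_iff using \<epsilon> by (metis UNIV_I half_gt_zero)
    show "\<exists>d>0. \<forall>y\<in>U. dist y x < d \<longrightarrow> dist (iter_pd is f y) (iter_pd is f x) < \<epsilon>"
    proof (intro exI [of _ "min d (t (Suc l))"] conjI ballI impI)
      show "0 < min d (t (Suc l))" using d t_pos by simp
      fix y assume y: "y \<in> U" and yx: "dist y x < min d (t (Suc l))"
      have "\<bar>y $ i - x $ i\<bar> \<le> t (Suc l)" for i
        using component_le_norm_cart [of "y - x" i] yx by (simp add: dist_norm)
      then have 1: "norm (iter_pd is (P l x) y - D l is y) \<le> E / 4 ^ l"
        using a by (intro change_center [OF x y]) auto
      have 2: "norm (D l is y - iter_pd is f y) \<le> 2 * E / 4 ^ l" "norm (D l is x - iter_pd is f x) \<le> 2 * E / 4 ^ l"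
        by (rule lim [OF a1 y], rule lim [OF a1 x])
      have 3: "norm (iter_pd is (P l x) y - D l is x) < \<epsilon> / 2" using d(2) [of y] yx by (simp add: dist_norm D_def)
      let ?a = "iter_pd is (P l x) y - D l is x" and ?b = "iter_pd is (P l x) y - D l is y"
        and ?c = "D l is y - iter_pd is f y" and ?d = "D l is x - iter_pd is f x"
      have "iter_pd is f y - iter_pd is f x = ?a - ?b + (- ?c) + ?d" by simp
      then have "norm (iter_pd is f y - iter_pd is f x) \<le> norm ?a + norm ?b + norm ?c + norm ?d"
        using norm_diff_sum_le [of ?a ?b "- ?c" ?d] by (simp only: norm_minus_cancel)
      also have "\<dots> < \<epsilon> / 2 + 5 * E * (1 / 4) ^ l" using 1 2 3 by (simp add: power_divide)
      finally show "dist (iter_pd is f y) (iter_pd is f x) < \<epsilon>" using l by (simp add: dist_norm)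
    qed
  qed
qed

end

section \<open>Derivative bounds\<close>

lemma one_plus_lebesgue_le: "1 + (real K + 1) * 30 ^ K \<le> 2 * 60 ^ K"
proof -
  have "real K + 1 \<le> 2 ^ K"
  proof -
    have "real (Suc K) \<le> real (2 ^ K)" by (intro of_nat_mono Suc_leI less_exp)
    then show ?thesis by (simp add: add.commute)
  qed
  then have "(real K + 1) * 30 ^ K \<le> 2 ^ K * 30 ^ K" by (intro mult_right_mono) auto
  also have "\<dots> = (60::real) ^ K" by (simp add: power_mult_distrib [symmetric])
  finally show ?thesis using one_le_power [of "60::real" K] by linarith
qed

text \<open>Scales and degrees are chosen anew for every order \<open>a\<close>, while
  \<open>p\<close> and \<open>X\<close> are not. With \<open>b = a + 4\<close> and
  \<open>k = Q * b\<close>, the choice of \<open>u l\<close> makes the Taylor error a multiple of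
  \<open>(1 / 2) ^ ((L + l) * k)\<close>, which is at most \<open>\<eta> l ^ g\<close>. The 3 in the
  exponent of \<open>\<eta> l\<close> is spent in equal parts: \<open>60 ^ (K l * d)\<close> from
  the interpolation error, the same factor at the next level from the Markov bound, and the negative
  powers of \<open>t\<close> from differentiation.\<close>

lemma joris_derivative_bound:
  fixes f :: "real^'n::finite \<Rightarrow> complex" and m :: "nat \<Rightarrow> real" and j :: nat and A B \<sigma> r c0 :: real
  assumes j: "1 \<le> j" and A: "1 \<le> A" and B: "1 \<le> B" and \<sigma>: "0 < \<sigma>" and r: "0 < r" and c0: "0 < c0"
    and m: "\<And>k. 1 \<le> k \<Longrightarrow> 0 < m k" "\<And>k. 1 \<le> k \<Longrightarrow> c0 \<le> root k (m k)"
    and fA: "\<And>x. (\<And>i. \<bar>x $ i\<bar> \<le> 2 * r) \<Longrightarrow> norm (f x) \<le> A"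
    and taylor1: "\<And>z i u k. 1 \<le> k \<Longrightarrow> 0 < u \<Longrightarrow> (\<And>s i'. \<bar>s\<bar> \<le> u \<Longrightarrow> \<bar>(z + s *\<^sub>R axis i 1) $ i'\<bar> \<le> 2 * r)
      \<Longrightarrow> poly_approx k u (B * ((2 * \<sigma> * u) ^ k * m k)) (\<lambda>s. f (z + s *\<^sub>R axis i 1) ^ j)"
    and taylor2: "\<And>z i u k. 1 \<le> k \<Longrightarrow> 0 < u \<Longrightarrow> (\<And>s i'. \<bar>s\<bar> \<le> u \<Longrightarrow> \<bar>(z + s *\<^sub>R axis i 1) $ i'\<bar> \<le> 2 * r)
      \<Longrightarrow> poly_approx k u (B * ((2 * \<sigma> * u) ^ k * m k)) (\<lambda>s. f (z + s *\<^sub>R axis i 1) ^ (j + 1))"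
  defines "U \<equiv> {x :: real^'n. \<forall>i. \<bar>x $ i\<bar> < r}"
  obtains p X where "1 \<le> X"
    "\<And>is. continuous_on U (iter_pd is f)"
    "\<And>is x i. x \<in> U \<Longrightarrow> (\<lambda>s. iter_pd is f (x + s *\<^sub>R axis i 1)) differentiable (at 0)"
    "\<And>is x. x \<in> U \<Longrightarrow> norm (iter_pd is f x) \<le> X ^ (length is + 4) * fact (length is + 4)
        * max 1 (root (2 ^ p * (length is + 4)) (m (2 ^ p * (length is + 4)))) ^ (length is + 4)"
proof -
  obtain g C D where g: "1 \<le> g" "1 \<le> C" "1 \<le> D" and joris:
    "\<And>\<eta> n f K R. 0 < \<eta> \<Longrightarrow> \<eta> \<le> 1 \<Longrightarrow> D ^ n * \<eta> \<le> 1
      \<Longrightarrow> (\<And>s::real. \<bar>s\<bar> \<le> 1 \<Longrightarrow> norm (f s) \<le> A)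
      \<Longrightarrow> poly_approx n 1 (B * \<eta> ^ g) (\<lambda>s. f s ^ j) \<Longrightarrow> poly_approx n 1 (B * \<eta> ^ g) (\<lambda>s. f s ^ (j + 1))
      \<Longrightarrow> 1 \<le> R \<Longrightarrow> 1 \<le> R ^ (K + 1) * \<eta> ^ 2
      \<Longrightarrow> poly_approx K (1 / (8 * R)) (C * \<eta>) f"
    using joris_polynomial_approx [OF j A B] by blast
  \<comment> \<open>\<open>p\<close> counts the doublings in the later use of moderate growth;
    \<open>3 * g \<le> 2 ^ p\<close> because \<open>n < 2 ^ n\<close>.\<close>
  define p where "p = 3 * g"
  define Q :: nat where "Q = 2 ^ p"
  have Q: "3 * g \<le> Q" "1 \<le> Q" unfolding Q_def p_def by (rule less_imp_le [OF less_exp]) simp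
  define d where "d = CARD('n)"
  have d: "1 \<le> d" unfolding d_def by (simp add: Suc_leI)
  \<comment> \<open>Here 36 = 6 * 6. The truncation needs
    \<open>R ^ (K l + 1) \<ge> 2 ^ (6 * (L + l) * b)\<close>, and \<open>60 \<le> 2 ^ 6\<close>; so
    a degree of about \<open>6 * (L + l) * b / \<rho>\<close> suffices and makes
    \<open>60 ^ (K l * d)\<close> at most \<open>2 ^ ((L + l) * b)\<close>.\<close>
  define \<rho> where "\<rho> = 36 * d"
  have \<rho>0: "0 < \<rho>" unfolding \<rho>_def using d by simp
  define R :: real where "R = 2 ^ \<rho>"
  have R1: "1 \<le> R" unfolding R_def by simp
  define c where "c = 1 / (8 * R)"
  have c: "0 < c" "c \<le> 1" unfolding c_def using R1 by (auto simp: divide_le_eq)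
  \<comment> \<open>The first condition yields \<open>D ^ k * \<eta> l \<le> 1\<close>; the second
    yields \<open>u l \<le> r\<close>, which keeps all segments inside the cube of half side
    \<open>2 * r\<close>.\<close>
  obtain L where L: "D ^ Q \<le> 2 ^ L" "1 / (2 * \<sigma> * c0 * r) \<le> 2 ^ L"
  proof -
    obtain L1 where "D ^ Q < 2 ^ L1" using real_arch_pow [of 2 "D ^ Q"] by auto
    moreover obtain L2 where "1 / (2 * \<sigma> * c0 * r) < 2 ^ L2" using real_arch_pow [of 2] by auto
    moreover have "(2::real) ^ L1 \<le> 2 ^ (L1 + L2)" "(2::real) ^ L2 \<le> 2 ^ (L1 + L2)" by (auto intro: power_increasing)
    ultimately show thesis by (intro that [of "L1 + L2"]) linarith+
  qed
  define c1 where "c1 = real d * 2 ^ d * C"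
  have c1: "0 \<le> c1" unfolding c1_def using g by simp
  define S where "S = A + c1"
  \<comment> \<open>The exponent collects \<open>8 * R = 2 ^ (\<rho> + 3)\<close> from
    \<open>1 / c\<close>, one factor 2 from \<open>2 * \<sigma>\<close> and one from the step to
    level \<open>Suc l\<close>.\<close>
  define T1 where "T1 = 2 ^ (\<rho> + 5) * \<sigma>"
  have T1: "0 < T1" unfolding T1_def using \<sigma> by simp
  define X where "X = (4 ^ L * (1 + S) + 8 * (1 + c1)) * (1 + T1)"
  have main: "continuous_on U (iter_pd is f) \<and> (\<forall>x\<in>U. \<forall>i. (\<lambda>s. iter_pd is f (x + s *\<^sub>R axis i 1)) differentiable (at 0))
    \<and> (\<forall>x\<in>U. norm (iter_pd is f x) \<le> X ^ (length is + 4) * fact (length is + 4)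
        * max 1 (root (Q * (length is + 4)) (m (Q * (length is + 4)))) ^ (length is + 4))" for "is" :: "'n list"
  proof -
    define a where "a = length is"
    \<comment> \<open>Difference quotients involve derivatives up to order \<open>a + 2\<close>. For
      these orders \<open>i\<close> the surplus \<open>b - i \<ge> 2\<close> leaves the factor
      \<open>1 / 4 ^ l\<close> that the convergence requires.\<close>
    define b where "b = a + 4"
    define k where "k = Q * b"
    have k: "1 \<le> k" unfolding k_def b_def using Q by simp
    define \<mu> where "\<mu> = root k (m k)"
    have \<mu>: "c0 \<le> \<mu>" "\<mu> ^ k = m k" unfolding \<mu>_def using m k by (auto simp: real_root_pow_pos2 less_imp_le)
    have \<mu>0: "0 < \<mu>" using \<mu> c0 by linarith
    define u where "u l = 1 / (2 ^ (L + l) * (2 * \<sigma> * \<mu>))" for l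
    define t where "t l = c * u l" for l
    define K where "K l = 6 * (L + l) * b div \<rho>" for l
    define \<eta> :: "nat \<Rightarrow> real" where "\<eta> l = (1 / 2) ^ (3 * (L + l) * b)" for l
    define e where "e l = c1 * (1 / 2) ^ (2 * (L + l) * b)" for l
    define T where "T = T1 * \<mu>"
    define E where "E = 2 * c1 * 2 ^ b * fact (a + 2) * max 1 T ^ (a + 2)"
    have u0: "0 < u l" for l unfolding u_def using \<sigma> \<mu>0 by simp
    have ur: "u l \<le> r" for l
    proof -
      have "1 / (2 * \<sigma> * c0 * r) \<le> 2 ^ (L + l)"
        using L(2) power_increasing [of L "L + l" "2::real"] by linarith
      then have "1 \<le> r * (2 ^ (L + l) * (2 * \<sigma> * c0))" using \<sigma> c0 r by (simp add: divide_le_eq mult_ac)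
      also have "\<dots> \<le> r * (2 ^ (L + l) * (2 * \<sigma> * \<mu>))" using \<sigma> \<mu> r by (intro mult_left_mono) auto
      finally show ?thesis unfolding u_def using \<sigma> \<mu>0 by (simp add: divide_le_eq)
    qed
    have tpos: "0 < t l" for l unfolding t_def using c u0 by simp
    have tu: "t l \<le> u l" for l unfolding t_def using c u0 [of l] by (intro mult_left_le_one_le) auto
    have K60: "60 ^ (K l * d) \<le> (2::real) ^ ((L + l) * b)" for l
    proof -
      have "K l * \<rho> \<le> 6 * (L + l) * b" unfolding K_def by (rule div_times_less_eq_dividend)
      moreover have "K l * \<rho> = 6 * (6 * (K l * d))" unfolding \<rho>_def by simp
      ultimately have "6 * (K l * d) \<le> (L + l) * b" unfolding mult.assoc [of 6] by linarith
      have "(60::real) ^ (K l * d) \<le> (2 ^ 6) ^ (K l * d)" by (intro power_mono) auto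
      also have "\<dots> = 2 ^ (6 * (K l * d))" by (rule power_mult [symmetric])
      also have "\<dots> \<le> 2 ^ ((L + l) * b)" using \<open>6 * (K l * d) \<le> (L + l) * b\<close> by (intro power_increasing) auto
      finally show ?thesis .
    qed
    have line: "poly_approx (K l) (t l) (C * \<eta> l) (\<lambda>s. f (z + s *\<^sub>R axis i 1))"
      if x: "\<And>i. \<bar>x $ i\<bar> < r" and z: "\<And>i. \<bar>z $ i - x $ i\<bar> \<le> t l" "z $ i = x $ i" for x z :: "real^'n" and i l
    proof -
      have seg: "\<bar>(z + s *\<^sub>R axis i 1) $ i'\<bar> \<le> 2 * r" if s: "\<bar>s\<bar> \<le> u l" for s i'
      proof (cases "i' = i")
        case True
        then show ?thesis using x [of i] z(2) s ur [of l] by (simp add: axis_def)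
      next
        case False
        then show ?thesis using x [of i'] z(1) [of i'] tu [of l] ur [of l] by (simp add: axis_def)
      qed
      have err: "(2 * \<sigma> * u l) ^ k * m k \<le> \<eta> l ^ g"
      proof -
        have "(2 * \<sigma> * u l) ^ k * m k = (2 * \<sigma> * u l * \<mu>) ^ k" using \<mu>(2) by (simp add: power_mult_distrib)
        also have "2 * \<sigma> * u l * \<mu> = (1 / 2) ^ (L + l)" unfolding u_def using \<sigma> \<mu>0 by (simp add: power_divide)
        also have "((1 / 2) ^ (L + l)) ^ k = (1 / 2 :: real) ^ ((L + l) * k)" by (rule power_mult [symmetric])
        also have "\<dots> \<le> (1 / 2) ^ ((L + l) * (3 * g * b))"
          unfolding k_def using Q by (intro power_decreasing mult_le_mono) auto
        also have "\<dots> = \<eta> l ^ g" unfolding \<eta>_def power_mult [symmetric] by (simp add: mult_ac)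
        finally show ?thesis .
      qed
      have us: "\<bar>u l * s\<bar> \<le> u l" if "\<bar>s\<bar> \<le> 1" for s
        using that u0 [of l] by (simp add: abs_mult mult_left_le)
      have Berr: "B * ((2 * \<sigma> * u l) ^ k * m k) \<le> B * \<eta> l ^ g" using err B by (intro mult_left_mono) auto
      have scale: "poly_approx k 1 (B * \<eta> l ^ g) (\<lambda>s. F (u l * s))"
        if "poly_approx k (u l) (B * ((2 * \<sigma> * u l) ^ k * m k)) F" for F
        by (rule poly_approx_scale) (use poly_approx_mono [OF that Berr] u0 [of l] in simp)
      have "poly_approx (K l) (1 / (8 * R)) (C * \<eta> l) (\<lambda>s. f (z + (u l * s) *\<^sub>R axis i 1))"
      proof (rule joris [where n = k])
        show "0 < \<eta> l" "\<eta> l \<le> 1" unfolding \<eta>_def by (auto intro: power_le_one)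
        show "D ^ k * \<eta> l \<le> 1"
        proof -
          have "D ^ k = (D ^ Q) ^ b" unfolding k_def by (rule power_mult)
          also have "\<dots> \<le> (2 ^ L) ^ b" using L(1) g by (intro power_mono) auto
          also have "\<dots> = 2 ^ (L * b)" by (rule power_mult [symmetric])
          also have "\<dots> \<le> 2 ^ (3 * (L + l) * b)" by (intro power_increasing mult_le_mono) auto
          finally have "D ^ k * \<eta> l \<le> 2 ^ (3 * (L + l) * b) * \<eta> l" unfolding \<eta>_def by (intro mult_right_mono) auto
          also have "\<dots> = 1" unfolding \<eta>_def by (simp add: power_mult_distrib [symmetric])
          finally show ?thesis .
        qed
        show "1 \<le> R ^ (K l + 1) * \<eta> l ^ 2"
        proof -
          have "6 * (L + l) * b < \<rho> * (K l + 1)" unfolding K_def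
            using dividend_less_times_div [OF \<rho>0, of "6 * (L + l) * b"] by simp
          then have "(2::real) ^ (6 * (L + l) * b) \<le> 2 ^ (\<rho> * (K l + 1))" by (intro power_increasing) auto
          also have "\<dots> = R ^ (K l + 1)" unfolding R_def by (rule power_mult)
          finally have "2 ^ (6 * (L + l) * b) * \<eta> l ^ 2 \<le> R ^ (K l + 1) * \<eta> l ^ 2" by (intro mult_right_mono) auto
          moreover have "(2::real) ^ (6 * (L + l) * b) * \<eta> l ^ 2 = 1"
          proof -
            have "\<eta> l ^ 2 = (1 / 2) ^ (6 * (L + l) * b)" unfolding \<eta>_def power_mult [symmetric] by (simp add: mult_ac)
            then show ?thesis by (simp add: power_mult_distrib [symmetric])
          qed
          ultimately show ?thesis by simp
        qed
        show "norm (f (z + (u l * s) *\<^sub>R axis i 1)) \<le> A" if "\<bar>s\<bar> \<le> 1" for s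
          by (rule fA) (rule seg [OF us [OF that]])
      qed (use R1 scale [OF taylor1 [OF k u0 seg]] scale [OF taylor2 [OF k u0 seg]] in auto)
      then have "poly_approx (K l) (\<bar>1 / u l\<bar> * t l) (C * \<eta> l) (\<lambda>s. f (z + (u l * s) *\<^sub>R axis i 1))"
        using u0 [of l] unfolding t_def c_def by simp
      from poly_approx_scale [OF this] show ?thesis using u0 [of l] by simp
    qed
    define P where "P l x = interp (K l) x (t l) (\<lambda>_. 0) f" for l and x :: "real^'n"
    have approx: "norm (f y - P l x y) \<le> e l"
      if x: "\<And>i. \<bar>x $ i\<bar> < r" and y: "\<And>i. \<bar>y $ i - x $ i\<bar> \<le> t l" for l and x y :: "real^'n"
    proof -
      have "norm (f y - P l x y) \<le> real CARD('n) * (1 + (real (K l) + 1) * 30 ^ K l) ^ CARD('n) * (C * \<eta> l)"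
        unfolding P_def
        by (rule norm_diff_interp_le [OF tpos _ line [OF x] y]) (use g in \<open>auto simp: \<eta>_def\<close>)
      also have "\<dots> \<le> real CARD('n) * (2 * 60 ^ K l) ^ CARD('n) * (C * \<eta> l)"
        using g one_plus_lebesgue_le [of "K l"] by (intro mult_right_mono mult_left_mono power_mono) (auto simp: \<eta>_def)
      also have "\<dots> = c1 * (60 ^ (K l * d) * \<eta> l)"
        unfolding c1_def d_def by (simp add: power_mult_distrib power_mult)
      also have "\<dots> \<le> c1 * (2 ^ ((L + l) * b) * \<eta> l)"
        using c1 K60 [of l] by (intro mult_left_mono mult_right_mono) (auto simp: \<eta>_def)
      also have "\<dots> = e l"
      proof -
        have "3 * (L + l) * b = (L + l) * b + 2 * (L + l) * b" by (simp add: algebra_simps)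
        then have "\<eta> l = (1 / 2) ^ ((L + l) * b) * (1 / 2) ^ (2 * (L + l) * b)" unfolding \<eta>_def by (simp only: power_add)
        then have "2 ^ ((L + l) * b) * \<eta> l = (2 ^ ((L + l) * b) * (1 / 2) ^ ((L + l) * b)) * (1 / 2) ^ (2 * (L + l) * b)"
          by (simp only: mult.assoc)
        also have "(2::real) ^ ((L + l) * b) * (1 / 2) ^ ((L + l) * b) = 1" by (simp add: power_mult_distrib [symmetric])
        finally show ?thesis unfolding e_def by simp
      qed
      finally show ?thesis .
    qed
    have e_le: "e l \<le> c1" for l unfolding e_def using c1 by (intro mult_left_le power_le_one) auto
    have inv_t: "1 / t (Suc l) = T * 2 ^ (L + l)" for l
      unfolding t_def u_def c_def T_def T1_def R_def by (simp add: power_add)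
    have rate: "fact i / t (Suc l) ^ i * 60 ^ (K (Suc l) * CARD('n)) * (2 * e l) \<le> E / 4 ^ l"
      if i: "i \<le> a + 2" for l i
    proof -
      have T0: "0 < T" unfolding T_def using T1 \<mu>0 by simp
      have "fact i / t (Suc l) ^ i = fact i * (1 / t (Suc l)) ^ i" by (simp add: divide_inverse power_inverse)
      also have "\<dots> = fact i * (T ^ i * 2 ^ ((L + l) * i))" unfolding inv_t by (simp add: power_mult_distrib power_mult)
      finally have 1: "fact i / t (Suc l) ^ i = fact i * (T ^ i * 2 ^ ((L + l) * i))" .
      have Ti: "T ^ i \<le> max 1 T ^ (a + 2)"
      proof -
        have "T ^ i \<le> max 1 T ^ i" using T0 by (intro power_mono) auto
        also have "\<dots> \<le> max 1 T ^ (a + 2)" using i by (intro power_increasing) auto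
        finally show ?thesis .
      qed
      have "60 ^ (K (Suc l) * CARD('n)) * (2 * e l) \<le> 2 ^ ((L + Suc l) * b) * (2 * e l)"
        using K60 [of "Suc l"] c1 unfolding d_def by (intro mult_right_mono) (auto simp: e_def)
      also have "\<dots> = 2 * c1 * 2 ^ b * (1 / 2) ^ ((L + l) * b)"
      proof -
        have h: "(2::real) ^ n * (1 / 2) ^ n = 1" for n by (simp add: power_mult_distrib [symmetric])
        have "(2::real) ^ ((L + Suc l) * b) = 2 ^ b * 2 ^ ((L + l) * b)" by (simp add: power_add [symmetric])
        moreover have "2 * (L + l) * b = (L + l) * b + (L + l) * b" by (simp add: algebra_simps)
        then have "e l = c1 * ((1 / 2) ^ ((L + l) * b) * (1 / 2) ^ ((L + l) * b))" unfolding e_def by (simp only: power_add)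
        ultimately have "2 ^ ((L + Suc l) * b) * (2 * e l)
            = 2 * c1 * 2 ^ b * (2 ^ ((L + l) * b) * (1 / 2) ^ ((L + l) * b)) * (1 / 2) ^ ((L + l) * b)"
          by (simp only: mult_ac)
        then show ?thesis unfolding h by simp
      qed
      finally have 2: "60 ^ (K (Suc l) * CARD('n)) * (2 * e l) \<le> 2 * c1 * 2 ^ b * (1 / 2) ^ ((L + l) * b)" .
      have 3: "2 ^ ((L + l) * i) * (1 / 2) ^ ((L + l) * b) \<le> 1 / (4::real) ^ l"
      proof -
        have "(L + l) * i + 2 * l \<le> (L + l) * b"
        proof -
          have "(L + l) * i + 2 * l \<le> (L + l) * i + (L + l) * 2" by simp
          also have "\<dots> = (L + l) * (i + 2)" by (simp add: distrib_left)
          also have "\<dots> \<le> (L + l) * b" using i unfolding b_def by (intro mult_le_mono) auto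
          finally show ?thesis .
        qed
        then have "(1 / 2 :: real) ^ ((L + l) * b) \<le> (1 / 2) ^ ((L + l) * i + 2 * l)" by (intro power_decreasing) auto
        then have "2 ^ ((L + l) * i) * (1 / 2 :: real) ^ ((L + l) * b) \<le> 2 ^ ((L + l) * i) * (1 / 2) ^ ((L + l) * i + 2 * l)"
          by (intro mult_left_mono) auto
        also have "\<dots> = (2 ^ ((L + l) * i) * (1 / 2) ^ ((L + l) * i)) * (1 / 2) ^ (2 * l)" by (simp only: power_add mult.assoc)
        also have "(2::real) ^ ((L + l) * i) * (1 / 2) ^ ((L + l) * i) = 1" by (simp add: power_mult_distrib [symmetric])
        also have "1 * (1 / 2 :: real) ^ (2 * l) = 1 / 4 ^ l" by (simp add: power_mult power_divide)
        finally show ?thesis .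
      qed
      have "fact i / t (Suc l) ^ i * 60 ^ (K (Suc l) * CARD('n)) * (2 * e l)
          = fact i * (T ^ i * 2 ^ ((L + l) * i)) * (60 ^ (K (Suc l) * CARD('n)) * (2 * e l))"
        unfolding 1 by (simp only: mult.assoc)
      also have "\<dots> \<le> fact i * (T ^ i * 2 ^ ((L + l) * i)) * (2 * c1 * 2 ^ b * (1 / 2) ^ ((L + l) * b))"
        using T0 by (intro mult_left_mono 2) auto
      also have "\<dots> = (2 * c1 * 2 ^ b) * fact i * T ^ i * (2 ^ ((L + l) * i) * (1 / 2) ^ ((L + l) * b))"
        by (simp only: mult_ac)
      also have "\<dots> \<le> (2 * c1 * 2 ^ b) * fact (a + 2) * max 1 T ^ (a + 2) * (1 / 4 ^ l)"
        using c1 T0 i by (intro mult_mono 3 Ti fact_mono) (auto intro!: mult_nonneg_nonneg)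
      also have "\<dots> = E / 4 ^ l" unfolding E_def by simp
      finally show ?thesis .
    qed
    note dom = U_def
    interpret coord_poly_approx f P K t e r E S "a + 2"
    proof
      show "t (Suc l) = t l / 2" for l unfolding t_def u_def by (simp add: power_add)
      show "K l \<le> K (Suc l)" for l unfolding K_def by (intro div_le_mono mult_le_mono) auto
      show "e (Suc l) \<le> e l" for l unfolding e_def using c1 by (intro mult_left_mono power_decreasing) auto
      show "coord_poly (K l) (P l x)" for l x unfolding P_def by (rule coord_poly_interp)
      fix x y :: "real^'n" assume x: "\<And>i. \<bar>x $ i\<bar> < r" and y: "\<And>i. \<bar>y $ i - x $ i\<bar> \<le> t 0"
      have "norm (f y) \<le> A"
      proof (rule fA)
        show "\<bar>y $ i\<bar> \<le> 2 * r" for i using x [of i] y [of i] tu [of 0] ur [of 0] by linarith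
      qed
      moreover have "norm (f y - P 0 x y) \<le> c1" by (rule order_trans [OF approx [OF x y] e_le])
      ultimately show "norm (P 0 x y) \<le> S"
        unfolding S_def using norm_triangle_sub [of "P 0 x y" "f y"] by (simp add: norm_minus_commute)
    qed (use r tpos approx rate in auto)
    have len: "length is + 2 \<le> a + 2" unfolding a_def by simp
    have UU: "U = coord_poly_approx.U r" unfolding dom U_def by simp
    have Xb: "norm (iter_pd is f x) \<le> X ^ b * fact b * max 1 \<mu> ^ b" if x: "x \<in> U" for x
    proof -
      have T0: "0 < T" unfolding T_def using T1 \<mu>0 by simp
      have S0: "0 \<le> S" unfolding S_def using A c1 by simp
      have inv_t0: "1 / t 0 \<le> T * 2 ^ L"
      proof -
        have "1 / t 0 \<le> 1 / t (Suc 0)" using tpos [of "Suc 0"] t_Suc [of 0] by (intro divide_left_mono) auto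
        then show ?thesis unfolding inv_t by simp
      qed
      have T_le: "max 1 T \<le> (1 + T1) * max 1 \<mu>"
      proof (rule max.boundedI)
        show "1 \<le> (1 + T1) * max 1 \<mu>" using T1 mult_mono [of 1 "1 + T1" 1 "max 1 \<mu>"] by simp
        show "T \<le> (1 + T1) * max 1 \<mu>" unfolding T_def using T1 \<mu>0 by (intro mult_mono) auto
      qed
      have Tb: "max 1 T ^ n \<le> (1 + T1) ^ b * max 1 \<mu> ^ b" if "n \<le> b" for n
      proof -
        have "max 1 T ^ n \<le> max 1 T ^ b" using that by (intro power_increasing) auto
        also have "\<dots> \<le> ((1 + T1) * max 1 \<mu>) ^ b" by (intro power_mono T_le) auto
        finally show ?thesis by (simp only: power_mult_distrib)
      qed
      have T_a: "T ^ a \<le> max 1 T ^ a" using T0 by (intro power_mono) auto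
      have one: "fact a / t 0 ^ a * 60 ^ (K 0 * CARD('n)) * S \<le> (4 ^ L) ^ b * S * (fact b * ((1 + T1) ^ b * max 1 \<mu> ^ b))"
      proof -
        have "fact a / t 0 ^ a = fact a * (1 / t 0) ^ a" by (simp add: divide_inverse power_inverse)
        also have "\<dots> \<le> fact b * (T * 2 ^ L) ^ a"
          using inv_t0 tpos [of 0] by (intro mult_mono power_mono fact_mono) (auto simp: b_def)
        also have "\<dots> = fact b * (T ^ a * (2 ^ L) ^ a)" by (simp only: power_mult_distrib)
        also have "\<dots> \<le> fact b * (((1 + T1) ^ b * max 1 \<mu> ^ b) * (2 ^ L) ^ b)"
        proof (intro mult_left_mono mult_mono power_increasing)
          show "T ^ a \<le> (1 + T1) ^ b * max 1 \<mu> ^ b" using T_a Tb [of a] unfolding b_def by linarith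
        qed (auto simp: b_def T1 less_imp_le intro!: mult_nonneg_nonneg zero_le_power add_nonneg_nonneg)
        finally have 1: "fact a / t 0 ^ a \<le> fact b * (((1 + T1) ^ b * max 1 \<mu> ^ b) * (2 ^ L) ^ b)" .
        have 2: "60 ^ (K 0 * CARD('n)) \<le> (2::real) ^ (L * b)" using K60 [of 0] unfolding d_def by simp
        have "fact a / t 0 ^ a * 60 ^ (K 0 * CARD('n)) * S
            \<le> (fact b * (((1 + T1) ^ b * max 1 \<mu> ^ b) * (2 ^ L) ^ b)) * 2 ^ (L * b) * S"
          using S0 T1 tpos [of 0] by (intro mult_right_mono mult_mono 1 2) (auto intro!: mult_nonneg_nonneg zero_le_power)
        also have "\<dots> = ((2 ^ L) ^ b * (2 ^ L) ^ b) * S * (fact b * ((1 + T1) ^ b * max 1 \<mu> ^ b))"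
          by (simp only: power_mult mult_ac)
        also have "((2::real) ^ L) ^ b * (2 ^ L) ^ b = (4 ^ L) ^ b"
          by (simp add: power_mult_distrib [symmetric])
        finally show ?thesis .
      qed
      have two: "2 * E \<le> 4 * c1 * 2 ^ b * (fact b * ((1 + T1) ^ b * max 1 \<mu> ^ b))"
      proof -
        have "fact (a + 2) * max 1 T ^ (a + 2) \<le> fact b * ((1 + T1) ^ b * max 1 \<mu> ^ b)"
          using T1 by (intro mult_mono Tb fact_mono) (auto simp: b_def)
        then have "4 * c1 * 2 ^ b * (fact (a + 2) * max 1 T ^ (a + 2)) \<le> 4 * c1 * 2 ^ b * (fact b * ((1 + T1) ^ b * max 1 \<mu> ^ b))"
          using c1 by (intro mult_left_mono) auto
        moreover have "2 * E = 4 * c1 * 2 ^ b * (fact (a + 2) * max 1 T ^ (a + 2))" unfolding E_def by (simp only: mult_ac)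
        ultimately show ?thesis by (simp only:)
      qed
      have coef: "(4 ^ L) ^ b * S + 4 * c1 * 2 ^ b \<le> (4 ^ L * (1 + S) + 8 * (1 + c1)) ^ b"
      proof -
        have pw: "x + y \<le> (p + q) ^ b" if "x \<le> p ^ b" "y \<le> q ^ b" "0 \<le> p" "0 \<le> q" for x y p q :: real
        proof -
          have b1: "b = Suc (b - 1)" unfolding b_def by simp
          have "p ^ Suc (b - 1) + q ^ Suc (b - 1) \<le> p * (p + q) ^ (b - 1) + q * (p + q) ^ (b - 1)"
            unfolding power_Suc using that by (intro add_mono mult_left_mono power_mono) auto
          also have "\<dots> = (p + q) ^ Suc (b - 1)" by (simp add: distrib_right)
          finally show ?thesis using that(1,2) b1 by simp
        qed
        have "(4 ^ L) ^ b * S \<le> (4 ^ L * (1 + S)) ^ b"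
        proof -
          have "S \<le> 1 + S" by simp
          also have "\<dots> \<le> (1 + S) ^ b" using S0 by (intro self_le_power) (auto simp: b_def)
          finally show ?thesis unfolding power_mult_distrib by (intro mult_left_mono) auto
        qed
        moreover have "4 * c1 * 2 ^ b \<le> (8 * (1 + c1)) ^ b"
        proof -
          have "c1 \<le> 1 + c1" by simp
          also have "\<dots> \<le> (1 + c1) ^ b" using c1 by (intro self_le_power) (auto simp: b_def)
          finally have "c1 \<le> (1 + c1) ^ b" .
          moreover have "(4::real) \<le> 4 ^ b" by (intro self_le_power) (auto simp: b_def)
          then have "4 * 2 ^ b \<le> (4::real) ^ b * 2 ^ b" by (intro mult_right_mono) auto
          then have "4 * 2 ^ b \<le> (8::real) ^ b" by (simp add: power_mult_distrib [symmetric])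
          ultimately have "(4 * 2 ^ b) * c1 \<le> 8 ^ b * (1 + c1) ^ b" using c1 by (intro mult_mono) auto
          then show ?thesis by (simp only: power_mult_distrib mult_ac)
        qed
        ultimately show ?thesis using S0 c1 by (intro pw) auto
      qed
      have "norm (iter_pd is f x) \<le> fact a / t 0 ^ a * 60 ^ (K 0 * CARD('n)) * S + 2 * E"
        using iter_pd_regular(3) [OF len, of x] x unfolding UU a_def .
      also have "\<dots> \<le> ((4 ^ L) ^ b * S + 4 * c1 * 2 ^ b) * (fact b * ((1 + T1) ^ b * max 1 \<mu> ^ b))"
        using one two by (simp only: distrib_right)
      also have "\<dots> \<le> (4 ^ L * (1 + S) + 8 * (1 + c1)) ^ b * (fact b * ((1 + T1) ^ b * max 1 \<mu> ^ b))"
        using T1 by (intro mult_right_mono coef) (auto intro!: mult_nonneg_nonneg zero_le_power)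
      also have "\<dots> = X ^ b * fact b * max 1 \<mu> ^ b" unfolding X_def by (simp only: power_mult_distrib mult_ac)
      finally show ?thesis .
    qed
    show ?thesis
      using iter_pd_regular(1,2) [OF len] Xb unfolding UU b_def a_def \<mu>_def k_def by blast
  qed
  have X1: "1 \<le> X"
  proof -
    have "0 \<le> 4 ^ L * (1 + S)" unfolding S_def using A c1 by (intro mult_nonneg_nonneg) auto
    then have "1 * 1 \<le> X" unfolding X_def using c1 T1 by (intro mult_mono) auto
    then show ?thesis by simp
  qed
  show thesis
  proof (rule that [of X p])
    show "1 \<le> X" by (rule X1)
  qed (use main in \<open>auto simp: Q_def\<close>)
qed

section \<open>Roumieu classes\<close>

lemma count_list_replicate: "count_list (replicate n x) y = (if y = x then n else 0)"
  by (induction n) auto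

text \<open>\<open>deriv_multi\<close> uses an arbitrary list with the prescribed counts. For a
  multi-index supported on one coordinate there is only one such list, so bounds on pure derivatives
  are available without exchanging the order of differentiation.\<close>

lemma deriv_multi_single: "deriv_multi (\<lambda>j. if j = i then a else 0) g = iter_pd (replicate a i) g"
proof -
  let ?P = "\<lambda>is. \<forall>j. count_list is j = (if j = i then a else 0)"
  have "?P (replicate a i)" by (auto simp: count_list_replicate)
  then have P: "?P (SOME is. ?P is)" by (rule someI)
  define js where "js = (SOME is. ?P is)"
  have c: "count_list js j = (if j = i then a else 0)" for j using P unfolding js_def by blast
  have "set js \<subseteq> {i}"
  proof
    fix j assume "j \<in> set js"
    then have "count_list js j \<noteq> 0" by (simp add: count_list_0_iff)
    then show "j \<in> {i}" using c [of j] by (auto split: if_splits)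
  qed
  then have js: "replicate (length js) i = js"
    by (intro replicate_length_same) auto
  then have "length js = a" using c [of i] count_list_replicate [of "length js" i i] by simp
  then show ?thesis using js unfolding deriv_multi_def js_def by simp
qed

lemma mi_len_single: "mi_len (\<lambda>j. if j = i then a else 0) = a"
  by (simp add: mi_len_def)

text \<open>Once some list with the prescribed counts exists, the chosen one has them too. Bounds
  proved for all lists therefore apply to it.\<close>

lemma deriv_multi_list:
  fixes f :: "real^'n::finite \<Rightarrow> complex"
  obtains "is" where "deriv_multi \<alpha> f = iter_pd is f" "length is = mi_len \<alpha>"
proof -
  have "\<exists>js. \<forall>i. count_list js i = (if i \<in> A then \<alpha> i else 0)" if "finite A" for A
    using that
  proof (induction A rule: finite_induct)
    case (insert i A)
    then obtain js where js: "\<And>k. count_list js k = (if k \<in> A then \<alpha> k else 0)" by blast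
    have "count_list (replicate (\<alpha> i) i @ js) k = (if k \<in> insert i A then \<alpha> k else 0)" for k
      using js [of k] insert(2) by (auto simp: count_list_append count_list_replicate)
    then show ?case by blast
  qed (auto intro!: exI [of _ "[]"])
  from this [of UNIV] have ex: "\<exists>js. \<forall>i. count_list js i = \<alpha> i" by simp
  define js where "js = (SOME is. \<forall>i. count_list is i = \<alpha> i)"
  have "\<forall>i. count_list js i = \<alpha> i" unfolding js_def using ex by (rule someI_ex)
  then have "length js = mi_len \<alpha>" unfolding mi_len_def by (simp add: sum_count_list_UNIV [symmetric])
  then show thesis by (intro that [of js]) (simp_all add: deriv_multi_def js_def)
qed

text \<open>Taylor's theorem is used in the complex field over a convex set. Taking a real segment
  as this set requires the derivative along the line in the form of a complex derivative within the
  segment.\<close>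

lemma has_field_derivative_Re:
  fixes h :: "real \<Rightarrow> complex"
  assumes h: "(h has_vector_derivative h') (at (Re z))" and S: "S \<subseteq> range complex_of_real" "z \<in> S"
  shows "((\<lambda>z. h (Re z)) has_field_derivative h') (at z within S)"
proof -
  have "((\<lambda>z. h (Re z)) has_derivative (\<lambda>d. Re d *\<^sub>R h')) (at z within S)"
  proof (rule has_derivative_compose [where f = Re])
    show "(Re has_derivative Re) (at z within S)" by (intro bounded_linear_imp_has_derivative bounded_linear_Re)
    show "(h has_derivative (\<lambda>d. d *\<^sub>R h')) (at (Re z))" using h unfolding has_vector_derivative_def .
  qed
  then have lim: "((\<lambda>y. norm (h (Re y) - h (Re z) - Re (y - z) *\<^sub>R h') / norm (y - z)) \<longlongrightarrow> 0) (at z within S)"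
    unfolding has_derivative_iff_norm by blast
  show ?thesis unfolding has_field_derivative_def has_derivative_iff_norm
  proof (intro conjI bounded_linear_mult_right)
    show "((\<lambda>y. norm (h (Re y) - h (Re z) - h' * (y - z)) / norm (y - z)) \<longlongrightarrow> 0) (at z within S)"
    proof (rule Lim_transform_eventually [OF lim])
      show "\<forall>\<^sub>F y in at z within S. norm (h (Re y) - h (Re z) - Re (y - z) *\<^sub>R h') / norm (y - z)
          = norm (h (Re y) - h (Re z) - h' * (y - z)) / norm (y - z)"
        unfolding eventually_at_filter
      proof (rule always_eventually, intro allI impI)
        fix y assume "y \<in> S"
        then obtain v v' where "y = of_real v" "z = of_real v'" using S by blast
        then have "y - z = of_real (Re (y - z))" by simp
        then have "h' * (y - z) = Re (y - z) *\<^sub>R h'" by (metis mult.commute scaleR_conv_of_real)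
        then show "norm (h (Re y) - h (Re z) - Re (y - z) *\<^sub>R h') / norm (y - z)
          = norm (h (Re y) - h (Re z) - h' * (y - z)) / norm (y - z)" by simp
      qed
    qed
  qed
qed

text \<open>Expansion along a coordinate direction involves pure derivatives only. The remainder
  comes with \<open>fact (k - 1)\<close> in the denominator; the missing factor
  \<open>k \<le> 2 ^ k\<close> is the 2 in \<open>2 * \<sigma> * u\<close>.\<close>

lemma B_sigma_taylor:
  fixes g :: "real^'n::finite \<Rightarrow> complex"
  assumes B: "B_sigma M \<sigma> V g" and \<sigma>: "0 < \<sigma>" and M: "\<And>k. 0 < M k" "M 0 = 1"
  obtains C0 where "\<And>x. x \<in> V \<Longrightarrow> norm (g x) \<le> C0"
    "\<And>x i u k. 1 \<le> k \<Longrightarrow> 0 < u \<Longrightarrow> (\<And>s. \<bar>s\<bar> \<le> u \<Longrightarrow> x + s *\<^sub>R axis i 1 \<in> V)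
      \<Longrightarrow> poly_approx k u (C0 * ((2 * \<sigma> * u) ^ k * lower M k)) (\<lambda>s. g (x + s *\<^sub>R axis i 1))"
proof -
  obtain C where sm: "smooth_on V g"
    and C: "\<And>x \<alpha>. x \<in> V \<Longrightarrow> norm (deriv_multi \<alpha> g x) \<le> C * \<sigma> ^ mi_len \<alpha> * M (mi_len \<alpha>)"
    using B unfolding B_sigma_def by blast
  define C0 where "C0 = max C 0"
  have C0: "0 \<le> C0" "C \<le> C0" unfolding C0_def by auto
  have pure: "norm (iter_pd (replicate a i) g x) \<le> C0 * \<sigma> ^ a * M a" if "x \<in> V" for x a i
  proof -
    have "norm (iter_pd (replicate a i) g x) \<le> C * \<sigma> ^ a * M a"
      using C [OF that, of "\<lambda>j. if j = i then a else 0"] unfolding deriv_multi_single mi_len_single .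
    also have "\<dots> \<le> C0 * \<sigma> ^ a * M a" using C0 \<sigma> M(1) [of a] by (intro mult_right_mono) auto
    finally show ?thesis .
  qed
  show thesis
  proof (rule that [of C0])
    show "norm (g x) \<le> C0" if "x \<in> V" for x using pure [OF that, of 0 undefined] M by simp
    fix x :: "real^'n" and i u and k :: nat
    assume k: "1 \<le> k" and u: "0 < u" and seg: "\<And>s. \<bar>s\<bar> \<le> u \<Longrightarrow> x + s *\<^sub>R axis i 1 \<in> V"
    define h where "h a s = iter_pd (replicate a i) g (x + s *\<^sub>R axis i 1)" for a s
    have vd: "(h a has_vector_derivative h (Suc a) s) (at s)" if s: "\<bar>s\<bar> \<le> u" for a s
    proof -
      let ?y = "x + s *\<^sub>R axis i 1"
      define \<psi> where "\<psi> t = iter_pd (replicate a i) g (?y + t *\<^sub>R axis i 1)" for t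
      have "\<psi> differentiable (at 0)" using sm seg [OF s] unfolding smooth_on_def \<psi>_def by blast
      then have "(\<psi> has_vector_derivative vector_derivative \<psi> (at 0)) (at (s - s))"
        by (simp add: vector_derivative_works)
      moreover have "vector_derivative \<psi> (at 0) = h (Suc a) s"
        unfolding h_def \<psi>_def by (simp add: pd_def)
      ultimately have "(\<psi> has_vector_derivative h (Suc a) s) (at (s - s))" by simp
      moreover have "((\<lambda>v. v - s) has_vector_derivative 1) (at s)"
        by (auto intro!: derivative_eq_intros simp: has_real_derivative_iff_has_vector_derivative [symmetric])
      ultimately have "((\<psi> \<circ> (\<lambda>v. v - s)) has_vector_derivative 1 *\<^sub>R h (Suc a) s) (at s)"
        by (intro vector_diff_chain_at)
      moreover have "\<psi> \<circ> (\<lambda>v. v - s) = h a"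
        by (rule ext) (simp add: \<psi>_def h_def scaleR_diff_left)
      ultimately show ?thesis by simp
    qed
    \<comment> \<open>The expansion stops at degree \<open>k - 1\<close>, so that the remainder
      involves the derivative of order \<open>k\<close> and thus \<open>M k\<close>.\<close>
    define q where "q = (\<Sum>a\<le>k - 1. monom (h a 0 / fact a) a)"
    show "poly_approx k u (C0 * ((2 * \<sigma> * u) ^ k * lower M k)) (\<lambda>s. g (x + s *\<^sub>R axis i 1))"
      unfolding poly_approx_def
    proof (intro exI [of _ q] conjI allI impI)
      show "degree q \<le> k" unfolding q_def
        by (intro degree_sum_le) (auto intro: order_trans [OF degree_monom_le])
      fix s assume s: "\<bar>s\<bar> \<le> u"
      let ?S = "complex_of_real ` {-u..u}"
      have "norm ((\<lambda>a z. h a (Re z)) 0 (of_real s) - (\<Sum>a\<le>k - 1. (\<lambda>a z. h a (Re z)) a 0 * (of_real s - 0) ^ a / fact a))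
          \<le> (C0 * \<sigma> ^ k * M k) * norm (of_real s - (0::complex)) ^ Suc (k - 1) / fact (k - 1)"
      proof (rule field_Taylor)
        show "convex ?S" by (rule convex_linear_image) (auto intro: linear_of_real)
        fix z assume z: "z \<in> ?S"
        show "((\<lambda>z. h a (Re z)) has_field_derivative h (Suc a) (Re z)) (at z within ?S)" for a
          by (rule has_field_derivative_Re [OF vd]) (use z in auto)
        show "norm (h (Suc (k - 1)) (Re z)) \<le> C0 * \<sigma> ^ k * M k"
          using pure [OF seg, of "Re z"] z k unfolding h_def by auto
      qed (use s u in \<open>auto simp: image_iff\<close>)
      then have "norm (h 0 s - poly q (of_real s)) \<le> (C0 * \<sigma> ^ k * M k) * \<bar>s\<bar> ^ k / fact (k - 1)"
        using k by (simp add: q_def poly_sum poly_monom)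
      also have "\<dots> \<le> (C0 * \<sigma> ^ k * M k) * u ^ k / fact (k - 1)"
        using C0 \<sigma> M(1) [of k] s by (intro divide_right_mono mult_left_mono power_mono) auto
      also have "\<dots> = (C0 * \<sigma> ^ k * M k) * u ^ k * (real k / fact k)"
        using k by (simp add: fact_reduce [of k])
      also have "\<dots> \<le> (C0 * \<sigma> ^ k * M k) * u ^ k * (2 ^ k / fact k)"
        using C0 \<sigma> M(1) [of k] u less_imp_le [OF of_nat_less_two_power [of k, where 'a = real]]
        by (intro mult_left_mono divide_right_mono) auto
      also have "\<dots> = C0 * ((2 * \<sigma> * u) ^ k * lower M k)" unfolding lower_def by (simp add: power_mult_distrib)
      finally show "norm (g (x + s *\<^sub>R axis i 1) - poly q (of_real s)) \<le> C0 * ((2 * \<sigma> * u) ^ k * lower M k)"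
        unfolding h_def by simp
    qed
  qed
qed

section \<open>Comparison of classes and consequences of moderate growth\<close>

lemma B_sigma_mono:
  assumes "B_sigma M \<sigma> V g" "0 < \<sigma>" "\<sigma> \<le> \<tau>" "\<And>k. 0 < M k" "\<And>k. M k \<le> N k"
  shows "B_sigma N \<tau> V g"
proof -
  obtain C where sm: "smooth_on V g"
    and C: "\<And>x \<alpha>. x \<in> V \<Longrightarrow> norm (deriv_multi \<alpha> g x) \<le> C * \<sigma> ^ mi_len \<alpha> * M (mi_len \<alpha>)"
    using assms(1) unfolding B_sigma_def by blast
  have "norm (deriv_multi \<alpha> g x) \<le> max C 0 * \<tau> ^ mi_len \<alpha> * N (mi_len \<alpha>)" if "x \<in> V" for x \<alpha>
    using assms(2,3) less_imp_le [OF assms(4)] assms(5)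
    by (intro order_trans [OF C [OF that]] mult_mono power_mono) auto
  then show ?thesis using sm unfolding B_sigma_def by blast
qed

lemma B_sigma_subset: "B_sigma M \<sigma> U f \<Longrightarrow> V \<subseteq> U \<Longrightarrow> B_sigma M \<sigma> V f"
  unfolding B_sigma_def smooth_on_def by (meson continuous_on_subset subsetD)

lemma mg_finiteD:
  assumes mg: "mg_finite M N" and M: "weight_seq M" and N: "weight_seq N"
  obtains C where "1 \<le> C" "\<And>j k. M (j + k) \<le> C ^ (j + k) * (N j * N k)"
proof -
  obtain C where C: "\<And>j k. 1 \<le> j + k \<Longrightarrow> (M (j + k) / (N j * N k)) powr (1 / real (j + k)) \<le> C"
    using mg unfolding mg_finite_def by blast
  have pos: "0 < M k" "0 < N k" "M 0 = 1" "N 0 = 1" for k using M N unfolding weight_seq_def by auto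
  have "M (j + k) \<le> max 1 C ^ (j + k) * (N j * N k)" for j k
  proof (cases "j + k = 0")
    case False
    define n where "n = j + k"
    define x where "x = M n / (N j * N k)"
    have x: "0 < x" unfolding x_def using pos by simp
    have n: "1 \<le> n" using False unfolding n_def by linarith
    have xC: "x powr (1 / real n) \<le> C" using C [OF n [unfolded n_def]] unfolding x_def n_def .
    have "x = (x powr (1 / real n)) powr real n" using n x by (simp add: powr_powr)
    also have "\<dots> \<le> max 1 C powr real n"
      using xC by (intro powr_mono2) auto
    also have "\<dots> = max 1 C ^ n" by (rule powr_realpow) simp
    finally have "M n \<le> max 1 C ^ n * (N j * N k)" unfolding x_def using pos by (simp add: pos_divide_le_eq)
    then show ?thesis unfolding n_def .
  qed (use pos in auto)
  then show thesis by (intro that [of "max 1 C"]) auto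
qed

text \<open>The quotient of the two sides is a multinomial coefficient.\<close>

lemma fact_power_le: "(fact a :: real) ^ q \<le> fact (q * a)"
proof (induction q)
  case (Suc q)
  have "(fact a :: real) ^ Suc q \<le> fact a * fact (q * a)" using Suc by (auto intro: mult_left_mono)
  also have "\<dots> \<le> fact (a + q * a)"
    using dvd_imp_le [OF fact_fact_dvd_fact [of a "q * a"]]
    by (simp add: of_nat_le_iff [symmetric, where 'a = real] del: of_nat_le_iff)
  finally show ?case by simp
qed simp

text \<open>With two equal indices, moderate growth bounds \<open>M (2 * b)\<close> by the square of
  \<open>N b\<close> up to a constant to the power \<open>2 * b\<close>. Each of the
  \<open>p\<close> doublings may move to another sequence of the matrix.\<close>

lemma iterated_moderate_growth:
  assumes W: "\<And>M. M \<in> W \<Longrightarrow> weight_seq M" and mg: "R_moderate_growth W" and M: "M \<in> W"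
  shows "\<exists>N\<in>W. \<exists>C\<ge>1. \<forall>a. M (2 ^ p * a) \<le> C ^ (2 ^ p * a) * N a ^ (2 ^ p)"
  using M
proof (induction p arbitrary: M)
  case 0
  then show ?case by (intro bexI [of _ M] exI [of _ 1]) auto
next
  case (Suc p)
  obtain N where N: "N \<in> W" "mg_finite M N" using mg Suc.prems unfolding R_moderate_growth_def by blast
  obtain C where C: "1 \<le> C" "\<And>j k. M (j + k) \<le> C ^ (j + k) * (N j * N k)"
    using mg_finiteD [OF N(2) W [OF Suc.prems] W [OF N(1)]] by blast
  obtain N' C' where N': "N' \<in> W" "1 \<le> C'" "\<And>a. N (2 ^ p * a) \<le> C' ^ (2 ^ p * a) * N' a ^ (2 ^ p)"
    using Suc.IH [OF N(1)] by blast
  have pos: "0 < N k" "0 < N' k" for k using W [OF N(1)] W [OF N'(1)] unfolding weight_seq_def by auto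
  have "M (2 ^ Suc p * a) \<le> (C * C') ^ (2 ^ Suc p * a) * N' a ^ (2 ^ Suc p)" for a
  proof -
    let ?b = "2 ^ p * a"
    have "2 ^ Suc p * a = ?b + ?b" by simp
    then have "M (2 ^ Suc p * a) \<le> C ^ (2 ^ Suc p * a) * (N ?b * N ?b)" using C(2) [of ?b ?b] by (simp only:)
    also have "\<dots> \<le> C ^ (2 ^ Suc p * a) * ((C' ^ ?b * N' a ^ (2 ^ p)) * (C' ^ ?b * N' a ^ (2 ^ p)))"
      using C(1) N'(2) less_imp_le [OF pos(1)] less_imp_le [OF pos(2)]
      by (intro mult_left_mono mult_mono N'(3)) auto
    also have "(C' ^ ?b * N' a ^ (2 ^ p)) * (C' ^ ?b * N' a ^ (2 ^ p)) = C' ^ (2 ^ Suc p * a) * N' a ^ (2 ^ Suc p)"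
    proof -
      have e1: "2 ^ Suc p * a = ?b + ?b" and e2: "(2::nat) ^ Suc p = 2 ^ p + 2 ^ p" by simp_all
      show ?thesis unfolding e1 unfolding e2 power_add by (simp only: mult_ac)
    qed
    finally show ?thesis by (simp only: power_mult_distrib mult.assoc)
  qed
  moreover have "1 \<le> C * C'" using C(1) N'(2) mult_mono [of 1 C 1 C'] by simp
  ultimately show ?case using N'(1) by blast
qed

text \<open>All but finitely many roots are at least 1, and the others have a positive
  minimum.\<close>

lemma root_lower_bound:
  assumes lim: "filterlim (\<lambda>k. root k (lower M k)) at_top sequentially" and pos: "\<And>k. 0 < M k"
  obtains c where "0 < c" "c \<le> 1" "\<And>k. 1 \<le> k \<Longrightarrow> c \<le> root k (lower M k)"
proof -
  obtain n where n: "\<And>k. n \<le> k \<Longrightarrow> 1 \<le> root k (lower M k)"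
    using lim unfolding filterlim_at_top eventually_sequentially by blast
  define c where "c = Min (insert 1 ((\<lambda>k. root k (lower M k)) ` {1..n}))"
  show thesis
  proof (rule that [of c])
    show "0 < c" unfolding c_def using pos by (auto simp: lower_def)
    show "c \<le> 1" unfolding c_def by (intro Min_le) auto
    show "c \<le> root k (lower M k)" if "1 \<le> k" for k
    proof (cases "k \<le> n")
      case True
      then show ?thesis unfolding c_def using that by (intro Min_le) auto
    next
      case False
      then show ?thesis using n [of k] \<open>c \<le> 1\<close> by linarith
    qed
  qed
qed

theorem theorem4p3:
  fixes W :: "(nat \<Rightarrow> real) set"
  assumes "weight_matrix W"
    and "R_regular W"
    and "R_moderate_growth W"
    and "\<exists>M\<in>W. summable (\<lambda>k. 1 / mu M (Suc k))"
  shows "property_D (germ_E W :: (real^'n::finite \<Rightarrow> complex) \<Rightarrow> bool)"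
  unfolding property_D_def
proof (intro allI impI, elim conjE)
  fix f :: "real^'n \<Rightarrow> complex" and j :: nat
  assume j: "1 \<le> j" and f1: "germ_E W (\<lambda>x. f x ^ j)" and f2: "germ_E W (\<lambda>x. f x ^ (j + 1))"
  have W: "weight_seq M" if "M \<in> W" for M using assms(1) that unfolding weight_matrix_def by blast
  have pos: "0 < M k" "M 0 = 1" if "M \<in> W" for M k using W [OF that] unfolding weight_seq_def by auto
  have rt: "filterlim (\<lambda>k. root k (lower M k)) at_top sequentially" if "M \<in> W" for M
    using assms(2) that unfolding R_regular_def by blast
  obtain U1 where U1: "open U1" "0 \<in> U1" "E_roum W U1 (\<lambda>x. f x ^ j)" using f1 unfolding germ_E_def by blast
  obtain U2 where U2: "open U2" "0 \<in> U2" "E_roum W U2 (\<lambda>x. f x ^ (j + 1))" using f2 unfolding germ_E_def by blast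
  have "open (U1 \<inter> U2)" "0 \<in> U1 \<inter> U2" using U1 U2 by auto
  then obtain \<rho> where \<rho>: "0 < \<rho>" "cball 0 \<rho> \<subseteq> U1 \<inter> U2" using open_contains_cball by blast
  define V :: "(real^'n) set" where "V = ball 0 \<rho>"
  have V: "open V" "compact (closure V)" "closure V \<subseteq> U1" "closure V \<subseteq> U2"
    using \<rho> unfolding V_def by auto
  obtain M1 \<sigma>1 where M1: "M1 \<in> W" "0 < \<sigma>1" "B_sigma M1 \<sigma>1 V (\<lambda>x. f x ^ j)"
    using U1(3) V unfolding E_roum_def B_roum_def by blast
  obtain M2 \<sigma>2 where M2: "M2 \<in> W" "0 < \<sigma>2" "B_sigma M2 \<sigma>2 V (\<lambda>x. f x ^ (j + 1))"
    using U2(3) V unfolding E_roum_def B_roum_def by blast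
  define \<sigma> where "\<sigma> = max \<sigma>1 \<sigma>2"
  have \<sigma>: "0 < \<sigma>" "\<sigma>1 \<le> \<sigma>" "\<sigma>2 \<le> \<sigma>" unfolding \<sigma>_def using M1 by auto
  \<comment> \<open>The matrix is totally ordered, so the larger of the two sequences serves both
    powers of \<open>f\<close>.\<close>
  have "\<exists>M\<in>W. (\<forall>k. M1 k \<le> M k) \<and> (\<forall>k. M2 k \<le> M k)"
    using assms(1) M1(1) M2(1) unfolding weight_matrix_def by (metis order_refl)
  then obtain M where M: "M \<in> W" "\<And>k. M1 k \<le> M k" "\<And>k. M2 k \<le> M k" by blast
  have B1: "B_sigma M \<sigma> V (\<lambda>x. f x ^ j)"
    by (rule B_sigma_mono [OF M1(3,2) \<sigma>(2) pos(1) [OF M1(1)] M(2)])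
  have B2: "B_sigma M \<sigma> V (\<lambda>x. f x ^ (j + 1))"
    by (rule B_sigma_mono [OF M2(3,2) \<sigma>(3) pos(1) [OF M2(1)] M(3)])
  obtain C1 where C1: "\<And>x. x \<in> V \<Longrightarrow> norm (f x ^ j) \<le> C1"
    "\<And>x i u k. 1 \<le> k \<Longrightarrow> 0 < u \<Longrightarrow> (\<And>s. \<bar>s\<bar> \<le> u \<Longrightarrow> x + s *\<^sub>R axis i 1 \<in> V)
      \<Longrightarrow> poly_approx k u (C1 * ((2 * \<sigma> * u) ^ k * lower M k)) (\<lambda>s. f (x + s *\<^sub>R axis i 1) ^ j)"
    using B_sigma_taylor [OF B1 \<sigma>(1) pos [OF M(1)]] by metis
  obtain C2 where C2:
    "\<And>x i u k. 1 \<le> k \<Longrightarrow> 0 < u \<Longrightarrow> (\<And>s. \<bar>s\<bar> \<le> u \<Longrightarrow> x + s *\<^sub>R axis i 1 \<in> V)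
      \<Longrightarrow> poly_approx k u (C2 * ((2 * \<sigma> * u) ^ k * lower M k)) (\<lambda>s. f (x + s *\<^sub>R axis i 1) ^ (j + 1))"
    using B_sigma_taylor [OF B2 \<sigma>(1) pos [OF M(1)]] by metis
  define A where "A = max 1 C1"
  define B where "B = max 1 (max C1 C2)"
  define r where "r = \<rho> / (4 * CARD('n))"
  have r: "0 < r" unfolding r_def using \<rho> by simp
  have inV: "x \<in> V" if "\<And>i. \<bar>x $ i\<bar> \<le> 2 * r" for x :: "real^'n"
  proof -
    have "norm x \<le> (\<Sum>i\<in>UNIV. \<bar>x $ i\<bar>)" by (rule norm_le_l1_cart)
    also have "\<dots> \<le> (\<Sum>i\<in>(UNIV :: 'n set). 2 * r)" by (intro sum_mono that)
    also have "\<dots> = \<rho> / 2" unfolding r_def by simp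
    finally show ?thesis using \<rho> unfolding V_def by simp
  qed
  obtain c0 where c0: "0 < c0" "\<And>k. 1 \<le> k \<Longrightarrow> c0 \<le> root k (lower M k)"
    using root_lower_bound [OF rt [OF M(1)] pos(1) [OF M(1)]] by blast
  have low: "0 < lower N k" if "N \<in> W" for N k using pos(1) [OF that] unfolding lower_def by simp
  define U where "U = {x :: real^'n. \<forall>i. \<bar>x $ i\<bar> < r}"
  have Y: "B * ((2 * \<sigma> * u) ^ k * lower M k) \<ge> C * ((2 * \<sigma> * u) ^ k * lower M k)"
    if "C \<le> B" "0 < u" for C u k
    using that \<sigma> low [OF M(1), of k] by (intro mult_right_mono) auto
  obtain p X where X: "1 \<le> X"
    "\<And>is. continuous_on U (iter_pd is f)"
    "\<And>is x i. x \<in> U \<Longrightarrow> (\<lambda>s. iter_pd is f (x + s *\<^sub>R axis i 1)) differentiable (at 0)"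
    "\<And>is x. x \<in> U \<Longrightarrow> norm (iter_pd is f x) \<le> X ^ (length is + 4) * fact (length is + 4)
        * max 1 (root (2 ^ p * (length is + 4)) (lower M (2 ^ p * (length is + 4)))) ^ (length is + 4)"
  proof (rule joris_derivative_bound [where f = f and m = "lower M" and j = j and A = A and B = B
        and \<sigma> = \<sigma> and r = r and ?c0.0 = c0, folded U_def])
    show "norm (f x) \<le> A" if "\<And>i. \<bar>x $ i\<bar> \<le> 2 * r" for x
    proof -
      have "norm (f x) ^ j \<le> A" using C1(1) [OF inV [OF that]] unfolding A_def norm_power by simp
      also have "A \<le> A ^ j" using j unfolding A_def by (intro self_le_power) auto
      finally have "norm (f x) ^ Suc (j - 1) \<le> A ^ Suc (j - 1)" using j by simp
      then show ?thesis by (rule power_le_imp_le_base) (simp add: A_def)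
    qed
    fix z :: "real^'n" and i u and k :: nat
    assume *: "1 \<le> k" "0 < u" "\<And>s i'. \<bar>s\<bar> \<le> u \<Longrightarrow> \<bar>(z + s *\<^sub>R axis i 1) $ i'\<bar> \<le> 2 * r"
    have seg: "z + s *\<^sub>R axis i 1 \<in> V" if "\<bar>s\<bar> \<le> u" for s by (rule inV) (rule *(3) [OF that])
    have CB: "C1 \<le> B" "C2 \<le> B" unfolding B_def by auto
    show "poly_approx k u (B * ((2 * \<sigma> * u) ^ k * lower M k)) (\<lambda>s. f (z + s *\<^sub>R axis i 1) ^ j)"
      by (rule poly_approx_mono [OF C1(2) [OF *(1,2) seg] Y [OF CB(1) *(2)]])
    show "poly_approx k u (B * ((2 * \<sigma> * u) ^ k * lower M k)) (\<lambda>s. f (z + s *\<^sub>R axis i 1) ^ (j + 1))"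
      by (rule poly_approx_mono [OF C2 [OF *(1,2) seg] Y [OF CB(2) *(2)]])
  qed (use j \<sigma> r c0 low [OF M(1)] in \<open>auto simp: A_def B_def\<close>)
  obtain N C where N: "N \<in> W" "1 \<le> C" "\<And>a. M (2 ^ p * a) \<le> C ^ (2 ^ p * a) * N a ^ (2 ^ p)"
    using iterated_moderate_growth [OF W assms(3) M(1)] by blast
  \<comment> \<open>The constant \<open>c\<close> is for \<open>\<mu> < 1\<close>: then
    \<open>max 1 \<mu> ^ b = 1\<close>, which is at most
    \<open>(1 / c) ^ b * lower N b\<close>.\<close>
  obtain c where c: "0 < c" "c \<le> 1" "\<And>k. 1 \<le> k \<Longrightarrow> c \<le> root k (lower N k)"
    using root_lower_bound [OF rt [OF N(1)] pos(1) [OF N(1)]] by blast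
  \<comment> \<open>A last use of moderate growth removes the shift by 4 in the order:
    \<open>N (a + 4)\<close> is compared with \<open>N' a * N' 4\<close>.\<close>
  obtain N' where N': "N' \<in> W" "mg_finite N N'" using assms(3) N(1) unfolding R_moderate_growth_def by blast
  obtain C3 where C3: "1 \<le> C3" "\<And>j k. N (j + k) \<le> C3 ^ (j + k) * (N' j * N' k)"
    using mg_finiteD [OF N'(2) W [OF N(1)] W [OF N'(1)]] by blast
  define Z where "Z = X * (C / c) * C3"
  have Z: "0 < Z" unfolding Z_def using X(1) N(2) c(1) C3(1) by simp
  have bound: "norm (iter_pd is f x) \<le> (Z ^ 4 * N' 4) * Z ^ length is * N' (length is)" if x: "x \<in> U" for x and "is" :: "'n list"
  proof -
    define b where "b = length is + 4"
    define k where "k = 2 ^ p * b"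
    define \<mu> where "\<mu> = root k (lower M k)"
    have b: "1 \<le> b" "1 \<le> k" unfolding b_def k_def by auto
    have \<mu>: "0 < \<mu>" using c0(1) c0(2) [OF b(2)] unfolding \<mu>_def by linarith
    \<comment> \<open>As \<open>k = 2 ^ p * b\<close>, both sides of the growth bound become
      \<open>2 ^ p\<close>-th powers once \<open>fact k\<close> is replaced by
      \<open>fact b ^ 2 ^ p\<close>. The root gives
      \<open>\<mu> ^ b \<le> C ^ b * lower N b\<close>, and the factor \<open>fact b\<close> in the
      derivative bound turns \<open>lower N b\<close> into \<open>N b\<close>.\<close>
    have "\<mu> ^ k = lower M k" unfolding \<mu>_def using low [OF M(1), of k] b by (simp add: real_root_pow_pos2 less_imp_le)
    also have "\<dots> \<le> (C ^ k * N b ^ (2 ^ p)) / fact b ^ (2 ^ p)"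
      unfolding lower_def
    proof (rule frac_le)
      show "fact b ^ 2 ^ p \<le> (fact k :: real)" unfolding k_def by (rule fact_power_le)
      show "M k \<le> C ^ k * N b ^ 2 ^ p" unfolding k_def by (rule N(3))
      show "0 \<le> C ^ k * N b ^ 2 ^ p" using N(2) pos(1) [OF N(1), of b] by simp
    qed simp
    also have "\<dots> = (C ^ b * lower N b) ^ (2 ^ p)"
      unfolding lower_def k_def by (simp add: power_divide power_mult_distrib power_mult [symmetric] mult.commute)
    finally have "(\<mu> ^ b) ^ (2 ^ p) \<le> (C ^ b * lower N b) ^ (2 ^ p)"
      unfolding k_def by (simp add: power_mult [symmetric] mult.commute)
    then have \<mu>b: "\<mu> ^ b \<le> C ^ b * lower N b"
      using \<mu> N(2) low [OF N(1), of b] by (subst (asm) power_mono_iff) auto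
    have "c ^ b \<le> root b (lower N b) ^ b" using c b by (intro power_mono) auto
    also have "\<dots> = lower N b" using low [OF N(1), of b] b by (simp add: real_root_pow_pos2 less_imp_le)
    finally have cb: "c ^ b \<le> lower N b" .
    have "max 1 \<mu> ^ b \<le> (C / c) ^ b * lower N b"
    proof (cases "1 \<le> \<mu>")
      case True
      have "C ^ b * lower N b \<le> (C / c) ^ b * lower N b"
        using c N(2) low [OF N(1), of b] by (intro mult_right_mono power_mono) (auto simp: le_divide_eq mult_left_le)
      then show ?thesis using \<mu>b True by (simp add: max_def)
    next
      case False
      have "1 = (1 / c) ^ b * c ^ b" using c by (simp add: power_divide)
      also have "\<dots> \<le> (C / c) ^ b * lower N b"
        using c N(2) by (intro mult_mono power_mono cb divide_right_mono) auto
      finally show ?thesis using False by (simp add: max_def)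
    qed
    then have "X ^ b * fact b * max 1 \<mu> ^ b \<le> X ^ b * fact b * ((C / c) ^ b * lower N b)"
      using X(1) by (intro mult_left_mono) auto
    also have "\<dots> = (X * (C / c)) ^ b * N b" unfolding lower_def power_mult_distrib by simp
    also have "\<dots> \<le> (X * (C / c)) ^ b * (C3 ^ b * (N' (length is) * N' 4))"
      using X(1) N(2) c(1) unfolding b_def by (intro mult_left_mono C3(2)) auto
    also have "\<dots> = (Z ^ 4 * N' 4) * Z ^ length is * N' (length is)"
      unfolding Z_def b_def power_mult_distrib power_add by (simp only: mult_ac)
    finally show ?thesis using X(4) [OF x, of "is"] unfolding b_def k_def \<mu>_def by linarith
  qed
  have "B_sigma N' Z U f"
    unfolding B_sigma_def smooth_on_def
  proof (intro conjI allI ballI exI [of _ "Z ^ 4 * N' 4"])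
    fix x \<alpha> assume x: "x \<in> U"
    obtain "is" where "deriv_multi \<alpha> f = iter_pd is f" "length is = mi_len \<alpha>" by (rule deriv_multi_list)
    then show "norm (deriv_multi \<alpha> f x) \<le> Z ^ 4 * N' 4 * Z ^ mi_len \<alpha> * N' (mi_len \<alpha>)"
      using bound [OF x, of "is"] by simp
  qed (use X(2,3) in auto)
  then have "E_roum W U f"
    unfolding E_roum_def B_roum_def
    using N'(1) Z B_sigma_subset closure_subset by (meson order_trans)
  moreover have "open U"
  proof -
    have "open (\<Inter>i. {x :: real^'n. \<bar>x $ i\<bar> < r})"
      by (intro open_INT ballI open_Collect_less continuous_intros) auto
    moreover have "U = (\<Inter>i. {x. \<bar>x $ i\<bar> < r})" unfolding U_def by auto
    ultimately show ?thesis by simp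
  qed
  moreover have "0 \<in> U" unfolding U_def using r by simp
  ultimately show "germ_E W f" unfolding germ_E_def by blast
qed

end
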